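(* Assume that the LTONP interpolation problem with given data set $\{W,\widetilde W,Z\}$, where $W:\ell^2_+(\mathcal Y)\to\mathcal Z$, $\widetilde W:\ell^2_+(\mathcal U)\to\mathcal Z$, $Z:\mathcal Z\to\mathcal Z$, is solvable, i.e., the Pick operator $\Lambda=WW^*-\widetilde W\widetilde W^*$ is non-negative. Let $F_\circ\in\mathcal S(\mathcal U,\mathcal Y)$ be the central solution to this LTONP interpolation problem. Then $F_\circ$ is the unique maximal entropy solution, that is, if $F\in\mathcal S(\mathcal U,\mathcal Y)$ is any other solution to the LTONP interpolation problem, then $$\sigma_F(u)\le\sigma_{F_\circ}(u)\qquad(u\in\mathcal U).$$ Moreover, for a solution $F$ we have $\sigma_F(u)=\sigma_{F_\circ}(u)$ for all $u\in\mathcal U$ if and only if $F=F_\circ$, and the entropy for the central solution is given by $$\sigma_{F_\circ}(u)=\langle P_{\mathcal G}(u\oplus0),(u\oplus0)\rangle\qquad(u\in\mathcal U),$$ where $\mathcal G=(\mathcal U\oplus\mathcal Z_\circ)\ominus\mathcal F$ and $P_{\mathcal G}$ is the orthogonal projection of $\mathcal U\oplus\mathcal Z_\circ$ onto $\mathcal G$. Finally, if $\Lambda$ is strictly positive, then the entropy for the central solution is also determined by $$\sigma_{F_\circ}(u)=\bigl\langle(I+\widetilde B^*\Lambda^{-1}\widetilde B)^{-1}u,u\bigr\rangle\qquad(u\in\mathcal U),$$ where $\widetilde B=\widetilde WE_{\mathcal U}$.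
   Context: All spaces are complex Hilbert spaces and "operator" means bounded linear operator. An operator is strictly positive if it is non-negative and invertible. $\mathbb D$ is the open unit disc. For a Hilbert space $\mathcal V$, $\ell^2_+(\mathcal V)$ is the space of square summable unilateral sequences in $\mathcal V$, $S_{\mathcal V}$ is the unilateral forward shift on it, and $E_{\mathcal V}:\mathcal V\to\ell^2_+(\mathcal V)$, $E_{\mathcal V}v=(v,0,0,\dots)$. The Schur class $\mathcal S(\mathcal U,\mathcal Y)$ is the set of analytic functions $F$ on $\mathbb D$ with values operators from $\mathcal U$ to $\mathcal Y$ and $\sup_{\lambda\in\mathbb D}\|F(\lambda)\|\le1$; $T_F:\ell^2_+(\mathcal U)\to\ell^2_+(\mathcal Y)$ is the corresponding block lower triangular Toeplitz operator. An LTONP data set is a triple of operators $Z:\mathcal Z\to\mathcal Z$, $W:\ell^2_+(\mathcal Y)\to\mathcal Z$, $\widetilde W:\ell^2_+(\mathcal U)\to\mathcal Z$ with $ZW=WS_{\mathcal Y}$ and $Z\widetilde W=\widetilde WS_{\mathcal U}$. A solution of the LTONP interpolation problem is a function $F\in\mathcal S(\mathcal U,\mathcal Y)$ with $WT_F=\widetilde W$. Entropy: for $F\in\mathcal S(\mathcal U,\mathcal Y)$ and $u\in\mathcal U$, $$\sigma_F(u)=\inf\bigl\{\|u-E_{\mathcal U}^*T_F^*h\|^2+\langle(I-T_FT_F^* )h,h\rangle : h\in\ell^2_+(\mathcal Y)\bigr\}.$$ Central solution: put $B=WE_{\mathcal Y}$, $\widetilde B=\widetilde WE_{\mathcal U}$,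 $\mathcal Z_\circ=\overline{\operatorname{Im}\Lambda}$, $K_1=[\,\widetilde B\ \ \Lambda^{1/2}\,]:\mathcal U\oplus\mathcal Z\to\mathcal Z$, $K_2=[\,B\ \ Z\Lambda^{1/2}\,]:\mathcal Y\oplus\mathcal Z\to\mathcal Z$, $\mathcal F=\overline{\operatorname{Im}K_1^*}\subset\mathcal U\oplus\mathcal Z_\circ$, $\mathcal F'=\overline{\operatorname{Im}K_2^*}\subset\mathcal Y\oplus\mathcal Z_\circ$. Since $K_1K_1^*=K_2K_2^*$, there is a unique unitary operator $\omega:\mathcal F\to\mathcal F'$ with $\omega K_1^*=K_2^*$. Let $P_{\mathcal F}$ be the orthogonal projection of $\mathcal U\oplus\mathcal Z_\circ$ onto $\mathcal F$ and write $$\omega P_{\mathcal F}=\begin{bmatrix}\delta_\circ&\gamma_\circ\\ \beta_\circ&\alpha_\circ\end{bmatrix}:\begin{bmatrix}\mathcal U\\ \mathcal Z_\circ\end{bmatrix}\to\begin{bmatrix}\mathcal Y\\ \mathcal Z_\circ\end{bmatrix}.$$ The central solution is $F_\circ(\lambda)=\delta_\circ+\lambda\gamma_\circ(I_{\mathcal Z_\circ}-\lambda\alpha_\circ)^{-1}\beta_\circ$, $\lambda\in\mathbb D$. *)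

theory Defs
  imports "HOL-Analysis.Analysis"
begin

text \<open>
  A complex Hilbert space is presented as a complete \<^class>\<open>real_inner\<close> space carrying a
  compatible complex scalar multiplication and a complex inner product whose real part is the
  given real one; norm, topology and completeness are therefore the library's.
  The complex inner product is linear in its first argument.
\<close>

class chilbert_space = real_inner + complete_space +
  fixes scaleC :: "complex \<Rightarrow> 'a \<Rightarrow> 'a" (infixr "*\<^sub>C" 75)
    and cinner :: "'a \<Rightarrow> 'a \<Rightarrow> complex"
  assumes scaleC_add_right: "a *\<^sub>C (x + y) = a *\<^sub>C x + a *\<^sub>C y"
    and scaleC_add_left: "(a + b) *\<^sub>C x = a *\<^sub>C x + b *\<^sub>C x"
    and scaleC_scaleC: "a *\<^sub>C b *\<^sub>C x = (a * b) *\<^sub>C x"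
    and scaleC_of_real: "complex_of_real r *\<^sub>C x = r *\<^sub>R x"
    and cinner_commute: "cinner x y = cnj (cinner y x)"
    and cinner_add_left: "cinner (x + y) z = cinner x z + cinner y z"
    and cinner_scaleC_left: "cinner (a *\<^sub>C x) y = a * cinner x y"
    and Re_cinner: "Re (cinner x y) = inner x y"

lemma Im_cinner: "Im (cinner x y) = - inner (\<i> *\<^sub>C x) y"
  for x :: "'a::chilbert_space"
  by (simp flip: Re_cinner add: cinner_scaleC_left)

lemma norm_scaleC: "norm (a *\<^sub>C x) = norm a * norm x"
  for x :: "'a::chilbert_space"
proof -
  have r: "cinner y y = complex_of_real (inner y y)" for y :: 'a
    using cinner_commute[of y y] by (simp add: complex_eq_iff Re_cinner)
  have "cinner (a *\<^sub>C x) (a *\<^sub>C x) = a * cnj a * cinner x x"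
    by (metis cinner_commute cinner_scaleC_left complex_cnj_mult mult.assoc mult.left_commute)
  then have "complex_of_real (inner (a *\<^sub>C x) (a *\<^sub>C x))
      = complex_of_real ((norm a)\<^sup>2 * inner x x)"
    by (simp only: r complex_norm_square[symmetric] of_real_mult)
  then have "inner (a *\<^sub>C x) (a *\<^sub>C x) = (norm a)\<^sup>2 * inner x x"
    using of_real_eq_iff by blast
  then show ?thesis
    by (simp add: norm_eq_sqrt_inner real_sqrt_mult)
qed

instantiation prod :: (chilbert_space, chilbert_space) chilbert_space
begin

definition scaleC_prod :: "complex \<Rightarrow> 'a \<times> 'b \<Rightarrow> 'a \<times> 'b"
  where "scaleC_prod a x = (a *\<^sub>C fst x, a *\<^sub>C snd x)"

definition cinner_prod :: "'a \<times> 'b \<Rightarrow> 'a \<times> 'b \<Rightarrow> complex"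
  where "cinner_prod x y = cinner (fst x) (fst y) + cinner (snd x) (snd y)"

instance
proof
  fix a b :: complex and r :: real and x y z :: "'a \<times> 'b"
  show "a *\<^sub>C (x + y) = a *\<^sub>C x + a *\<^sub>C y"
    by (simp add: scaleC_prod_def scaleC_add_right)
  show "(a + b) *\<^sub>C x = a *\<^sub>C x + b *\<^sub>C x"
    by (simp add: scaleC_prod_def scaleC_add_left)
  show "a *\<^sub>C b *\<^sub>C x = (a * b) *\<^sub>C x"
    by (simp add: scaleC_prod_def scaleC_scaleC)
  show "complex_of_real r *\<^sub>C x = r *\<^sub>R x"
    by (simp add: scaleC_prod_def scaleC_of_real scaleR_prod_def)
  show "cinner x y = cnj (cinner y x)"
    by (simp add: cinner_prod_def flip: cinner_commute)
  show "cinner (x + y) z = cinner x z + cinner y z"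
    by (simp add: cinner_prod_def cinner_add_left)
  show "cinner (a *\<^sub>C x) y = a * cinner x y"
    by (simp add: scaleC_prod_def cinner_prod_def cinner_scaleC_left distrib_left)
  show "Re (cinner x y) = inner x y"
    by (simp add: cinner_prod_def inner_prod_def Re_cinner)
qed

end

typedef (overloaded) 'a ell2 = "{x :: nat \<Rightarrow> 'a::real_normed_vector. summable (\<lambda>n. (norm (x n))\<^sup>2)}"
  morphisms ell2_nth Abs_ell2
  by (rule exI[of _ "\<lambda>_. 0"]) simp

setup_lifting type_definition_ell2

lemma summable_norm2_ell2: "summable (\<lambda>n. (norm (ell2_nth x n))\<^sup>2)"
  using ell2_nth[of x] by simp

lemma ell2_eqI: "(\<And>n. ell2_nth x n = ell2_nth y n) \<Longrightarrow> x = y"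
  by (simp add: ell2_nth_inject[symmetric] fun_eq_iff)

lemma summable_norm2_add:
  fixes x y :: "nat \<Rightarrow> 'a::real_normed_vector"
  assumes "summable (\<lambda>n. (norm (x n))\<^sup>2)" "summable (\<lambda>n. (norm (y n))\<^sup>2)"
  shows "summable (\<lambda>n. (norm (x n + y n))\<^sup>2)"
proof (rule summable_comparison_test')
  show "summable (\<lambda>n. 2 * (norm (x n))\<^sup>2 + 2 * (norm (y n))\<^sup>2)"
    using assms by (intro summable_add summable_mult)
  show "norm ((norm (x n + y n))\<^sup>2) \<le> 2 * (norm (x n))\<^sup>2 + 2 * (norm (y n))\<^sup>2"
    if "n \<ge> 0" for n
  proof -
    have "(norm (x n + y n))\<^sup>2 \<le> (norm (x n) + norm (y n))\<^sup>2"
      by (intro power_mono norm_triangle_ineq norm_ge_zero)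
    also have "\<dots> \<le> 2 * (norm (x n))\<^sup>2 + 2 * (norm (y n))\<^sup>2"
      using sum_squares_bound[of "norm (x n)" "norm (y n)"] by (simp add: power2_sum)
    finally show ?thesis by simp
  qed
qed

lemma summable_norm_mult:
  fixes x y :: "nat \<Rightarrow> 'a::real_normed_vector"
  assumes "summable (\<lambda>n. (norm (x n))\<^sup>2)" "summable (\<lambda>n. (norm (y n))\<^sup>2)"
  shows "summable (\<lambda>n. norm (x n) * norm (y n))"
proof (rule summable_comparison_test')
  show "summable (\<lambda>n. (norm (x n))\<^sup>2 + (norm (y n))\<^sup>2)"
    using assms by (rule summable_add)
  show "norm (norm (x n) * norm (y n)) \<le> (norm (x n))\<^sup>2 + (norm (y n))\<^sup>2"
    if "n \<ge> 0" for n
  proof -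
    have "0 \<le> norm (x n) * norm (y n)"
      by simp
    moreover have "2 * (norm (x n) * norm (y n)) \<le> (norm (x n))\<^sup>2 + (norm (y n))\<^sup>2"
      using sum_squares_bound[of "norm (x n)" "norm (y n)"] by (simp only: mult.assoc)
    ultimately show ?thesis
      unfolding real_norm_def by linarith
  qed
qed

instantiation ell2 :: (real_normed_vector) real_vector
begin

lift_definition zero_ell2 :: "'a ell2" is "\<lambda>_. 0" by simp
lift_definition plus_ell2 :: "'a ell2 \<Rightarrow> 'a ell2 \<Rightarrow> 'a ell2" is "\<lambda>x y n. x n + y n"
  by (rule summable_norm2_add)
lift_definition uminus_ell2 :: "'a ell2 \<Rightarrow> 'a ell2" is "\<lambda>x n. - x n" by simp
lift_definition minus_ell2 :: "'a ell2 \<Rightarrow> 'a ell2 \<Rightarrow> 'a ell2" is "\<lambda>x y n. x n - y n"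
  by (drule summable_norm2_add[where y = "\<lambda>n. - y n" for y]) simp_all
lift_definition scaleR_ell2 :: "real \<Rightarrow> 'a ell2 \<Rightarrow> 'a ell2" is "\<lambda>r x n. r *\<^sub>R x n"
  by (simp add: power_mult_distrib summable_mult)

instance
proof
  fix a b :: real and x y z :: "'a ell2"
  show "x + y + z = x + (y + z)" by transfer (simp add: add.assoc)
  show "x + y = y + x" by transfer (simp add: add.commute)
  show "0 + x = x" by transfer simp
  show "- x + x = 0" by transfer simp
  show "x - y = x + - y" by transfer simp
  show "a *\<^sub>R (x + y) = a *\<^sub>R x + a *\<^sub>R y" by transfer (simp add: scaleR_add_right)
  show "(a + b) *\<^sub>R x = a *\<^sub>R x + b *\<^sub>R x" by transfer (simp add: scaleR_add_left)
  show "a *\<^sub>R b *\<^sub>R x = (a * b) *\<^sub>R x" by transfer simp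
  show "1 *\<^sub>R x = x" by transfer simp
qed

end

instantiation ell2 :: (real_inner) real_inner
begin

definition inner_ell2 :: "'a ell2 \<Rightarrow> 'a ell2 \<Rightarrow> real"
  where "inner_ell2 x y = (\<Sum>n. inner (ell2_nth x n) (ell2_nth y n))"
definition norm_ell2 :: "'a ell2 \<Rightarrow> real"
  where "norm_ell2 x = sqrt (inner x x)"
definition dist_ell2 :: "'a ell2 \<Rightarrow> 'a ell2 \<Rightarrow> real"
  where "dist_ell2 x y = norm (x - y)"
definition sgn_ell2 :: "'a ell2 \<Rightarrow> 'a ell2"
  where "sgn_ell2 x = inverse (norm x) *\<^sub>R x"
definition uniformity_ell2 :: "('a ell2 \<times> 'a ell2) filter"
  where "uniformity_ell2 = (INF e\<in>{0 <..}. principal {(x, y). dist x y < e})"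
definition open_ell2 :: "'a ell2 set \<Rightarrow> bool"
  where "open_ell2 S \<longleftrightarrow> (\<forall>x\<in>S. \<forall>\<^sub>F (x', y) in uniformity. x' = x \<longrightarrow> y \<in> S)"

lemma summable_inner_ell2: "summable (\<lambda>n. inner (ell2_nth x n) (ell2_nth y n))"
  for x y :: "'a ell2"
proof (rule summable_comparison_test')
  show "summable (\<lambda>n. norm (ell2_nth x n) * norm (ell2_nth y n))"
    by (intro summable_norm_mult summable_norm2_ell2)
  show "norm (inner (ell2_nth x n) (ell2_nth y n)) \<le> norm (ell2_nth x n) * norm (ell2_nth y n)"
    if "n \<ge> 0" for n
    using Cauchy_Schwarz_ineq2 by simp
qed

instance
proof
  fix x y z :: "'a ell2" and r :: real and U :: "'a ell2 set"
  show "dist x y = norm (x - y)"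
    by (rule dist_ell2_def)
  show "sgn x = inverse (norm x) *\<^sub>R x"
    by (rule sgn_ell2_def)
  show "(uniformity :: ('a ell2 \<times> 'a ell2) filter)
      = (INF e\<in>{0 <..}. principal {(x, y). dist x y < e})"
    by (rule uniformity_ell2_def)
  show "open U \<longleftrightarrow> (\<forall>x\<in>U. \<forall>\<^sub>F (x', y) in uniformity. x' = x \<longrightarrow> y \<in> U)"
    by (rule open_ell2_def)
  show "inner x y = inner y x"
    by (simp add: inner_ell2_def inner_commute)
  show "inner (x + y) z = inner x z + inner y z"
    unfolding inner_ell2_def plus_ell2.rep_eq inner_add_left
    by (intro suminf_add[symmetric] summable_inner_ell2)
  show "inner (r *\<^sub>R x) y = r * inner x y"
    unfolding inner_ell2_def scaleR_ell2.rep_eq inner_scaleR_left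
    by (intro suminf_mult summable_inner_ell2)
  show "0 \<le> inner x x"
    unfolding inner_ell2_def by (intro suminf_nonneg summable_inner_ell2) simp
  show "inner x x = 0 \<longleftrightarrow> x = 0"
    unfolding inner_ell2_def
    by (subst suminf_eq_zero_iff[OF summable_inner_ell2])
       (auto intro: ell2_eqI simp: zero_ell2.rep_eq)
  show "norm x = sqrt (inner x x)"
    by (rule norm_ell2_def)
qed

end

lemma norm2_ell2: "(norm x)\<^sup>2 = (\<Sum>n. (norm (ell2_nth x n))\<^sup>2)"
  for x :: "'a::real_inner ell2"
  by (simp add: power2_norm_eq_inner inner_ell2_def)

lemma norm_nth_le_ell2: "norm (ell2_nth x n) \<le> norm x"
  for x :: "'a::real_inner ell2"
proof (rule power2_le_imp_le)
  show "(norm (ell2_nth x n))\<^sup>2 \<le> (norm x)\<^sup>2"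
    using sum_le_suminf[OF summable_norm2_ell2[of x], of "{n}"] by (simp add: norm2_ell2)
qed simp

instance ell2 :: ("{real_inner, complete_space}") complete_space
proof
  fix X :: "nat \<Rightarrow> 'a ell2"
  assume X: "Cauchy X"
  have "Cauchy (\<lambda>m. ell2_nth (X m) n)" for n
  proof (rule metric_CauchyI)
    fix e :: real assume "0 < e"
    then obtain N where N: "\<And>m k. m \<ge> N \<Longrightarrow> k \<ge> N \<Longrightarrow> dist (X m) (X k) < e"
      using X by (meson metric_CauchyD)
    have "dist (ell2_nth (X m) n) (ell2_nth (X k) n) \<le> dist (X m) (X k)" for m k
      using norm_nth_le_ell2[of "X m - X k" n] by (simp add: dist_norm minus_ell2.rep_eq)
    with N show "\<exists>N. \<forall>m\<ge>N. \<forall>k\<ge>N. dist (ell2_nth (X m) n) (ell2_nth (X k) n) < e"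
      by (meson le_less_trans)
  qed
  then have "\<forall>n. \<exists>a. (\<lambda>m. ell2_nth (X m) n) \<longlonglongrightarrow> a"
    by (simp add: Cauchy_convergent flip: convergent_def)
  then have "\<exists>l. \<forall>n. (\<lambda>m. ell2_nth (X m) n) \<longlonglongrightarrow> l n"
    by (rule choice)
  then obtain l where l: "\<And>n. (\<lambda>m. ell2_nth (X m) n) \<longlonglongrightarrow> l n"
    by blast
  have bound: "\<exists>N. \<forall>m\<ge>N. \<forall>M. (\<Sum>n<M. (norm (ell2_nth (X m) n - l n))\<^sup>2) \<le> e\<^sup>2"
    if "e > 0" for e
  proof -
    obtain N where N: "\<And>m k. m \<ge> N \<Longrightarrow> k \<ge> N \<Longrightarrow> dist (X m) (X k) < e"
      using X \<open>e > 0\<close> by (meson metric_CauchyD)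
    have "(\<Sum>n<M. (norm (ell2_nth (X m) n - l n))\<^sup>2) \<le> e\<^sup>2" if "m \<ge> N" for m M
    proof (rule tendsto_upperbound)
      show "(\<lambda>k. \<Sum>n<M. (norm (ell2_nth (X m) n - ell2_nth (X k) n))\<^sup>2)
          \<longlonglongrightarrow> (\<Sum>n<M. (norm (ell2_nth (X m) n - l n))\<^sup>2)"
        by (intro tendsto_intros l)
      have "(\<Sum>n<M. (norm (ell2_nth (X m) n - ell2_nth (X k) n))\<^sup>2) \<le> e\<^sup>2" if "k \<ge> N" for k
      proof -
        have "(\<Sum>n<M. (norm (ell2_nth (X m - X k) n))\<^sup>2) \<le> (norm (X m - X k))\<^sup>2"
          unfolding norm2_ell2 by (intro sum_le_suminf summable_norm2_ell2) auto
        also have "\<dots> \<le> e\<^sup>2"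
          using N[OF \<open>m \<ge> N\<close> that] by (intro power_mono) (simp_all add: dist_norm)
        finally show ?thesis by (simp add: minus_ell2.rep_eq)
      qed
      then show "\<forall>\<^sub>F k in sequentially.
          (\<Sum>n<M. (norm (ell2_nth (X m) n - ell2_nth (X k) n))\<^sup>2) \<le> e\<^sup>2"
        by (auto simp: eventually_sequentially)
    qed simp
    then show ?thesis by blast
  qed
  have summ: "summable (\<lambda>n. (norm (ell2_nth (X m) n - l n))\<^sup>2)"
    if "\<And>M. (\<Sum>n<M. (norm (ell2_nth (X m) n - l n))\<^sup>2) \<le> e\<^sup>2" for m e
    using that[of "Suc n" for n]
    by (intro bounded_imp_summable[where B = "e\<^sup>2"]) (simp_all only: lessThan_Suc_atMost zero_le_power2)
  obtain N where "\<And>M. (\<Sum>n<M. (norm (ell2_nth (X N) n - l n))\<^sup>2) \<le> 1\<^sup>2"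
    using bound[of 1] by auto
  from summable_norm2_add[OF summable_norm2_ell2[of "- X N"] summ[OF this]]
  have "summable (\<lambda>n. (norm (l n))\<^sup>2)"
    by (simp add: uminus_ell2.rep_eq)
  then have "ell2_nth (Abs_ell2 l) = l"
    by (simp add: Abs_ell2_inverse)
  then obtain L where L: "\<And>n. ell2_nth L n = l n"
    by (metis (no_types))
  have "X \<longlonglongrightarrow> L"
  proof (rule metric_LIMSEQ_I)
    fix e :: real assume "0 < e"
    then obtain N where N: "\<And>m M. m \<ge> N \<Longrightarrow> (\<Sum>n<M. (norm (ell2_nth (X m) n - l n))\<^sup>2) \<le> (e/2)\<^sup>2"
      using bound[of "e/2"] by auto
    have "dist (X m) L < e" if "m \<ge> N" for m
    proof -
      have "(norm (X m - L))\<^sup>2 \<le> (e/2)\<^sup>2"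
        unfolding norm2_ell2 minus_ell2.rep_eq L
        using N[OF that] summ[OF N[OF that]] by (intro suminf_le_const)
      then have "norm (X m - L) \<le> e/2"
        by (rule power2_le_imp_le) (use \<open>0 < e\<close> in simp)
      then show ?thesis
        using \<open>0 < e\<close> by (simp add: dist_norm)
    qed
    then show "\<exists>N. \<forall>m\<ge>N. dist (X m) L < e" by blast
  qed
  then show "convergent X" by (rule convergentI)
qed

instantiation ell2 :: (chilbert_space) chilbert_space
begin

lift_definition scaleC_ell2 :: "complex \<Rightarrow> 'a ell2 \<Rightarrow> 'a ell2" is "\<lambda>a x n. a *\<^sub>C x n"
  by (simp add: norm_scaleC power_mult_distrib summable_mult)

definition cinner_ell2 :: "'a ell2 \<Rightarrow> 'a ell2 \<Rightarrow> complex"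
  where "cinner_ell2 x y = (\<Sum>n. cinner (ell2_nth x n) (ell2_nth y n))"

lemma summable_cinner_ell2: "summable (\<lambda>n. cinner (ell2_nth x n) (ell2_nth y n))"
  for x y :: "'a ell2"
  unfolding summable_complex_iff Re_cinner Im_cinner
  using summable_inner_ell2[of x y] summable_minus[OF summable_inner_ell2[of "\<i> *\<^sub>C x" y]]
  by (simp add: scaleC_ell2.rep_eq)

instance
proof
  fix a b :: complex and r :: real and x y z :: "'a ell2"
  show "a *\<^sub>C (x + y) = a *\<^sub>C x + a *\<^sub>C y"
    by transfer (simp add: scaleC_add_right)
  show "(a + b) *\<^sub>C x = a *\<^sub>C x + b *\<^sub>C x"
    by transfer (simp add: scaleC_add_left)
  show "a *\<^sub>C b *\<^sub>C x = (a * b) *\<^sub>C x"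
    by transfer (simp add: scaleC_scaleC)
  show "complex_of_real r *\<^sub>C x = r *\<^sub>R x"
    by transfer (simp add: scaleC_of_real)
  show "cinner (x + y) z = cinner x z + cinner y z"
    unfolding cinner_ell2_def plus_ell2.rep_eq cinner_add_left
    by (intro suminf_add[symmetric] summable_cinner_ell2)
  show "cinner (a *\<^sub>C x) y = a * cinner x y"
    unfolding cinner_ell2_def scaleC_ell2.rep_eq cinner_scaleC_left
    by (intro suminf_mult summable_cinner_ell2)
  show "Re (cinner x y) = inner x y"
    unfolding cinner_ell2_def inner_ell2_def Re_suminf[OF summable_cinner_ell2] Re_cinner ..
  have "(\<lambda>n. cinner (ell2_nth y n) (ell2_nth x n)) sums cinner y x"
    unfolding cinner_ell2_def by (intro summable_sums summable_cinner_ell2)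
  then have "(\<lambda>n. cnj (cinner (ell2_nth y n) (ell2_nth x n))) sums cnj (cinner y x)"
    by (simp only: sums_cnj)
  then have "(\<lambda>n. cinner (ell2_nth x n) (ell2_nth y n)) sums cnj (cinner y x)"
    by (simp only: cinner_commute[symmetric])
  then show "cinner x y = cnj (cinner y x)"
    unfolding cinner_ell2_def[of x y] by (rule sums_unique[symmetric])
qed

end

definition bounded_clinear :: "('a::chilbert_space \<Rightarrow> 'b::chilbert_space) \<Rightarrow> bool"
  where "bounded_clinear T \<longleftrightarrow> bounded_linear T \<and> (\<forall>a x. T (a *\<^sub>C x) = a *\<^sub>C T x)"

definition cadjoint :: "('a::chilbert_space \<Rightarrow> 'b::chilbert_space) \<Rightarrow> 'b \<Rightarrow> 'a"
  where "cadjoint T = (THE S. \<forall>x y. cinner (T x) y = cinner x (S y))"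

definition nonneg_op :: "('a::chilbert_space \<Rightarrow> 'a) \<Rightarrow> bool"
  where "nonneg_op T \<longleftrightarrow>
    bounded_clinear T \<and> (\<forall>x. cinner (T x) x \<in> \<real> \<and> 0 \<le> Re (cinner (T x) x))"

definition invertible_op :: "('a::chilbert_space \<Rightarrow> 'b::chilbert_space) \<Rightarrow> bool"
  where "invertible_op T \<longleftrightarrow>
    bounded_clinear T \<and> (\<exists>S. bounded_clinear S \<and> S \<circ> T = id \<and> T \<circ> S = id)"

definition strictly_positive_op :: "('a::chilbert_space \<Rightarrow> 'a) \<Rightarrow> bool"
  where "strictly_positive_op T \<longleftrightarrow> nonneg_op T \<and> invertible_op T"

definition sqrt_op :: "('a::chilbert_space \<Rightarrow> 'a) \<Rightarrow> 'a \<Rightarrow> 'a"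
  where "sqrt_op T = (THE R. nonneg_op R \<and> R \<circ> R = T)"

text \<open>Meaningful only for closed subspaces \<open>M\<close>, where the orthogonal projection exists.\<close>

definition orth_proj :: "'a::chilbert_space set \<Rightarrow> 'a \<Rightarrow> 'a"
  where "orth_proj M x = (THE y. y \<in> M \<and> (\<forall>m\<in>M. cinner (x - y) m = 0))"

definition orth_diff :: "'a::chilbert_space set \<Rightarrow> 'a set \<Rightarrow> 'a set"
  where "orth_diff M N = {x \<in> M. \<forall>y\<in>N. cinner x y = 0}"

definition unitary_betw ::
    "('a::chilbert_space \<Rightarrow> 'b::chilbert_space) \<Rightarrow> 'a set \<Rightarrow> 'b set \<Rightarrow> bool"
  where "unitary_betw V M N \<longleftrightarrow> bij_betw V M N
    \<and> (\<forall>x\<in>M. \<forall>y\<in>M. V (x + y) = V x + V y)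
    \<and> (\<forall>a. \<forall>x\<in>M. V (a *\<^sub>C x) = a *\<^sub>C V x)
    \<and> (\<forall>x\<in>M. \<forall>y\<in>M. cinner (V x) (V y) = cinner x y)"

lift_definition embed0 :: "'a::chilbert_space \<Rightarrow> 'a ell2" is "\<lambda>v n. if n = 0 then v else 0"
  by (rule summable_finite[of "{0}"]) auto

lift_definition fwd_shift :: "'a::chilbert_space ell2 \<Rightarrow> 'a ell2"
  is "\<lambda>x n. if n = 0 then 0 else x (n - 1)"
  by (subst summable_Suc_iff[symmetric]) simp

text \<open>
  Operator-valued functions on the open unit disc are functions \<^typ>\<open>complex \<Rightarrow> 'u \<Rightarrow> 'y\<close>,
  of which only the values on \<^term>\<open>ball 0 1 :: complex set\<close> matter. Analyticity is complex
  differentiability in the operator norm.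
\<close>

definition op_analytic_on_disc :: "(complex \<Rightarrow> 'u::chilbert_space \<Rightarrow> 'y::chilbert_space) \<Rightarrow> bool"
  where "op_analytic_on_disc F \<longleftrightarrow> (\<forall>\<zeta>\<in>ball 0 1. \<exists>D. bounded_clinear D \<and>
    ((\<lambda>\<xi>. onorm (\<lambda>u. inverse (\<xi> - \<zeta>) *\<^sub>C (F \<xi> u - F \<zeta> u) - D u)) \<longlongrightarrow> 0) (at \<zeta>))"

definition schur_class :: "(complex \<Rightarrow> 'u::chilbert_space \<Rightarrow> 'y::chilbert_space) set"
  where "schur_class = {F. (\<forall>\<zeta>\<in>ball 0 1. bounded_clinear (F \<zeta>)) \<and>
    op_analytic_on_disc F \<and> (\<forall>\<zeta>\<in>ball 0 1. onorm (F \<zeta>) \<le> 1)}"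

definition taylor_coeff :: "(complex \<Rightarrow> 'u::chilbert_space \<Rightarrow> 'y::chilbert_space) \<Rightarrow> nat \<Rightarrow> 'u \<Rightarrow> 'y"
  where "taylor_coeff F =
    (THE c. \<forall>\<zeta>\<in>ball 0 1. \<forall>u. (\<lambda>n. \<zeta> ^ n *\<^sub>C c n u) sums F \<zeta> u)"

definition toeplitz_op ::
    "(complex \<Rightarrow> 'u::chilbert_space \<Rightarrow> 'y::chilbert_space) \<Rightarrow> 'u ell2 \<Rightarrow> 'y ell2"
  where "toeplitz_op F x = Abs_ell2 (\<lambda>n. \<Sum>k\<le>n. taylor_coeff F (n - k) (ell2_nth x k))"

definition ltonp_data ::
    "('y::chilbert_space ell2 \<Rightarrow> 'z::chilbert_space) \<Rightarrow> ('u::chilbert_space ell2 \<Rightarrow> 'z) \<Rightarrow> ('z \<Rightarrow> 'z) \<Rightarrow> bool"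
  where "ltonp_data W Wt Z \<longleftrightarrow>
    bounded_clinear W \<and> bounded_clinear Wt \<and> bounded_clinear Z \<and>
    Z \<circ> W = W \<circ> fwd_shift \<and> Z \<circ> Wt = Wt \<circ> fwd_shift"

definition ltonp_solution ::
    "('y::chilbert_space ell2 \<Rightarrow> 'z::chilbert_space) \<Rightarrow> ('u::chilbert_space ell2 \<Rightarrow> 'z)
      \<Rightarrow> (complex \<Rightarrow> 'u \<Rightarrow> 'y) \<Rightarrow> bool"
  where "ltonp_solution W Wt F \<longleftrightarrow> F \<in> schur_class \<and> W \<circ> toeplitz_op F = Wt"

definition pick_op ::
    "('y::chilbert_space ell2 \<Rightarrow> 'z::chilbert_space) \<Rightarrow> ('u::chilbert_space ell2 \<Rightarrow> 'z) \<Rightarrow> 'z \<Rightarrow> 'z"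
  where "pick_op W Wt z = W (cadjoint W z) - Wt (cadjoint Wt z)"

definition schur_entropy :: "(complex \<Rightarrow> 'u::chilbert_space \<Rightarrow> 'y::chilbert_space) \<Rightarrow> 'u \<Rightarrow> real"
  where "schur_entropy F u = (INF h.
    (norm (u - cadjoint embed0 (cadjoint (toeplitz_op F) h)))\<^sup>2
      + Re (cinner (h - toeplitz_op F (cadjoint (toeplitz_op F) h)) h))"

text \<open>
  The space \<open>\<Z>\<^sub>\<circ>\<close> is the subset \<open>Z_circ\<close> of the type \<^typ>\<open>'z\<close>, and \<open>\<U> \<oplus> \<Z>\<^sub>\<circ>\<close> is \<open>UNIV \<times> Z_circ\<close>.
\<close>

context
  fixes W :: "'y::chilbert_space ell2 \<Rightarrow> 'z::chilbert_space"
    and Wt :: "'u::chilbert_space ell2 \<Rightarrow> 'z"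
begin

definition Z_circ :: "'z set"
  where "Z_circ = closure (range (pick_op W Wt))"

definition K1_op :: "'u \<times> 'z \<Rightarrow> 'z"
  where "K1_op = (\<lambda>(u, z). Wt (embed0 u) + sqrt_op (pick_op W Wt) z)"

definition K2_op :: "('z \<Rightarrow> 'z) \<Rightarrow> 'y \<times> 'z \<Rightarrow> 'z"
  where "K2_op Z = (\<lambda>(y, z). W (embed0 y) + Z (sqrt_op (pick_op W Wt) z))"

definition F_space :: "('u \<times> 'z) set"
  where "F_space = closure (range (cadjoint K1_op))"

definition F'_space :: "('z \<Rightarrow> 'z) \<Rightarrow> ('y \<times> 'z) set"
  where "F'_space Z = closure (range (cadjoint (K2_op Z)))"

definition G_space :: "('u \<times> 'z) set"
  where "G_space = orth_diff (UNIV \<times> Z_circ) F_space"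

text \<open>Only the values on \<open>F_space\<close> matter, and these are uniquely determined.\<close>

definition omega :: "('z \<Rightarrow> 'z) \<Rightarrow> 'u \<times> 'z \<Rightarrow> 'y \<times> 'z"
  where "omega Z = (SOME V. unitary_betw V F_space (F'_space Z) \<and> V \<circ> cadjoint K1_op = cadjoint (K2_op Z))"

definition delta0 :: "('z \<Rightarrow> 'z) \<Rightarrow> 'u \<Rightarrow> 'y"
  where "delta0 Z u = fst (omega Z (orth_proj F_space (u, 0)))"

definition beta0 :: "('z \<Rightarrow> 'z) \<Rightarrow> 'u \<Rightarrow> 'z"
  where "beta0 Z u = snd (omega Z (orth_proj F_space (u, 0)))"

definition gamma0 :: "('z \<Rightarrow> 'z) \<Rightarrow> 'z \<Rightarrow> 'y"
  where "gamma0 Z z = fst (omega Z (orth_proj F_space (0, z)))"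

definition alpha0 :: "('z \<Rightarrow> 'z) \<Rightarrow> 'z \<Rightarrow> 'z"
  where "alpha0 Z z = snd (omega Z (orth_proj F_space (0, z)))"

definition central_solution :: "('z \<Rightarrow> 'z) \<Rightarrow> complex \<Rightarrow> 'u \<Rightarrow> 'y"
  where "central_solution Z \<zeta> u =
    delta0 Z u + \<zeta> *\<^sub>C gamma0 Z (inv_into Z_circ (\<lambda>z. z - \<zeta> *\<^sub>C alpha0 Z z) (beta0 Z u))"

end

end

theory Submission
  imports Defs "HOL-Complex_Analysis.Complex_Analysis"
begin

text \<open>
  Since \<open>T\<^sub>F\<^sup>* W\<^sup>* = Wt\<^sup>*\<close> for a solution \<open>F\<close>, evaluating the entropy functional at \<open>h = W\<^sup>* z\<close> gives
  \<open>\<parallel>(u, 0) - K\<^sub>1\<^sup>* z\<parallel>\<^sup>2\<close>; hence the entropy of every solution is at most the squared distance from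
  \<open>(u, 0)\<close> to \<open>\<F>\<close>. For the central solution, the system \<open>M = \<omega> P\<^sub>\<F>\<close> is contractive, and the
  energy balance of its trajectories shows that the functional never drops below that distance.

  If a solution \<open>F\<close> attains the distance for every \<open>u\<close>, the vanishing first variation at the minimizers
  forces \<open>F\<close> to be the transfer function of the same system: every solution is, through
  \<open>(I - T\<^sub>F T\<^sub>F\<^sup>*) W\<^sup>*\<close>, compatible with the system on \<open>\<F>\<close>, and equality means that it also vanishes on the
  complement of \<open>\<F>\<close>.
\<close>

section \<open>Real Hilbert spaces\<close>

text \<open>No minimizer of the entropy functional is at hand: \<open>F_space\<close> is a closure,
  and the vectors \<open>Ws z\<close> only reach its dense part \<open>range K1s\<close>. Upper
  bounds and first variations are therefore computed at \<open>K1s z\<close> and carried to the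
  projection of \<open>(u, 0)\<close> as closed conditions. A second obstacle is that the Schur
  class is given by analyticity and a pointwise bound alone, so Taylor coefficients and the
  contractivity of \<open>toeplitz_op F\<close> have to be derived before adjoints can be used.
  Thirdly, nothing bounds the powers of \<open>Z\<close>; that the central solution interpolates
  rests instead on the powers of the backward shift tending strongly to 0. The geometry is done with
  the real inner product; invariance of subspaces and operators under multiplication by \<i>
  restores the complex statements.\<close>

instance chilbert_space \<subseteq> banach ..

text \<open>For small t the linear term decides the sign. This is the first-variation argument
  behind the orthogonality of nearest points and, later, the stationarity of the entropy
  functional.\<close>

lemma quadratic_nonneg_imp_linear_zero:
  fixes a c :: real
  assumes "\<And>t. 0 \<le> 2 * t * a + t\<^sup>2 * c"
  shows "a = 0"
proof (rule ccontr)
  assume a: "a \<noteq> 0"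
  \<comment> \<open>Any \<open>k > 0\<close> with \<open>2 * k > c\<close> makes
    \<open>t = - a / k\<close> produce a negative value, whatever the sign of
    \<open>c\<close>.\<close>
  define k where "k = \<bar>c\<bar> + 1"
  have k: "k > 0" "c < 2 * k" by (auto simp: k_def)
  have "0 \<le> 2 * (-a/k) * a + (-a/k)\<^sup>2 * c" by (rule assms)
  also have "\<dots> = a\<^sup>2 / k\<^sup>2 * (c - 2 * k)"
    using k by (simp add: field_simps power2_eq_square)
  also have "\<dots> < 0"
    using a k by (intro mult_pos_neg) auto
  finally show False by simp
qed

lemma norm_add_sq: "(norm (x + y))\<^sup>2 = (norm x)\<^sup>2 + 2 * inner x y + (norm y)\<^sup>2"
  for x y :: "'a::real_inner"
  by (simp add: power2_norm_eq_inner inner_simps inner_commute)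

lemma norm_diff_sq: "(norm (x - y))\<^sup>2 = (norm x)\<^sup>2 - 2 * inner x y + (norm y)\<^sup>2"
  for x y :: "'a::real_inner"
  by (simp add: power2_norm_eq_inner inner_simps inner_commute)

lemma orthogonal_projection_exists:
  fixes M :: "'a::{real_inner,banach} set"
  assumes "subspace M" "closed M"
  obtains y where "y \<in> M" "\<And>m. m \<in> M \<Longrightarrow> inner (x - y) m = 0"
proof -
  define d where "d = (INF m\<in>M. (norm (x - m))\<^sup>2)"
  have ne: "M \<noteq> {}" using subspace_0[OF assms(1)] by auto
  have bdd: "bdd_below ((\<lambda>m. (norm (x - m))\<^sup>2) ` M)"
    by (rule bdd_belowI[of _ 0]) auto
  have dle: "d \<le> (norm (x - m))\<^sup>2" if "m \<in> M" for m
    unfolding d_def using bdd that by (rule cINF_lower)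
  have "\<exists>m\<in>M. (norm (x - m))\<^sup>2 < d + inverse (real (Suc k))" for k
    using cINF_less_iff[OF ne bdd, of "d + inverse (real (Suc k))"] by (simp add: d_def)
  then obtain m where m: "\<And>k. m k \<in> M" "\<And>k. (norm (x - m k))\<^sup>2 < d + inverse (real (Suc k))"
    by metis
  \<comment> \<open>Parallelogram law: the midpoint lies in \<open>M\<close>, so its squared
    distance to \<open>x\<close> is at least \<open>d\<close>, which limits how far two nearly
    optimal points can lie apart.\<close>
  have par: "(norm (m j - m k))\<^sup>2 \<le> 2 * inverse (real (Suc j)) + 2 * inverse (real (Suc k))" for j k
  proof -
    have "(1/2) *\<^sub>R (m j + m k) \<in> M"
      using m(1) assms(1) by (simp add: subspace_add subspace_scale)
    then have "d \<le> (norm (x - (1/2) *\<^sub>R (m j + m k)))\<^sup>2" by (rule dle)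
    moreover have "(norm (m j - m k))\<^sup>2 = 2 * (norm (x - m j))\<^sup>2 + 2 * (norm (x - m k))\<^sup>2
        - 4 * (norm (x - (1/2) *\<^sub>R (m j + m k)))\<^sup>2"
      by (simp add: power2_norm_eq_inner inner_simps inner_commute algebra_simps)
    ultimately show ?thesis using m(2)[of j] m(2)[of k] by linarith
  qed
  have "Cauchy m"
  proof (rule metric_CauchyI)
    fix e :: real assume e: "e > 0"
    then obtain N where N: "inverse (real (Suc N)) < e\<^sup>2 / 4"
      using reals_Archimedean[of "e\<^sup>2/4"] by auto
    have "dist (m j) (m k) < e" if "j \<ge> N" "k \<ge> N" for j k
    proof -
      have "inverse (real (Suc j)) \<le> inverse (real (Suc N))"
        "inverse (real (Suc k)) \<le> inverse (real (Suc N))"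
        using that by (auto intro!: le_imp_inverse_le)
      then have "(norm (m j - m k))\<^sup>2 < e\<^sup>2" using par[of j k] N by linarith
      then show ?thesis using e by (simp add: dist_norm power2_less_imp_less)
    qed
    then show "\<exists>N. \<forall>j\<ge>N. \<forall>k\<ge>N. dist (m j) (m k) < e" by blast
  qed
  then obtain y where y: "m \<longlonglongrightarrow> y" by (auto simp: Cauchy_convergent_iff convergent_def)
  have yM: "y \<in> M" using closed_sequentially[OF assms(2) m(1) y] .
  have "(norm (x - y))\<^sup>2 \<le> d + 0"
  proof (rule LIMSEQ_le)
    show "(\<lambda>k. (norm (x - m k))\<^sup>2) \<longlonglongrightarrow> (norm (x - y))\<^sup>2"
      by (intro tendsto_intros y)
    show "(\<lambda>k. d + inverse (real (Suc k))) \<longlonglongrightarrow> d + 0"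
      by (intro tendsto_intros LIMSEQ_inverse_real_of_nat)
    show "\<exists>N. \<forall>n\<ge>N. (norm (x - m n))\<^sup>2 \<le> d + inverse (real (Suc n))"
      using m(2) less_imp_le by blast
  qed
  then have dy: "(norm (x - y))\<^sup>2 = d" using dle[OF yM] by simp
  have "inner (x - y) n = 0" if "n \<in> M" for n
  proof (rule quadratic_nonneg_imp_linear_zero)
    fix t :: real
    have "y - t *\<^sub>R n \<in> M" using yM that assms(1) by (simp add: subspace_diff subspace_scale)
    then have "(norm (x - y))\<^sup>2 \<le> (norm ((x - y) + t *\<^sub>R n))\<^sup>2" using dle dy
      by (metis add.commute add_diff_eq diff_diff_eq2)
    then show "0 \<le> 2 * t * inner (x - y) n + t\<^sup>2 * (norm n)\<^sup>2"
      by (simp add: norm_add_sq power_mult_distrib)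
  qed
  with yM show ?thesis by (rule that)
qed

text \<open>The kernel of a nonzero functional has a one-dimensional orthogonal complement, spanned
  by the residual \<open>b\<close> of any point outside the kernel; only its scaling has to be
  adjusted.\<close>

lemma riesz_representation:
  fixes f :: "'a::{real_inner,banach} \<Rightarrow> real"
  assumes "bounded_linear f"
  obtains a where "\<And>x. f x = inner x a"
proof (cases "\<forall>x. f x = 0")
  case True
  then show ?thesis by (intro that[of 0]) auto
next
  case False
  then obtain x where x: "f x \<noteq> 0" by blast
  interpret f: bounded_linear f by fact
  define M where "M = {x. f x = 0}"
  have "subspace M" by (auto simp: M_def subspace_def f.add f.scaleR f.zero)
  moreover have "closed M" unfolding M_def
    by (intro closed_Collect_eq continuous_on_const linear_continuous_on assms)
  ultimately obtain y where y: "y \<in> M" "\<And>m. m \<in> M \<Longrightarrow> inner (x - y) m = 0"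
    using orthogonal_projection_exists by blast
  define b where "b = x - y"
  have fb: "f b \<noteq> 0" using x y(1) by (simp add: b_def M_def f.diff)
  then have b0: "inner b b \<noteq> 0" using f.zero by auto
  have "f z = inner z ((f b / inner b b) *\<^sub>R b)" for z
  proof -
    have "z - (f z / f b) *\<^sub>R b \<in> M" using fb by (simp add: M_def f.diff f.scaleR)
    then have "inner b (z - (f z / f b) *\<^sub>R b) = 0" using y(2) by (simp add: b_def)
    then show ?thesis using fb b0 by (simp add: inner_simps inner_commute field_simps)
  qed
  then show ?thesis by (rule that)
qed

text \<open>Riesz applied to each functional \<open>inner (T x) y\<close> of \<open>x\<close>. The
  real inner product suffices: for complex-linear \<open>T\<close> the resulting map is also the
  complex adjoint.\<close>

lemma adjoint_exists:
  fixes T :: "'a::{real_inner,banach} \<Rightarrow> 'b::real_inner"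
  assumes "bounded_linear T"
  obtains S where "bounded_linear S" "\<And>x y. inner (T x) y = inner x (S y)"
proof -
  interpret T: bounded_linear T by fact
  have "\<exists>a. \<forall>x. inner (T x) y = inner x a" for y
  proof -
    have "bounded_linear (\<lambda>x. inner (T x) y)"
      by (intro bounded_linear_compose[OF bounded_linear_inner_left] assms)
    then show ?thesis by (metis riesz_representation)
  qed
  then obtain S where S: "\<And>x y. inner (T x) y = inner x (S y)" by metis
  obtain K where K: "\<And>x. norm (T x) \<le> norm x * K" "K > 0" using T.pos_bounded by blast
  have "bounded_linear S"
  proof (rule bounded_linear_intro[where K=K])
    fix x y and r :: real
    have "inner z (S (x + y)) = inner z (S x + S y)" for z
      by (simp add: inner_simps flip: S)
    then show "S (x + y) = S x + S y" by (metis vector_eq_ldot)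
    have "inner z (S (r *\<^sub>R x)) = inner z (r *\<^sub>R S x)" for z
      by (simp flip: S)
    then show "S (r *\<^sub>R x) = r *\<^sub>R S x" by (metis vector_eq_ldot)
    have "norm (S x) * norm (S x) = inner (T (S x)) x"
      by (simp add: S power2_eq_square[symmetric] power2_norm_eq_inner)
    also have "\<dots> \<le> norm (S x) * K * norm x"
      by (rule order_trans[OF norm_cauchy_schwarz]) (intro mult_right_mono K norm_ge_zero)
    finally have "norm (S x) * norm (S x) \<le> norm (S x) * (norm x * K)" by (simp add: ac_simps)
    then show "norm (S x) \<le> norm x * K"
      using K(2) by (cases "S x = 0") (auto simp: mult_le_cancel_left_pos)
  qed
  then show ?thesis using S that by blast
qed

lemma subspace_closure:
  fixes S :: "'a::real_normed_vector set"
  assumes "subspace S"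
  shows "subspace (closure S)"
proof (rule subspaceI)
  show "0 \<in> closure S" using subspace_0[OF assms] closure_subset by blast
next
  fix x y assume "x \<in> closure S" "y \<in> closure S"
  then obtain f g where "\<And>n. f n \<in> S" "f \<longlonglongrightarrow> x" "\<And>n. g n \<in> S" "g \<longlonglongrightarrow> y"
    by (metis closure_sequential)
  then have "\<And>n. f n + g n \<in> S" "(\<lambda>n. f n + g n) \<longlonglongrightarrow> x + y"
    using subspace_add[OF assms] by (auto intro: tendsto_add)
  then show "x + y \<in> closure S" unfolding closure_sequential
    by (intro exI[of _ "\<lambda>n. f n + g n"]) blast
next
  fix x and c :: real assume "x \<in> closure S"
  then obtain f where "\<And>n. f n \<in> S" "f \<longlonglongrightarrow> x"
    by (metis closure_sequential)
  then have "\<And>n. c *\<^sub>R f n \<in> S" "(\<lambda>n. c *\<^sub>R f n) \<longlonglongrightarrow> c *\<^sub>R x"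
    using subspace_scale[OF assms] by (auto intro: tendsto_scaleR)
  then show "c *\<^sub>R x \<in> closure S" unfolding closure_sequential
    by (intro exI[of _ "\<lambda>n. c *\<^sub>R f n"]) blast
qed

text \<open>Douglas' factorization: the closure of the set of pairs \<open>(A z, C z)\<close> is the graph of a contraction.\<close>

lemma douglas_factorization:
  fixes A :: "'a::real_normed_vector \<Rightarrow> 'b::{real_inner,banach}" and C :: "'a \<Rightarrow> 'c::{real_inner,banach}"
  assumes A: "bounded_linear A" and C: "bounded_linear C" and le: "\<And>z. norm (C z) \<le> norm (A z)"
  obtains G where "bounded_linear G" "\<And>z. G (A z) = C z" "\<And>x. norm (G x) \<le> norm x"
    "\<And>x. (\<And>z. inner x (A z) = 0) \<Longrightarrow> G x = 0"
proof -
  interpret A: bounded_linear A by fact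
  interpret C: bounded_linear C by fact
  define H where "H = closure (range (\<lambda>z. (A z, C z)))"
  have sub: "subspace H" unfolding H_def
    by (intro subspace_closure linear_subspace_image subspace_UNIV bounded_linear.linear
        bounded_linear_Pair A C)
  have "H \<subseteq> {p. norm (snd p) \<le> norm (fst p)}" unfolding H_def
    by (intro closure_minimal closed_Collect_le continuous_intros) (auto simp: le)
  then have Hle: "norm v \<le> norm x" if "(x, v) \<in> H" for x v using that by auto
  \<comment> \<open>On \<open>H\<close> the first component dominates the second, so
    \<open>fst\<close> is bounded below there and the domain of the graph is closed; it can then be
    projected onto.\<close>
  have com: "complete (fst ` H)"
  proof (rule complete_isometric_image[where e="1/2"])
    show "complete H" by (simp add: H_def complete_eq_closed)
    show "\<forall>x\<in>H. norm (fst x) \<ge> 1/2 * norm x"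
    proof
      fix p assume "p \<in> H"
      moreover obtain x v where p: "p = (x, v)" by fastforce
      ultimately have "norm v \<le> norm x" using Hle by blast
      then have "norm p \<le> 2 * norm x" unfolding p
        using norm_Pair_le[of x v] by linarith
      then show "norm (fst p) \<ge> 1/2 * norm p" by (simp add: p)
    qed
  qed (auto intro: bounded_linear_fst sub)
  define M where "M = fst ` H"
  have Mcl: "closed M" using com by (simp add: M_def complete_eq_closed)
  have Msub: "subspace M" unfolding M_def
    by (intro linear_subspace_image sub bounded_linear.linear bounded_linear_fst)
  have AM: "(A z, C z) \<in> H" for z unfolding H_def by (rule subsetD[OF closure_subset]) auto
  have MA: "M \<subseteq> closure (range A)"
  proof -
    have "fst ` H \<subseteq> closure (fst ` range (\<lambda>z. (A z, C z)))"
      unfolding H_def by (intro image_closure_subset continuous_on_fst continuous_on_id closed_closure)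
        (auto intro!: closure_subset[THEN subsetD])
    then show ?thesis by (simp add: M_def image_image)
  qed
  have "\<exists>y v. (y, v) \<in> H \<and> (\<forall>m\<in>M. inner (x - y) m = 0)" for x
  proof -
    obtain y where "y \<in> M" "\<And>m. m \<in> M \<Longrightarrow> inner (x - y) m = 0"
      using orthogonal_projection_exists[OF Msub Mcl] by blast
    moreover from this(1) obtain v where "(y, v) \<in> H" by (auto simp: M_def)
    ultimately show ?thesis by blast
  qed
  \<comment> \<open>\<open>G\<close> projects onto \<open>M\<close> and then follows the graph.
    Keeping both components together makes the pair unique (\<open>uniq\<close>), and linearity
    follows from uniqueness.\<close>
  then obtain P G where PG: "\<And>x. (P x, G x) \<in> H" "\<And>x m. m \<in> M \<Longrightarrow> inner (x - P x) m = 0" by metis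
  have uniq: "y = P x \<and> v = G x" if "(y, v) \<in> H" "\<And>m. m \<in> M \<Longrightarrow> inner (x - y) m = 0" for x y v
  proof -
    have d: "(y - P x, v - G x) \<in> H" using subspace_diff[OF sub that(1) PG(1)[of x]] by simp
    then have "y - P x \<in> M" by (force simp: M_def)
    then have "inner (x - P x) (y - P x) = 0" "inner (x - y) (y - P x) = 0" using PG(2) that(2) by auto
    then have "inner (y - P x) (y - P x) = 0" by (simp add: inner_simps)
    then have "y = P x" by simp
    moreover have "v = G x" using Hle[OF d] \<open>y = P x\<close> by simp
    ultimately show ?thesis by simp
  qed
  have add: "P (x + y) = P x + P y \<and> G (x + y) = G x + G y" for x y
  proof -
    have "P x + P y = P (x + y) \<and> G x + G y = G (x + y)"
    proof (rule uniq)
      show "(P x + P y, G x + G y) \<in> H" using subspace_add[OF sub PG(1)[of x] PG(1)[of y]] by simp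
      fix m assume "m \<in> M"
      from PG(2)[OF this, of x] PG(2)[OF this, of y]
      show "inner (x + y - (P x + P y)) m = 0" by (simp add: inner_simps)
    qed
    then show ?thesis by simp
  qed
  have scl: "P (r *\<^sub>R x) = r *\<^sub>R P x \<and> G (r *\<^sub>R x) = r *\<^sub>R G x" for x r
  proof -
    have "r *\<^sub>R P x = P (r *\<^sub>R x) \<and> r *\<^sub>R G x = G (r *\<^sub>R x)"
    proof (rule uniq)
      show "(r *\<^sub>R P x, r *\<^sub>R G x) \<in> H" using subspace_scale[OF sub PG(1)[of x]] by simp
      fix m assume "m \<in> M"
      from PG(2)[OF this, of x]
      show "inner (r *\<^sub>R x - r *\<^sub>R P x) m = 0" by (simp flip: scaleR_diff_right)
    qed
    then show ?thesis by simp
  qed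
  have nG: "norm (G x) \<le> norm x" for x
  proof -
    have "norm (G x) \<le> norm (P x)" using Hle PG(1) by blast
    also have "\<dots> \<le> norm x"
    proof (rule power2_le_imp_le)
      have "P x \<in> M" using PG(1)[of x] by (force simp: M_def)
      then have "inner (x - P x) (P x) = 0" by (rule PG(2))
      then have "(norm x)\<^sup>2 = (norm (x - P x))\<^sup>2 + (norm (P x))\<^sup>2"
        using norm_add_sq[of "x - P x" "P x"] by simp
      then show "(norm (P x))\<^sup>2 \<le> (norm x)\<^sup>2" by simp
    qed simp
    finally show ?thesis .
  qed
  show ?thesis
  proof (rule that)
    show "bounded_linear G"
      using add scl nG by (intro bounded_linear_intro[where K=1]) auto
    show "G (A z) = C z" for z using uniq[OF AM, of "A z" z] by simp
    show "norm (G x) \<le> norm x" for x by (rule nG)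
    show "G x = 0" if "\<And>z. inner x (A z) = 0" for x
    proof -
      have "closure (range A) \<subseteq> {m. inner x m = 0}"
        by (intro closure_minimal closed_Collect_eq continuous_intros) (auto simp: that)
      then have "0 = P x \<and> 0 = G x" using MA subspace_0[OF sub]
        by (intro uniq) (auto simp: zero_prod_def)
      then show ?thesis by simp
    qed
  qed
qed

section \<open>Operators and subspaces of complex Hilbert spaces\<close>

lemma cinner_eq_Complex: "cinner x y = Complex (inner x y) (- inner (\<i> *\<^sub>C x) y)"
  by (simp add: complex_eq_iff Re_cinner Im_cinner)

lemma scaleC_one [simp]: "1 *\<^sub>C x = x"
  using scaleC_of_real[of 1 x] by simp

lemma scaleC_zero_left [simp]: "0 *\<^sub>C x = 0"
  using scaleC_of_real[of 0 x] by simp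

lemma scaleC_zero_right [simp]: "a *\<^sub>C (0::'a::chilbert_space) = 0"
  using norm_scaleC[of a "0::'a"] by simp

lemma scaleC_minus1: "(- 1) *\<^sub>C x = - x"
  using scaleC_of_real[of "-1" x] by simp

lemma scaleC_ii: "\<i> *\<^sub>C \<i> *\<^sub>C x = - x"
  by (simp add: scaleC_scaleC scaleC_minus1)

lemma scaleC_minus_right [simp]: "a *\<^sub>C (- x) = - (a *\<^sub>C x)"
  by (metis mult.commute scaleC_minus1 scaleC_scaleC)

lemma scaleC_minus_left: "(- a) *\<^sub>C x = - (a *\<^sub>C x)"
  by (metis mult_minus1 scaleC_minus1 scaleC_scaleC)

lemma scaleC_diff_right: "a *\<^sub>C (x - y) = a *\<^sub>C x - a *\<^sub>C y"
  using scaleC_add_right[of a x "- y"] by simp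

lemma scaleC_diff_left: "(a - b) *\<^sub>C x = a *\<^sub>C x - b *\<^sub>C x"
  using scaleC_add_left[of a "- b" x] by (simp add: scaleC_minus_left)

lemma scaleC_scaleR: "a *\<^sub>C (r *\<^sub>R x) = r *\<^sub>R (a *\<^sub>C x)"
  by (simp add: scaleC_scaleC mult.commute flip: scaleC_of_real)

lemma cinner_scaleC_right: "cinner x (a *\<^sub>C y) = cnj a * cinner x y"
proof -
  have "cinner x (a *\<^sub>C y) = cnj (cinner (a *\<^sub>C y) x)" by (rule cinner_commute)
  also have "\<dots> = cnj a * cnj (cinner y x)" by (simp add: cinner_scaleC_left)
  also have "cnj (cinner y x) = cinner x y" by (rule cinner_commute[symmetric])
  finally show ?thesis .
qed

lemma inner_scaleC_ii: "inner (\<i> *\<^sub>C x) (\<i> *\<^sub>C y) = inner x y"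
  by (simp add: cinner_scaleC_left cinner_scaleC_right flip: Re_cinner)

lemma inner_ii_left: "inner (\<i> *\<^sub>C x) y = - inner x (\<i> *\<^sub>C y)"
  using inner_scaleC_ii[of "\<i> *\<^sub>C x" y] by (simp add: scaleC_ii)

lemma cinner_add_right: "cinner x (y + z) = cinner x y + cinner x z"
proof -
  have "cinner x (y + z) = cnj (cinner (y + z) x)" by (rule cinner_commute)
  also have "\<dots> = cnj (cinner y x) + cnj (cinner z x)" by (simp add: cinner_add_left)
  finally show ?thesis by (simp only: cinner_commute[symmetric])
qed

lemma inner_scaleC_left: "inner (a *\<^sub>C x) y = inner x (cnj a *\<^sub>C y)"
  by (simp add: cinner_scaleC_left cinner_scaleC_right flip: Re_cinner)

lemma cinner_self: "cinner x x = complex_of_real ((norm x)\<^sup>2)"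
proof -
  have "inner (\<i> *\<^sub>C x) x = 0" using inner_ii_left[of x x] by (simp add: inner_commute)
  then show ?thesis by (simp add: cinner_eq_Complex complex_eq_iff power2_norm_eq_inner)
qed

lemma bounded_linear_scaleC: "bounded_linear ((*\<^sub>C) a)"
  by (intro bounded_linear_intro[where K="norm a"])
     (simp_all add: scaleC_add_right scaleC_scaleR norm_scaleC mult.commute)

lemma bounded_linear_cinner_left: "bounded_linear (\<lambda>x. cinner x y)"
proof (intro bounded_linear_intro[where K="2 * norm y"])
  show "cinner (r *\<^sub>R x) y = r *\<^sub>R cinner x y" for r x
    by (simp add: scaleR_conv_of_real cinner_scaleC_left flip: scaleC_of_real)
  show "norm (cinner x y) \<le> norm x * (2 * norm y)" for x
  proof -
    have "norm (cinner x y) \<le> \<bar>inner x y\<bar> + \<bar>inner (\<i> *\<^sub>C x) y\<bar>"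
      using cmod_le[of "cinner x y"] by (simp add: Re_cinner Im_cinner)
    also have "\<dots> \<le> norm x * norm y + norm (\<i> *\<^sub>C x) * norm y"
      by (intro add_mono Cauchy_Schwarz_ineq2)
    finally show ?thesis by (simp add: norm_scaleC)
  qed
qed (rule cinner_add_left)

lemma cinner_diff_left: "cinner (x - y) z = cinner x z - cinner y z"
  by (rule linear_diff[OF bounded_linear.linear[OF bounded_linear_cinner_left]])

lemma cinner_sum_left: "cinner (sum f A) y = (\<Sum>i\<in>A. cinner (f i) y)"
  by (rule linear_sum[OF bounded_linear.linear[OF bounded_linear_cinner_left]])

lemma cinner_sum_right: "cinner x (sum f A) = (\<Sum>i\<in>A. cinner x (f i))"
proof -
  have "cinner x (sum f A) = cnj (cinner (sum f A) x)" by (rule cinner_commute)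
  also have "\<dots> = (\<Sum>i\<in>A. cnj (cinner (f i) x))" by (simp add: cinner_sum_left)
  finally show ?thesis by (simp only: cinner_commute[symmetric])
qed

lemma cinner_zero_left [simp]: "cinner 0 y = 0"
  by (simp add: cinner_eq_Complex complex_eq_iff)

text \<open>Multiplying \<open>x\<close> by a suitable scalar of modulus at most 1 turns the complex
  value into its modulus, and the real Cauchy-Schwarz inequality applies.\<close>

lemma norm_cinner_le: "norm (cinner x y) \<le> norm x * norm y"
proof -
  define a where "a = cnj (sgn (cinner x y))"
  have na: "norm a \<le> 1" by (simp add: a_def norm_sgn)
  have "a * cinner x y = complex_of_real (norm (cinner x y))"
    using complex_norm_square[of "cinner x y"]
    by (cases "cinner x y = 0") (simp_all add: a_def sgn_eq field_simps power2_eq_square)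
  then have "norm (cinner x y) = inner (a *\<^sub>C x) y"
    by (metis Re_cinner Re_complex_of_real cinner_scaleC_left)
  also have "\<dots> \<le> norm a * norm x * norm y"
    using norm_cauchy_schwarz[of "a *\<^sub>C x" y] by (simp add: norm_scaleC)
  also have "\<dots> \<le> 1 * norm x * norm y" by (intro mult_right_mono na) auto
  finally show ?thesis by simp
qed

section \<open>Bounded complex-linear operators and their adjoints\<close>

lemma inner_eqI: "(\<And>z. inner x z = inner y z) \<Longrightarrow> x = y"
  using vector_eq_rdot by blast

lemma cinner_eqI: "(\<And>z. cinner x z = cinner y z) \<Longrightarrow> x = y"
  by (metis Re_cinner vector_eq_rdot)

lemma bounded_clinear_linear: "bounded_clinear T \<Longrightarrow> bounded_linear T"
  by (simp add: bounded_clinear_def)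

lemma bounded_clinear_scaleC: "bounded_clinear T \<Longrightarrow> T (a *\<^sub>C x) = a *\<^sub>C T x"
  by (simp add: bounded_clinear_def)

lemmas bounded_clinear_add = bounded_linear.linear[OF bounded_clinear_linear, THEN linear_add]
  and bounded_clinear_diff = bounded_linear.linear[OF bounded_clinear_linear, THEN linear_diff]
  and bounded_clinear_zero = bounded_linear.linear[OF bounded_clinear_linear, THEN linear_0]
  and bounded_clinear_scaleR = bounded_linear.linear[OF bounded_clinear_linear, THEN linear_scale]

lemma bounded_clinear_intro:
  assumes "\<And>x y. T (x + y) = T x + T y" "\<And>a x. T (a *\<^sub>C x) = a *\<^sub>C T x"
    "\<And>x. norm (T x) \<le> K * norm x"
  shows "bounded_clinear T"
  unfolding bounded_clinear_def
proof
  show "bounded_linear T"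
  proof (rule bounded_linear_intro[where K=K])
    show "T (r *\<^sub>R x) = r *\<^sub>R T x" for r x
      using assms(2)[of "complex_of_real r" x] by (simp add: scaleC_of_real)
  qed (use assms in \<open>auto simp: mult.commute\<close>)
qed (use assms in auto)

lemma bounded_clinear_compose:
  "bounded_clinear S \<Longrightarrow> bounded_clinear T \<Longrightarrow> bounded_clinear (\<lambda>x. S (T x))"
  using bounded_linear_compose[of S T] by (simp add: bounded_clinear_def)

lemma bounded_clinear_plus:
  "bounded_clinear S \<Longrightarrow> bounded_clinear T \<Longrightarrow> bounded_clinear (\<lambda>x. S x + T x)"
  by (auto simp: bounded_clinear_def scaleC_add_right intro: bounded_linear_add)

lemma bounded_clinear_minus:
  "bounded_clinear S \<Longrightarrow> bounded_clinear T \<Longrightarrow> bounded_clinear (\<lambda>x. S x - T x)"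
  by (auto simp: bounded_clinear_def scaleC_diff_right intro: bounded_linear_sub)

lemma bounded_clinear_scale: "bounded_clinear T \<Longrightarrow> bounded_clinear (\<lambda>x. a *\<^sub>C T x)"
  using bounded_linear_compose[OF bounded_linear_scaleC, of T a]
  by (simp add: bounded_clinear_def scaleC_scaleC mult.commute)

lemma bounded_clinear_ident: "bounded_clinear (\<lambda>x. x)"
  by (simp add: bounded_clinear_def bounded_linear_ident)

lemma bounded_clinear_const_zero: "bounded_clinear (\<lambda>x. 0)"
  by (simp add: bounded_clinear_def bounded_linear_zero)

lemma bounded_clinear_sum:
  "(\<And>i. i \<in> A \<Longrightarrow> bounded_clinear (T i)) \<Longrightarrow> bounded_clinear (\<lambda>x. \<Sum>i\<in>A. T i x)"
proof (induction A rule: infinite_finite_induct)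
  case (insert i A)
  then show ?case using bounded_clinear_plus[of "T i" "\<lambda>x. \<Sum>i\<in>A. T i x"] by simp
qed (simp_all add: bounded_clinear_const_zero)

lemma bounded_clinear_funpow: "bounded_clinear T \<Longrightarrow> bounded_clinear (T ^^ n)"
  for T :: "'a::chilbert_space \<Rightarrow> 'a"
proof (induction n)
  case 0
  have "T ^^ 0 = (\<lambda>x. x)" by (rule ext) simp
  then show ?case using bounded_clinear_ident by (simp only:)
next
  case (Suc n)
  then show ?case using bounded_clinear_compose[of T "T ^^ n"] by (simp add: o_def)
qed

lemma bounded_clinear_Pair:
  "bounded_clinear S \<Longrightarrow> bounded_clinear T \<Longrightarrow> bounded_clinear (\<lambda>x. (S x, T x))"
  by (auto simp: bounded_clinear_def scaleC_prod_def intro: bounded_linear_Pair)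

lemma fst_scaleC: "fst (a *\<^sub>C p) = a *\<^sub>C fst p" and snd_scaleC: "snd (a *\<^sub>C p) = a *\<^sub>C snd p"
  by (simp_all add: scaleC_prod_def)

lemma bounded_clinear_fst: "bounded_clinear fst"
  and bounded_clinear_snd: "bounded_clinear snd"
  by (auto simp: bounded_clinear_def scaleC_prod_def bounded_linear_fst bounded_linear_snd)

text \<open>The imaginary part of \<open>cinner\<close> is a real inner product involving
  \<open>\<i> *\<^sub>C x\<close>, and \<open>T\<close> commutes with \<i>; so a real adjoint
  identity is already a complex one.\<close>

lemma cinner_eq_adjointI:
  assumes T: "bounded_clinear T" and "\<And>x y. inner (T x) y = inner x (S y)"
  shows "cinner (T x) y = cinner x (S y)"
  using assms by (simp add: cinner_eq_Complex flip: bounded_clinear_scaleC[OF T])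

lemma cadjoint_eqI:
  assumes T: "bounded_clinear T" and S: "\<And>x y. inner (T x) y = inner x (S y)"
  shows "cadjoint T = S"
  unfolding cadjoint_def
proof (rule the_equality)
  show "\<forall>x y. cinner (T x) y = cinner x (S y)" using cinner_eq_adjointI[OF assms] by blast
next
  fix S' assume "\<forall>x y. cinner (T x) y = cinner x (S' y)"
  then have "inner x (S' y) = inner x (S y)" for x y by (metis Re_cinner S)
  then show "S' = S" by (meson ext vector_eq_ldot)
qed

lemma inner_cadjoint:
  assumes "bounded_clinear T"
  shows "inner (T x) y = inner x (cadjoint T y)"
proof -
  obtain S where "bounded_linear S" and S: "\<And>x y. inner (T x) y = inner x (S y)"
    by (rule adjoint_exists[OF bounded_clinear_linear[OF assms]]) (rule that)
  then show ?thesis by (simp add: cadjoint_eqI[OF assms S])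
qed

lemma inner_cadjoint_left:
  assumes "bounded_clinear T"
  shows "inner (cadjoint T y) x = inner y (T x)"
  using inner_cadjoint[OF assms] by (metis inner_commute)

lemma norm_cadjoint_le:
  assumes T: "bounded_clinear T" and le: "\<And>x. norm (T x) \<le> K * norm x" and K: "0 \<le> K"
  shows "norm (cadjoint T y) \<le> K * norm y"
proof (cases "cadjoint T y = 0")
  case False
  have "norm (cadjoint T y) * norm (cadjoint T y) = inner (T (cadjoint T y)) y"
    by (simp add: inner_cadjoint[OF T] power2_eq_square[symmetric] power2_norm_eq_inner)
  also have "\<dots> \<le> K * norm (cadjoint T y) * norm y"
    by (rule order_trans[OF norm_cauchy_schwarz]) (intro mult_right_mono le norm_ge_zero)
  finally have "norm (cadjoint T y) * norm (cadjoint T y) \<le> norm (cadjoint T y) * (K * norm y)"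
    by (simp add: ac_simps)
  then show ?thesis using False by (simp add: mult_le_cancel_left_pos)
qed (use K in simp)

lemma bounded_clinear_cadjoint:
  assumes T: "bounded_clinear T"
  shows "bounded_clinear (cadjoint T)"
proof -
  obtain K where K: "\<And>x. norm (T x) \<le> K * norm x" "0 \<le> K"
    by (metis bounded_linear.nonneg_bounded[OF bounded_clinear_linear[OF T]] mult.commute)
  show ?thesis
  proof (rule bounded_clinear_intro)
    fix x y and a :: complex
    show "cadjoint T (x + y) = cadjoint T x + cadjoint T y"
      by (rule inner_eqI) (simp add: inner_add_left inner_cadjoint_left[OF T])
    show "cadjoint T (a *\<^sub>C x) = a *\<^sub>C cadjoint T x"
      by (rule inner_eqI)
         (simp add: inner_cadjoint_left[OF T] inner_scaleC_left bounded_clinear_scaleC[OF T])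
    show "norm (cadjoint T x) \<le> K * norm x" by (rule norm_cadjoint_le[OF T K])
  qed
qed

section \<open>Closed complex subspaces and orthogonal projections\<close>

definition csubspace :: "'a::chilbert_space set \<Rightarrow> bool"
  where "csubspace M \<longleftrightarrow> subspace M \<and> (\<forall>a. \<forall>x\<in>M. a *\<^sub>C x \<in> M)"

lemma csubspace_range: "bounded_clinear T \<Longrightarrow> csubspace (range T)"
  unfolding csubspace_def
proof (intro conjI allI ballI)
  assume T: "bounded_clinear T"
  then show "subspace (range T)"
    by (intro linear_subspace_image bounded_linear.linear bounded_clinear_linear subspace_UNIV)
  fix a x assume "x \<in> range T"
  then obtain z where "x = T z" by blast
  then have "a *\<^sub>C x = T (a *\<^sub>C z)" by (simp add: bounded_clinear_scaleC[OF T])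
  then show "a *\<^sub>C x \<in> range T" by simp
qed

lemma csubspace_closure:
  assumes "csubspace M"
  shows "csubspace (closure M)"
  unfolding csubspace_def
proof (intro conjI allI ballI)
  show "subspace (closure M)" using assms by (simp add: csubspace_def subspace_closure)
  fix a x assume "x \<in> closure M"
  moreover have "(*\<^sub>C) a ` closure M \<subseteq> closure M"
    using assms by (intro image_closure_subset linear_continuous_on bounded_linear_scaleC)
      (auto simp: csubspace_def intro: closure_subset[THEN subsetD])
  ultimately show "a *\<^sub>C x \<in> closure M" by blast
qed

text \<open>A complex subspace contains \<open>\<i> *\<^sub>C m\<close> along with \<open>m\<close>,
  so real orthogonality also controls imaginary parts. This lets \<open>orth_proj\<close> be
  obtained from the real projection theorem.\<close>

lemma cinner_orthogonal_iff:
  assumes "csubspace M"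
  shows "(\<forall>m\<in>M. cinner x m = 0) \<longleftrightarrow> (\<forall>m\<in>M. inner x m = 0)"
proof
  assume "\<forall>m\<in>M. cinner x m = 0"
  then show "\<forall>m\<in>M. inner x m = 0" by (simp flip: Re_cinner)
next
  assume *: "\<forall>m\<in>M. inner x m = 0"
  have "\<i> *\<^sub>C m \<in> M" if "m \<in> M" for m using assms that by (simp add: csubspace_def)
  with * show "\<forall>m\<in>M. cinner x m = 0"
    by (simp add: cinner_eq_Complex complex_eq_iff inner_ii_left)
qed

locale closed_csubspace =
  fixes M :: "'a::chilbert_space set"
  assumes csub: "csubspace M" and closed: "closed M"
begin

lemma sub: "subspace M" using csub by (simp add: csubspace_def)

lemma orth_proj_spec: "orth_proj M x \<in> M \<and> (\<forall>m\<in>M. cinner (x - orth_proj M x) m = 0)"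
  unfolding orth_proj_def
proof (rule theI')
  obtain y where y: "y \<in> M" "\<And>m. m \<in> M \<Longrightarrow> inner (x - y) m = 0"
    using orthogonal_projection_exists[OF sub closed] by blast
  show "\<exists>!y. y \<in> M \<and> (\<forall>m\<in>M. cinner (x - y) m = 0)"
    unfolding cinner_orthogonal_iff[OF csub]
  proof (rule ex1I[of _ y])
    fix z assume z: "z \<in> M \<and> (\<forall>m\<in>M. inner (x - z) m = 0)"
    then have "z - y \<in> M" using y sub by (simp add: subspace_diff)
    then have "inner (x - z) (z - y) = 0" "inner (x - y) (z - y) = 0" using z y by auto
    then have "inner (z - y) (z - y) = 0" by (simp add: inner_simps)
    then show "z = y" by simp
  qed (use y in auto)
qed

lemma orth_proj_mem: "orth_proj M x \<in> M"
  using orth_proj_spec by blast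

lemma orth_proj_orth: "m \<in> M \<Longrightarrow> inner (x - orth_proj M x) m = 0"
  using orth_proj_spec[of x] by (metis Re_cinner zero_complex.sel(1))

lemma orth_proj_eqI:
  assumes "y \<in> M" "\<And>m. m \<in> M \<Longrightarrow> inner (x - y) m = 0"
  shows "orth_proj M x = y"
proof -
  have "y - orth_proj M x \<in> M" using assms(1) orth_proj_mem sub by (simp add: subspace_diff)
  then have "inner (x - y) (y - orth_proj M x) = 0"
    "inner (x - orth_proj M x) (y - orth_proj M x) = 0" using assms orth_proj_orth by auto
  then have "inner (y - orth_proj M x) (y - orth_proj M x) = 0" by (simp add: inner_simps)
  then show ?thesis by simp
qed

lemma inner_orth_proj: "m \<in> M \<Longrightarrow> inner (orth_proj M x) m = inner x m"
  using orth_proj_orth[of m x] by (simp add: inner_simps)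

lemma orth_proj_pythagoras: "(norm x)\<^sup>2 = (norm (orth_proj M x))\<^sup>2 + (norm (x - orth_proj M x))\<^sup>2"
  using norm_add_sq[of "x - orth_proj M x" "orth_proj M x"] orth_proj_orth[OF orth_proj_mem, of x x]
  by simp

lemma norm_orth_proj_le: "norm (orth_proj M x) \<le> norm x"
  by (rule power2_le_imp_le) (simp_all add: orth_proj_pythagoras[of x])

lemma orth_proj_nearest:
  assumes "m \<in> M"
  shows "(norm (x - orth_proj M x))\<^sup>2 \<le> (norm (x - m))\<^sup>2"
proof -
  have "orth_proj M x - m \<in> M" using assms orth_proj_mem sub by (simp add: subspace_diff)
  then have "inner (x - orth_proj M x) (orth_proj M x - m) = 0" by (rule orth_proj_orth)
  then show ?thesis using norm_add_sq[of "x - orth_proj M x" "orth_proj M x - m"] by simp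
qed

lemma orth_proj_ident: "x \<in> M \<Longrightarrow> orth_proj M x = x"
  by (rule orth_proj_eqI) auto

lemma orth_proj_eq_0: "(\<And>m. m \<in> M \<Longrightarrow> inner x m = 0) \<Longrightarrow> orth_proj M x = 0"
  using sub by (intro orth_proj_eqI) (auto simp: subspace_0)

lemma bounded_clinear_orth_proj: "bounded_clinear (orth_proj M)"
proof (rule bounded_clinear_intro[where K=1])
  fix x y and a :: complex
  show "orth_proj M (x + y) = orth_proj M x + orth_proj M y"
  proof (rule orth_proj_eqI)
    show "orth_proj M x + orth_proj M y \<in> M" using sub orth_proj_mem by (simp add: subspace_add)
    fix m assume "m \<in> M"
    from orth_proj_orth[OF this, of x] orth_proj_orth[OF this, of y]
    show "inner (x + y - (orth_proj M x + orth_proj M y)) m = 0" by (simp add: inner_simps)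
  qed
  show "orth_proj M (a *\<^sub>C x) = a *\<^sub>C orth_proj M x"
  proof (rule orth_proj_eqI)
    show "a *\<^sub>C orth_proj M x \<in> M" using csub orth_proj_mem by (simp add: csubspace_def)
    fix m assume "m \<in> M"
    then have "cnj a *\<^sub>C m \<in> M" using csub by (simp add: csubspace_def)
    from orth_proj_orth[OF this, of x]
    show "inner (a *\<^sub>C x - a *\<^sub>C orth_proj M x) m = 0"
      by (simp add: inner_scaleC_left flip: scaleC_diff_right)
  qed
  show "norm (orth_proj M x) \<le> 1 * norm x" using norm_orth_proj_le by simp
qed

text \<open>A closed subspace is its own double orthogonal complement. It reduces the membership of
  vectors such as \<open>R z\<close> or \<open>cadjoint Theta h\<close> to the vanishing of
  \<open>R\<close> or \<open>Theta\<close> on the complement.\<close>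

lemma mem_if_orth_complement:
  assumes "\<And>n. (\<And>m. m \<in> M \<Longrightarrow> inner n m = 0) \<Longrightarrow> inner x n = 0"
  shows "x \<in> M"
proof -
  have "inner x (x - orth_proj M x) = 0" by (rule assms) (rule orth_proj_orth)
  moreover have "inner (orth_proj M x) (x - orth_proj M x) = 0"
    using orth_proj_orth[OF orth_proj_mem, of x x] by (simp add: inner_commute)
  ultimately have "inner (x - orth_proj M x) (x - orth_proj M x) = 0" by (simp add: inner_simps)
  then show ?thesis using orth_proj_mem[of x] by simp
qed

end

lemma closed_csubspace_closure_range:
  "bounded_clinear T \<Longrightarrow> closed_csubspace (closure (range T))"
  by unfold_locales (auto intro: csubspace_closure csubspace_range)

section \<open>Non-negative operators\<close>

lemma nonneg_op_bounded_clinear: "nonneg_op T \<Longrightarrow> bounded_clinear T"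
  by (simp add: nonneg_op_def)

lemma nonneg_op_inner: "nonneg_op T \<Longrightarrow> 0 \<le> inner (T x) x"
  by (simp add: nonneg_op_def Re_cinner)

text \<open>The quadratic form \<open>inner (\<i> *\<^sub>C T x) x\<close> vanishes. Polarization
  makes its bilinear form antisymmetric, and replacing \<open>x\<close> by
  \<open>- \<i> *\<^sub>C x\<close> turns antisymmetry into symmetry of \<open>T\<close>.\<close>

lemma nonneg_op_selfadjoint:
  assumes "nonneg_op T"
  shows "inner (T x) y = inner x (T y)"
proof -
  have T: "bounded_clinear T" using assms by (simp add: nonneg_op_def)
  have 0: "inner (\<i> *\<^sub>C T x) x = 0" for x
  proof -
    have "Im (cinner (T x) x) = 0" using assms unfolding nonneg_op_def by (meson complex_is_Real_iff)
    then show ?thesis by (simp add: Im_cinner)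
  qed
  have anti: "inner (\<i> *\<^sub>C T x) y = - inner (\<i> *\<^sub>C T y) x" for x y
    using 0[of "x + y"] 0[of x] 0[of y]
    by (simp add: bounded_clinear_add[OF T] scaleC_add_right inner_simps)
  have "inner (T x) y = inner (\<i> *\<^sub>C T (\<i> *\<^sub>C (- x))) y"
    by (simp add: bounded_clinear_scaleC[OF T] scaleC_ii linear_neg[OF bounded_linear.linear[OF bounded_clinear_linear[OF T]]])
  also have "\<dots> = inner (T y) x"
    by (subst anti) (simp add: inner_scaleC_ii)
  finally show ?thesis by (simp add: inner_commute)
qed

lemma nonneg_opI:
  assumes "bounded_clinear T" "\<And>x y. inner (T x) y = inner x (T y)" "\<And>x. 0 \<le> inner (T x) x"
  shows "nonneg_op T"
proof -
  have "inner (\<i> *\<^sub>C T x) x = 0" for x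
    using assms(2)[of x "\<i> *\<^sub>C x"] inner_ii_left[of "T x" x] inner_commute[of x "\<i> *\<^sub>C T x"]
    by (simp add: bounded_clinear_scaleC[OF assms(1)])
  then show ?thesis using assms
    by (auto simp: nonneg_op_def Re_cinner complex_is_Real_iff Im_cinner)
qed

section \<open>Square roots of non-negative operators\<close>

text \<open>These are the coefficients of the binomial series of \<open>(1 - x)\<^sup>1\<^sup>/\<^sup>2\<close>. They are absolutely summable, so
  the series can be evaluated at every contraction, of norm \<open>1\<close> included.\<close>

definition sqrt_coeff :: "nat \<Rightarrow> real"
  where "sqrt_coeff n = (1/2 gchoose n) * (-1) ^ n"

lemma sqrt_coeff_pochhammer: "sqrt_coeff n = pochhammer (-1/2) n / fact n"
  by (simp add: sqrt_coeff_def gbinomial_pochhammer power_mult_distrib[symmetric])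

lemma sqrt_coeff_0: "sqrt_coeff 0 = 1"
  by (simp add: sqrt_coeff_def)

lemma sqrt_coeff_nonpos: "n > 0 \<Longrightarrow> sqrt_coeff n \<le> 0"
proof (cases n)
  case (Suc m)
  have "0 \<le> pochhammer (1/2::real) m" by (rule pochhammer_nonneg) simp
  then show ?thesis
    unfolding sqrt_coeff_pochhammer Suc pochhammer_rec by (simp add: divide_le_0_iff)
qed simp

text \<open>Partial sums of the coefficients of (1 - x)^(1/2) are the coefficients of (1 - x)^(1/2)
  / (1 - x) = (1 - x)^(-1/2), which are all nonnegative.\<close>

lemma sum_sqrt_coeff_nonneg: "0 \<le> (\<Sum>n\<le>N. sqrt_coeff n)"
proof -
  have "(\<Sum>n\<le>N. sqrt_coeff n) = (-1) ^ N * (-1/2 gchoose N)"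
    using gbinomial_sum_lower_neg[of "1/2::real" N] by (simp add: sqrt_coeff_def)
  also have "\<dots> = pochhammer (1/2) N / fact N"
    by (simp add: gbinomial_pochhammer power_mult_distrib[symmetric])
  also have "\<dots> \<ge> 0" using pochhammer_nonneg[of "1/2::real" N] by simp
  finally show ?thesis .
qed

text \<open>Only the constant coefficient 1 is positive, so coefficients and absolute values
  together sum to 2; nonnegativity of the plain partial sums gives the bound.\<close>

lemma sum_abs_sqrt_coeff_le: "(\<Sum>n<N. \<bar>sqrt_coeff n\<bar>) \<le> 2"
proof (cases N)
  case (Suc M)
  have "(\<Sum>n\<le>M. \<bar>sqrt_coeff n\<bar>) + (\<Sum>n\<le>M. sqrt_coeff n) = (\<Sum>n\<le>M. if n = 0 then 2 else 0)"
    unfolding sum.distrib[symmetric]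
    by (intro sum.cong) (use sqrt_coeff_nonpos in \<open>auto simp: sqrt_coeff_0\<close>)
  also have "\<dots> = 2" by (simp add: sum.delta)
  finally show ?thesis using sum_sqrt_coeff_nonneg[of M] by (simp add: Suc lessThan_Suc_atMost)
qed simp

lemma summable_abs_sqrt_coeff: "summable (\<lambda>n. \<bar>sqrt_coeff n\<bar>)"
proof (rule bounded_imp_summable[where B=2])
  show "(\<Sum>k\<le>n. \<bar>sqrt_coeff k\<bar>) \<le> 2" for n
    using sum_abs_sqrt_coeff_le[of "Suc n"] by (simp only: lessThan_Suc_atMost)
qed simp

text \<open>Squaring the series of (1 - x)^(1/2) gives 1 - x; on coefficients this is Vandermonde's
  identity.\<close>

lemma sqrt_coeff_conv:
  "(\<Sum>k\<le>n. sqrt_coeff k * sqrt_coeff (n - k)) = (if n = 0 then 1 else if n = 1 then -1 else 0)"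
proof -
  have "(\<Sum>k\<le>n. sqrt_coeff k * sqrt_coeff (n - k))
      = (\<Sum>k\<le>n. (1/2 gchoose k) * (1/2 gchoose (n - k)) * (-1) ^ n)"
  proof (intro sum.cong refl)
    fix k assume "k \<in> {..n}"
    then have "(-1::real) ^ n = (-1) ^ k * (-1) ^ (n - k)" by (simp flip: power_add)
    then show "sqrt_coeff k * sqrt_coeff (n - k)
        = (1/2 gchoose k) * (1/2 gchoose (n - k)) * (-1) ^ n" by (simp add: sqrt_coeff_def)
  qed
  also have "\<dots> = ((1::real) gchoose n) * (-1) ^ n"
    using gbinomial_Vandermonde[of "1/2::real" "1/2" n]
    by (simp add: atMost_atLeast0 flip: sum_distrib_right)
  also have "(1::real) gchoose n = of_nat (1 choose n)"
    by (simp only: binomial_gbinomial of_nat_1)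
  finally have *: "(\<Sum>k\<le>n. sqrt_coeff k * sqrt_coeff (n - k)) = of_nat (1 choose n) * (-1) ^ n" .
  consider "n = 0" | "n = 1" | "n > 1" by linarith
  then show ?thesis unfolding * by cases (auto simp: binomial_eq_0)
qed

text \<open>The sums over the square and over the triangle k + j < N both converge to the square of
  the total mass, so the corner between them carries no mass in the limit.\<close>

lemma sum_square_minus_triangle_tendsto_0:
  fixes a :: "nat \<Rightarrow> real"
  assumes "summable (\<lambda>n. \<bar>a n\<bar>)"
  shows "(\<lambda>N. \<Sum>(k,j)\<in>{..<N}\<times>{..<N} - {(k,j). k + j < N}. \<bar>a k\<bar> * \<bar>a j\<bar>) \<longlonglongrightarrow> 0"
proof -
  define L where "L = (\<Sum>n. \<bar>a n\<bar>)"
  have "(\<lambda>k. \<Sum>i\<le>k. \<bar>a i\<bar> * \<bar>a (k - i)\<bar>) sums (L * L)"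
    unfolding L_def using assms by (intro Cauchy_product_sums) auto
  moreover have "(\<lambda>n. \<bar>a n\<bar>) sums L" unfolding L_def using assms by (rule summable_sums)
  ultimately have "(\<lambda>N. (\<Sum>k<N. \<bar>a k\<bar>) * (\<Sum>j<N. \<bar>a j\<bar>)
      - (\<Sum>k<N. \<Sum>i\<le>k. \<bar>a i\<bar> * \<bar>a (k - i)\<bar>)) \<longlonglongrightarrow> L * L - L * L"
    unfolding sums_def by (intro tendsto_intros)
  moreover have "(\<Sum>(k,j)\<in>{..<N}\<times>{..<N} - {(k,j). k + j < N}. \<bar>a k\<bar> * \<bar>a j\<bar>)
      = (\<Sum>k<N. \<bar>a k\<bar>) * (\<Sum>j<N. \<bar>a j\<bar>) - (\<Sum>k<N. \<Sum>i\<le>k. \<bar>a i\<bar> * \<bar>a (k - i)\<bar>)" for N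
  proof -
    have "{(k,j). k + j < N} \<subseteq> {..<N}\<times>{..<N}" by auto
    moreover have "(\<Sum>(k,j)\<in>{(k,j). k + j < N}. \<bar>a k\<bar> * \<bar>a j\<bar>)
        = (\<Sum>k<N. \<Sum>i\<le>k. \<bar>a i\<bar> * \<bar>a (k - i)\<bar>)"
      by (rule sum.triangle_reindex)
    ultimately show ?thesis
      by (subst sum_diff) (simp_all add: sum_product sum.cartesian_product)
  qed
  ultimately show ?thesis by simp
qed

locale contraction_sqrt =
  fixes B :: "'a::chilbert_space \<Rightarrow> 'a"
  assumes B: "bounded_clinear B" and B_le: "\<And>x. norm (B x) \<le> norm x"
begin

definition psum :: "nat \<Rightarrow> 'a \<Rightarrow> 'a"
  where "psum N x = (\<Sum>n<N. sqrt_coeff n *\<^sub>R (B ^^ n) x)"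

definition root_op :: "'a \<Rightarrow> 'a"
  where "root_op x = (\<Sum>n. sqrt_coeff n *\<^sub>R (B ^^ n) x)"

lemma pow_le: "norm ((B ^^ n) x) \<le> norm x"
  by (induction n) (auto intro: order_trans[OF B_le])

lemma psum_le: "norm (psum N x) \<le> 2 * norm x"
proof -
  have "norm (psum N x) \<le> (\<Sum>n<N. norm (sqrt_coeff n *\<^sub>R (B ^^ n) x))"
    unfolding psum_def by (rule norm_sum)
  also have "\<dots> \<le> (\<Sum>n<N. \<bar>sqrt_coeff n\<bar> * norm x)"
    by (intro sum_mono) (simp add: pow_le mult_left_mono)
  also have "\<dots> \<le> 2 * norm x"
    unfolding sum_distrib_right[symmetric] by (intro mult_right_mono sum_abs_sqrt_coeff_le) simp
  finally show ?thesis .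
qed

lemma psum_tendsto: "(\<lambda>N. psum N x) \<longlonglongrightarrow> root_op x"
proof -
  have "summable (\<lambda>n. norm (sqrt_coeff n *\<^sub>R (B ^^ n) x))"
  proof (rule summable_comparison_test')
    show "summable (\<lambda>n. \<bar>sqrt_coeff n\<bar> * norm x)"
      by (intro summable_mult2 summable_abs_sqrt_coeff)
    show "norm (norm (sqrt_coeff n *\<^sub>R (B ^^ n) x)) \<le> \<bar>sqrt_coeff n\<bar> * norm x" if "n \<ge> 0" for n
      by (simp add: pow_le mult_left_mono)
  qed
  then have "(\<lambda>n. sqrt_coeff n *\<^sub>R (B ^^ n) x) sums root_op x"
    unfolding root_op_def by (rule summable_sums[OF summable_norm_cancel])
  then show ?thesis by (simp add: sums_def psum_def)
qed

lemma psum_clinear: "bounded_clinear (psum N)"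
proof -
  have "bounded_clinear (\<lambda>x. sqrt_coeff n *\<^sub>R (B ^^ n) x)" for n
    using bounded_clinear_scale[OF bounded_clinear_funpow[OF B], of "complex_of_real (sqrt_coeff n)" n]
    by (simp add: scaleC_of_real)
  then have "bounded_clinear (\<lambda>x. \<Sum>n<N. sqrt_coeff n *\<^sub>R (B ^^ n) x)"
    by (intro bounded_clinear_sum)
  then show ?thesis by (simp add: psum_def[abs_def])
qed

lemma root_op_le: "norm (root_op x) \<le> 2 * norm x"
  by (rule tendsto_upperbound[OF tendsto_norm[OF psum_tendsto]]) (simp_all add: psum_le)

lemma root_op_clinear: "bounded_clinear root_op"
proof (rule bounded_clinear_intro[where K=2])
  fix x y and a :: complex
  show "root_op (x + y) = root_op x + root_op y"
  proof (rule LIMSEQ_unique[OF psum_tendsto])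
    show "(\<lambda>N. psum N (x + y)) \<longlonglongrightarrow> root_op x + root_op y"
      using tendsto_add[OF psum_tendsto psum_tendsto]
      by (simp add: bounded_clinear_add[OF psum_clinear])
  qed
  show "root_op (a *\<^sub>C x) = a *\<^sub>C root_op x"
  proof (rule LIMSEQ_unique[OF psum_tendsto])
    show "(\<lambda>N. psum N (a *\<^sub>C x)) \<longlonglongrightarrow> a *\<^sub>C root_op x"
      using bounded_linear.tendsto[OF bounded_linear_scaleC psum_tendsto]
      by (simp add: bounded_clinear_scaleC[OF psum_clinear])
  qed
qed (rule root_op_le)

text \<open>Applying \<open>psum N\<close> twice sums over a square of indices. The triangle part
  collapses to \<open>x - B x\<close> by \<open>sqrt_coeff_conv\<close>, and the corner tends to
  0.\<close>

lemma root_op_square: "root_op (root_op x) = x - B x"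
proof -
  define D where "D N = {..<N}\<times>{..<N} - {(k,j). k + j < N}" for N :: nat
  let ?t = "\<lambda>(k,j). (sqrt_coeff k * sqrt_coeff j) *\<^sub>R (B ^^ (k + j)) x"
  have pp: "psum N (psum N x) = (\<Sum>p\<in>{..<N}\<times>{..<N}. ?t p)" for N
  proof -
    have "(B ^^ k) (psum N x) = (\<Sum>j<N. sqrt_coeff j *\<^sub>R (B ^^ (k + j)) x)" for k
      by (simp add: psum_def linear_sum[OF bounded_linear.linear[OF bounded_clinear_linear[OF bounded_clinear_funpow[OF B]]]]
          bounded_clinear_scaleR[OF bounded_clinear_funpow[OF B]] funpow_add)
    then have "psum N (psum N x)
        = (\<Sum>k<N. \<Sum>j<N. (sqrt_coeff k * sqrt_coeff j) *\<^sub>R (B ^^ (k + j)) x)"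
      by (subst psum_def) (simp add: scaleR_sum_right)
    then show ?thesis by (simp add: sum.cartesian_product)
  qed
  have tri: "(\<Sum>p\<in>{(k,j). k + j < N}. ?t p) = x - B x" if "N \<ge> 2" for N
  proof -
    have "(\<Sum>p\<in>{(k,j). k + j < N}. ?t p)
        = (\<Sum>n<N. \<Sum>k\<le>n. (sqrt_coeff k * sqrt_coeff (n - k)) *\<^sub>R (B ^^ (k + (n - k))) x)"
      by (rule sum.triangle_reindex)
    also have "\<dots> = (\<Sum>n<N. (\<Sum>k\<le>n. sqrt_coeff k * sqrt_coeff (n - k)) *\<^sub>R (B ^^ n) x)"
      by (intro sum.cong refl) (simp add: scaleR_sum_left)
    also have "\<dots> = (\<Sum>n<2. (if n = 0 then 1 else if n = 1 then -1 else 0) *\<^sub>R (B ^^ n) x)"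
      unfolding sqrt_coeff_conv using that by (intro sum.mono_neutral_right) auto
    also have "\<dots> = x - B x" by (simp add: numeral_2_eq_2)
    finally show ?thesis .
  qed
  have "(\<lambda>N. psum N (psum N x)) \<longlonglongrightarrow> x - B x"
  proof (rule Lim_transform)
    show "(\<lambda>N. x - B x) \<longlonglongrightarrow> x - B x" by simp
    have "(\<lambda>N. psum N (psum N x) - (x - B x)) \<longlonglongrightarrow> 0"
    proof (rule Lim_null_comparison)
      show "\<forall>\<^sub>F N in sequentially. norm (psum N (psum N x) - (x - B x))
          \<le> (\<Sum>(k,j)\<in>D N. \<bar>sqrt_coeff k\<bar> * \<bar>sqrt_coeff j\<bar>) * norm x"
        using eventually_ge_at_top[of 2]
      proof eventually_elim
        case (elim N)
        have "{(k,j). k + j < N} \<subseteq> {..<N}\<times>{..<N}" by auto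
        then have "(\<Sum>p\<in>D N. ?t p) = psum N (psum N x) - (x - B x)"
          unfolding D_def by (subst sum_diff) (simp_all add: pp tri[OF elim])
        then have "norm (psum N (psum N x) - (x - B x)) \<le> (\<Sum>p\<in>D N. norm (?t p))"
          using norm_sum[of ?t "D N"] by simp
        also have "\<dots> \<le> (\<Sum>(k,j)\<in>D N. \<bar>sqrt_coeff k\<bar> * \<bar>sqrt_coeff j\<bar> * norm x)"
          by (intro sum_mono) (auto simp: abs_mult pow_le mult_left_mono)
        finally show ?case by (simp add: sum_distrib_right case_prod_unfold)
      qed
      show "(\<lambda>N. (\<Sum>(k,j)\<in>D N. \<bar>sqrt_coeff k\<bar> * \<bar>sqrt_coeff j\<bar>) * norm x) \<longlonglongrightarrow> 0"
        unfolding D_def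
        by (rule tendsto_mult_left_zero[OF sum_square_minus_triangle_tendsto_0[OF summable_abs_sqrt_coeff]])
    qed
    then show "(\<lambda>N. psum N (psum N x) - (x - B x)) \<longlonglongrightarrow> 0" .
  qed
  moreover have "(\<lambda>N. psum N (psum N x)) \<longlonglongrightarrow> root_op (root_op x)"
  proof -
    \<comment> \<open>Strong convergence survives composition because all \<open>psum N\<close> are
      bounded by 2.\<close>
    have "(\<lambda>N. psum N (psum N x - root_op x)) \<longlonglongrightarrow> 0"
    proof (rule Lim_null_comparison)
      show "\<forall>\<^sub>F N in sequentially. norm (psum N (psum N x - root_op x)) \<le> 2 * norm (psum N x - root_op x)"
        by (simp add: psum_le)
      show "(\<lambda>N. 2 * norm (psum N x - root_op x)) \<longlonglongrightarrow> 0"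
        by (intro tendsto_mult_right_zero tendsto_norm_zero LIM_zero psum_tendsto)
    qed
    from tendsto_add[OF this psum_tendsto[of "root_op x"]] show ?thesis
      by (simp add: bounded_clinear_diff[OF psum_clinear])
  qed
  ultimately show ?thesis by (metis LIMSEQ_unique)
qed

text \<open>Needed for uniqueness of the square root: whatever commutes with the operator commutes
  with this particular root.\<close>

lemma root_op_commute:
  assumes C: "bounded_linear C" and comm: "\<And>x. C (B x) = B (C x)"
  shows "C (root_op x) = root_op (C x)"
proof (rule LIMSEQ_unique)
  interpret C: bounded_linear C by fact
  show "(\<lambda>N. C (psum N x)) \<longlonglongrightarrow> C (root_op x)"
    by (rule C.tendsto[OF psum_tendsto])
  have "C ((B ^^ n) x) = (B ^^ n) (C x)" for n
    by (induction n) (simp_all add: comm)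
  then show "(\<lambda>N. C (psum N x)) \<longlonglongrightarrow> root_op (C x)"
    using psum_tendsto[of "C x"] by (simp add: psum_def C.sum C.scaleR)
qed

lemma nonneg_root_op:
  assumes sa: "\<And>x y. inner (B x) y = inner x (B y)"
  shows "nonneg_op root_op"
proof (rule nonneg_opI[OF root_op_clinear])
  fix x y
  have "inner ((B ^^ n) x) y = inner x ((B ^^ n) y)" for n x y
    by (induction n arbitrary: y) (simp_all add: sa, simp add: funpow_swap1)
  then have "inner (psum N x) y = inner x (psum N y)" for N
    by (simp add: psum_def inner_sum_left inner_sum_right)
  moreover have "(\<lambda>N. inner (psum N x) y) \<longlonglongrightarrow> inner (root_op x) y"
    "(\<lambda>N. inner x (psum N y)) \<longlonglongrightarrow> inner x (root_op y)"
    by (intro tendsto_intros psum_tendsto)+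
  ultimately show "inner (root_op x) y = inner x (root_op y)"
    by (metis (no_types, lifting) LIMSEQ_unique ext)
  show "0 \<le> inner (root_op x) x"
  proof (rule tendsto_lowerbound)
    show "(\<lambda>N. inner (psum (Suc N) x) x) \<longlonglongrightarrow> inner (root_op x) x"
      by (intro tendsto_intros LIMSEQ_Suc psum_tendsto)
    \<comment> \<open>For n > 0 the coefficient is nonpositive and
      \<open>inner ((B ^^ n) x) x\<close> is at most \<open>(norm x)\<^sup>2\<close>, so inserting
      the latter only lowers the sum, down to a nonnegative partial sum of coefficients.\<close>
    have "0 \<le> inner (psum (Suc N) x) x" for N
    proof -
      have "0 \<le> (\<Sum>n\<le>N. sqrt_coeff n) * (norm x)\<^sup>2"
        by (intro mult_nonneg_nonneg sum_sqrt_coeff_nonneg) simp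
      also have "\<dots> = (\<Sum>n\<le>N. sqrt_coeff n * (norm x)\<^sup>2)" by (rule sum_distrib_right)
      also have "\<dots> \<le> (\<Sum>n\<le>N. sqrt_coeff n * inner ((B ^^ n) x) x)"
      proof (rule sum_mono)
        fix n
        show "sqrt_coeff n * (norm x)\<^sup>2 \<le> sqrt_coeff n * inner ((B ^^ n) x) x"
        proof (cases "n = 0")
          case False
          have "inner ((B ^^ n) x) x \<le> norm ((B ^^ n) x) * norm x" by (rule norm_cauchy_schwarz)
          also have "\<dots> \<le> norm x * norm x" by (intro mult_right_mono pow_le) simp
          finally show ?thesis using sqrt_coeff_nonpos[of n] False
            by (intro mult_left_mono_neg) (auto simp: power2_eq_square)
        qed (simp add: power2_norm_eq_inner)
      qed
      finally show ?thesis by (simp add: psum_def inner_sum_left lessThan_Suc_atMost del: sum.lessThan_Suc)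
    qed
    then show "\<forall>\<^sub>F N in sequentially. 0 \<le> inner (psum (Suc N) x) x" by simp
  qed simp
qed

end

text \<open>The operator inequality T^2 \<le> c T without spectral theory: it is positivity of
  \<open>T\<close> at the vector x - T x / c.\<close>

lemma nonneg_op_norm_sq_le:
  assumes T: "nonneg_op T" and le: "\<And>x. norm (T x) \<le> c * norm x" and c: "c > 0"
  shows "(norm (T x))\<^sup>2 \<le> c * inner (T x) x"
proof -
  note cl = nonneg_op_bounded_clinear[OF T]
  define t where "t = 1 / c"
  have n: "norm (T x) * norm (T x) = inner (T x) (T x)"
    by (metis power2_eq_square power2_norm_eq_inner)
  have "0 \<le> inner (T (x - t *\<^sub>R T x)) (x - t *\<^sub>R T x)" by (rule nonneg_op_inner[OF T])
  also have "\<dots> = inner (T x) x - 2 * t * (norm (T x))\<^sup>2 + t\<^sup>2 * inner (T (T x)) (T x)"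
    by (simp add: bounded_clinear_diff[OF cl] bounded_clinear_scaleR[OF cl] inner_simps
        power2_norm_eq_inner nonneg_op_selfadjoint[OF T, of "T x" x] power2_eq_square n algebra_simps)
  also have "inner (T (T x)) (T x) \<le> c * norm (T x) * norm (T x)"
    by (rule order_trans[OF norm_cauchy_schwarz]) (intro mult_right_mono le norm_ge_zero)
  finally have "0 \<le> inner (T x) x - 2 * t * (norm (T x))\<^sup>2 + t\<^sup>2 * (c * norm (T x) * norm (T x))"
    by (simp add: mult_left_mono)
  also have "\<dots> = inner (T x) x - (norm (T x))\<^sup>2 / c"
    using c by (simp add: t_def power2_eq_square field_simps)
  finally show ?thesis using c by (simp add: field_simps)
qed

lemma nonneg_op_bound_exists:
  assumes "nonneg_op T"
  obtains c where "c > 0" "\<And>x. norm (T x) \<le> c * norm x"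
  using bounded_linear.pos_bounded[OF bounded_clinear_linear[OF nonneg_op_bounded_clinear[OF assms]]]
  by (metis mult.commute)

lemma nonneg_op_inner_eq_0:
  assumes T: "nonneg_op T" and "inner (T x) x = 0"
  shows "T x = 0"
proof -
  obtain c where "c > 0" "\<And>x. norm (T x) \<le> c * norm x" using nonneg_op_bound_exists[OF T] by blast
  from nonneg_op_norm_sq_le[OF T this(2,1), of x] assms(2) show ?thesis by simp
qed

text \<open>With T bounded by c, B = I - T / c is a contraction by T^2 \<le> c T, and T = c (I - B);
  so the root is sqrt c times the binomial series in B.\<close>

lemma nonneg_sqrt_exists:
  assumes T: "nonneg_op T"
  obtains R where "nonneg_op R" "\<And>x. R (R x) = T x"
    "\<And>C x. bounded_linear C \<Longrightarrow> (\<And>x. C (T x) = T (C x)) \<Longrightarrow> C (R x) = R (C x)"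
proof -
  note cl = nonneg_op_bounded_clinear[OF T]
  obtain c where c: "c > 0" "\<And>x. norm (T x) \<le> c * norm x" using nonneg_op_bound_exists[OF T] by blast
  define B where "B x = x - (1/c) *\<^sub>R T x" for x
  interpret contraction_sqrt B
  proof
    have "bounded_clinear (\<lambda>x. x - complex_of_real (1/c) *\<^sub>C T x)"
      by (intro bounded_clinear_minus bounded_clinear_scale bounded_clinear_ident cl)
    then show "bounded_clinear B" by (simp only: B_def[abs_def] scaleC_of_real)
    fix x
    have "(norm (B x))\<^sup>2 = (norm x)\<^sup>2 - 2 / c * inner (T x) x + (norm (T x))\<^sup>2 / c\<^sup>2"
      unfolding B_def norm_diff_sq by (simp add: power_divide inner_commute)
    also have "\<dots> \<le> (norm x)\<^sup>2 - 2 / c * inner (T x) x + (c * inner (T x) x) / c\<^sup>2"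
      by (intro add_left_mono divide_right_mono nonneg_op_norm_sq_le[OF T c(2,1)]) simp
    also have "\<dots> = (norm x)\<^sup>2 - inner (T x) x / c" using c(1) by (simp add: field_simps power2_eq_square)
    also have "\<dots> \<le> (norm x)\<^sup>2" using c(1) nonneg_op_inner[OF T, of x] by simp
    finally show "norm (B x) \<le> norm x" by (simp add: power2_le_iff_abs_le)
  qed
  define R where "R x = sqrt c *\<^sub>R root_op x" for x
  note rl = bounded_clinear_scaleR[OF root_op_clinear]
  have sa: "inner (B x) y = inner x (B y)" for x y
    by (simp add: B_def inner_simps nonneg_op_selfadjoint[OF T])
  show ?thesis
  proof (rule that)
    note N = nonneg_root_op[OF sa]
    show "nonneg_op R"
    proof (rule nonneg_opI)
      have "bounded_clinear (\<lambda>x. complex_of_real (sqrt c) *\<^sub>C root_op x)"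
        by (intro bounded_clinear_scale root_op_clinear)
      then show "bounded_clinear R" by (simp only: R_def[abs_def] scaleC_of_real)
      show "inner (R x) y = inner x (R y)" for x y
        by (simp add: R_def nonneg_op_selfadjoint[OF N])
      show "0 \<le> inner (R x) x" for x using nonneg_op_inner[OF N] c(1) by (simp add: R_def)
    qed
    show "R (R x) = T x" for x
      using c(1) by (simp add: R_def rl root_op_square B_def)
    show "C (R x) = R (C x)" if C: "bounded_linear C" and comm: "\<And>x. C (T x) = T (C x)" for C x
    proof -
      interpret C: bounded_linear C by fact
      have "C (B x) = B (C x)" for x by (simp add: B_def C.diff C.scaleR comm)
      from root_op_commute[OF C this, of x] show ?thesis by (simp add: R_def C.scaleR)
    qed
  qed
qed

text \<open>A second root \<open>R\<close> commutes with T = R R and hence with \<open>S\<close>, so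
  (S + R)(S - R) = 0. Positivity forces \<open>S\<close> and \<open>R\<close> each to vanish on
  \<open>y = S x - R x\<close>, which is then orthogonal to itself.\<close>

lemma sqrt_op_ex1:
  assumes T: "nonneg_op T"
  shows "\<exists>!R. nonneg_op R \<and> R \<circ> R = T"
proof -
  obtain S where S: "nonneg_op S" "\<And>x. S (S x) = T x"
    and comm: "\<And>C x. bounded_linear C \<Longrightarrow> (\<And>x. C (T x) = T (C x)) \<Longrightarrow> C (S x) = S (C x)"
    using nonneg_sqrt_exists[OF T] by metis
  show ?thesis
  proof (rule ex1I[of _ S])
    show "nonneg_op S \<and> S \<circ> S = T" using S by (auto simp: fun_eq_iff)
    fix R assume R: "nonneg_op R \<and> R \<circ> R = T"
    then have RR: "R (R x) = T x" for x by (auto simp: fun_eq_iff)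
    have RS: "R (S x) = S (R x)" for x
      by (rule comm) (use R RR nonneg_op_bounded_clinear bounded_clinear_linear in \<open>metis+\<close>)
    note Sd = bounded_clinear_diff[OF nonneg_op_bounded_clinear[OF S(1)]]
      and Rd = bounded_clinear_diff[OF nonneg_op_bounded_clinear[OF conjunct1[OF R]]]
    have "R x = S x" for x
    proof -
      define y where "y = S x - R x"
      have "S y + R y = 0" by (simp add: y_def Sd Rd S(2) RR RS)
      then have "inner (S y) y + inner (R y) y = 0" by (simp flip: inner_add_left)
      then have "inner (S y) y = 0" "inner (R y) y = 0"
        using nonneg_op_inner[OF S(1), of y] nonneg_op_inner[OF conjunct1[OF R], of y] by linarith+
      then have "S y = 0" "R y = 0" using nonneg_op_inner_eq_0 S(1) R by blast+
      then have "inner y y = 0"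
        by (subst (1) y_def) (simp add: inner_diff_left nonneg_op_selfadjoint[OF S(1)]
            nonneg_op_selfadjoint[OF conjunct1[OF R]])
      then show ?thesis by (simp add: y_def)
    qed
    then show "R = S" by blast
  qed
qed

lemma
  assumes "nonneg_op T"
  shows nonneg_sqrt_op: "nonneg_op (sqrt_op T)"
    and sqrt_op_sqrt_op: "sqrt_op T (sqrt_op T x) = T x"
  using theI'[OF sqrt_op_ex1[OF assms]] by (auto simp: sqrt_op_def fun_eq_iff)

section \<open>Square summable sequences\<close>

text \<open>\<open>Abs_ell2\<close> is meaningful only on square summable sequences; one bound on
  partial sums yields both membership and the norm estimate.\<close>

lemma norm_le_if_partial_sums_le:
  fixes f :: "nat \<Rightarrow> 'a::real_inner"
  assumes "\<And>N. (\<Sum>n<N. (norm (f n))\<^sup>2) \<le> C\<^sup>2" "0 \<le> C"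
  shows "ell2_nth (Abs_ell2 f) = f" and "norm (Abs_ell2 f) \<le> C"
proof -
  have s: "summable (\<lambda>n. (norm (f n))\<^sup>2)"
  proof (rule bounded_imp_summable[where B="C\<^sup>2"])
    show "(\<Sum>k\<le>n. (norm (f k))\<^sup>2) \<le> C\<^sup>2" for n
      using assms(1)[of "Suc n"] by (simp only: lessThan_Suc_atMost)
  qed simp
  then show 1: "ell2_nth (Abs_ell2 f) = f" by (simp add: Abs_ell2_inverse)
  have "(norm (Abs_ell2 f))\<^sup>2 \<le> C\<^sup>2"
    unfolding norm2_ell2 1 by (intro suminf_le_const s assms)
  then show "norm (Abs_ell2 f) \<le> C" using assms(2) by (rule power2_le_imp_le)
qed

lift_definition bwd_shift :: "'a::real_normed_vector ell2 \<Rightarrow> 'a ell2" is "\<lambda>x n. x (Suc n)"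
  by (subst summable_Suc_iff)

lemma inner_embed0: "inner (embed0 v) y = inner v (ell2_nth y 0)"
proof -
  have "inner (embed0 v) y = (\<Sum>n. if n = 0 then inner v (ell2_nth y 0) else 0)"
    unfolding inner_ell2_def embed0.rep_eq by (intro suminf_cong) auto
  also have "\<dots> = inner v (ell2_nth y 0)"
    using sums_unique[OF sums_single[of 0 "\<lambda>n. inner v (ell2_nth y 0)"]] by simp
  finally show ?thesis .
qed

lemma norm_embed0: "norm (embed0 v) = norm v"
  by (simp add: norm_eq_sqrt_inner inner_embed0 embed0.rep_eq)

lemma bounded_clinear_embed0: "bounded_clinear embed0"
  by (rule bounded_clinear_intro[where K=1])
     (auto intro!: ell2_eqI simp: embed0.rep_eq plus_ell2.rep_eq scaleC_ell2.rep_eq norm_embed0)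

lemma cadjoint_embed0: "cadjoint embed0 = (\<lambda>x. ell2_nth x 0)"
  by (rule cadjoint_eqI[OF bounded_clinear_embed0 inner_embed0])

lemma inner_fwd_shift: "inner (fwd_shift x) y = inner x (bwd_shift y)"
  using suminf_split_head[OF summable_inner_ell2[of "fwd_shift x" y]]
  by (simp add: inner_ell2_def fwd_shift.rep_eq bwd_shift.rep_eq)

lemma bwd_fwd_shift: "bwd_shift (fwd_shift x) = x"
  by (rule ell2_eqI) (simp add: bwd_shift.rep_eq fwd_shift.rep_eq)

lemma ell2_nth_fwd_shift_0: "ell2_nth (fwd_shift x) 0 = 0"
  by (simp add: fwd_shift.rep_eq)

lemma norm_fwd_shift: "norm (fwd_shift x) = norm x"
  by (simp add: norm_eq_sqrt_inner inner_fwd_shift bwd_fwd_shift)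

lemma bounded_clinear_fwd_shift: "bounded_clinear fwd_shift"
  by (rule bounded_clinear_intro[where K=1])
     (auto intro!: ell2_eqI simp: fwd_shift.rep_eq plus_ell2.rep_eq scaleC_ell2.rep_eq norm_fwd_shift)

lemma cadjoint_fwd_shift: "cadjoint fwd_shift = bwd_shift"
  by (rule cadjoint_eqI[OF bounded_clinear_fwd_shift inner_fwd_shift])

lemma bounded_clinear_bwd_shift: "bounded_clinear bwd_shift"
  unfolding cadjoint_fwd_shift[symmetric] by (rule bounded_clinear_cadjoint[OF bounded_clinear_fwd_shift])

lemma ell2_decompose: "x = embed0 (ell2_nth x 0) + fwd_shift (bwd_shift x)"
  by (rule ell2_eqI) (auto simp: plus_ell2.rep_eq embed0.rep_eq fwd_shift.rep_eq bwd_shift.rep_eq)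

lemma inner_embed0_fwd_shift: "inner (embed0 v) (fwd_shift x) = 0"
  by (simp add: inner_embed0 ell2_nth_fwd_shift_0)

lemma norm_embed0_fwd_shift_sq: "(norm (embed0 v + fwd_shift x))\<^sup>2 = (norm v)\<^sup>2 + (norm x)\<^sup>2"
  by (simp add: norm_add_sq inner_embed0_fwd_shift norm_embed0 norm_fwd_shift)

lemma norm_ell2_decompose: "(norm x)\<^sup>2 = (norm (ell2_nth x 0))\<^sup>2 + (norm (bwd_shift x))\<^sup>2"
  for x :: "'a::chilbert_space ell2"
  by (subst ell2_decompose[of x]) (rule norm_embed0_fwd_shift_sq)

lemma ell2_nth_bwd_shift_funpow: "ell2_nth ((bwd_shift ^^ n) x) k = ell2_nth x (n + k)"
  by (induction n arbitrary: k) (simp_all add: bwd_shift.rep_eq)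

text \<open>Tails of a convergent series. This is the source of both limit arguments for the central
  solution, in \<open>W_Theta\<close> and \<open>F0_solution\<close>.\<close>

lemma bwd_shift_funpow_tendsto_0: "(\<lambda>n. (bwd_shift ^^ n) x) \<longlonglongrightarrow> 0"
proof -
  have "(\<lambda>n. (norm x)\<^sup>2 - (\<Sum>k<n. (norm (ell2_nth x k))\<^sup>2)) \<longlonglongrightarrow> (norm x)\<^sup>2 - (norm x)\<^sup>2"
    using summable_sums[OF summable_norm2_ell2[of x]]
    by (intro tendsto_intros) (simp add: sums_def norm2_ell2)
  moreover have "(norm ((bwd_shift ^^ n) x))\<^sup>2 = (norm x)\<^sup>2 - (\<Sum>k<n. (norm (ell2_nth x k))\<^sup>2)" for n
    unfolding norm2_ell2 ell2_nth_bwd_shift_funpow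
    using suminf_minus_initial_segment[OF summable_norm2_ell2[of x], of n] by (simp add: add.commute)
  ultimately have "(\<lambda>n. (norm ((bwd_shift ^^ n) x))\<^sup>2) \<longlonglongrightarrow> 0" by simp
  then have "(\<lambda>n. sqrt ((norm ((bwd_shift ^^ n) x))\<^sup>2)) \<longlonglongrightarrow> sqrt 0" by (rule tendsto_real_sqrt)
  then show ?thesis by (simp add: tendsto_norm_zero_iff)
qed

section \<open>Power series with vector coefficients\<close>

lemma powser_unique_complex:
  fixes a b :: "nat \<Rightarrow> complex"
  assumes "\<And>z. norm z < 1 \<Longrightarrow> (\<lambda>n. a n * z ^ n) sums f z"
    and "\<And>z. norm z < 1 \<Longrightarrow> (\<lambda>n. b n * z ^ n) sums f z"
  shows "a = b"
proof -
  define c where "c n = a n - b n" for n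
  have c0: "(\<lambda>n. c n * z ^ n) sums 0" if "norm z < 1" for z
    using sums_diff[OF assms[OF that]] by (simp add: c_def left_diff_distrib)
  have "c n = 0" for n
  proof (induction n rule: less_induct)
    case (less n)
    have "(\<lambda>k. c (k + n) * z ^ k) sums 0" if "norm z < 1" "z \<noteq> 0" for z
    proof -
      have "(\<lambda>k. c (k + n) * z ^ (k + n)) sums 0"
        using c0[OF that(1)] less by (subst sums_zero_iff_shift) auto
      from sums_mult[OF this, of "1 / z ^ n"] show ?thesis using that(2)
        by (simp add: power_add)
    qed
    \<comment> \<open>With the lower coefficients known to be 0, dividing by \<open>z ^ n\<close>
      leaves a series that vanishes off the origin; continuity at 0 isolates
      \<open>c n\<close>.\<close>
    then have "((\<lambda>_. 0) \<longlongrightarrow> (\<lambda>k. c (k + n)) 0) (at (0::complex))"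
      by (intro powser_limit_0_strong[where s=1]) auto
    then have "(\<lambda>k. c (k + n)) 0 = 0" by (rule LIM_const_eq[symmetric])
    then show ?case by simp
  qed
  then show ?thesis by (auto simp: c_def fun_eq_iff)
qed

lemma powser_unique:
  fixes a b :: "nat \<Rightarrow> 'y::chilbert_space"
  assumes "\<And>\<zeta>. norm \<zeta> < 1 \<Longrightarrow> (\<lambda>n. \<zeta> ^ n *\<^sub>C a n) sums f \<zeta>"
    and "\<And>\<zeta>. norm \<zeta> < 1 \<Longrightarrow> (\<lambda>n. \<zeta> ^ n *\<^sub>C b n) sums f \<zeta>"
  shows "a = b"
proof
  fix n
  show "a n = b n"
  proof (rule cinner_eqI)
    fix y
    have "(\<lambda>n. cinner (a n) y) = (\<lambda>n. cinner (b n) y)"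
    proof (rule powser_unique_complex)
      fix \<zeta> :: complex assume "norm \<zeta> < 1"
      from bounded_linear.sums[OF bounded_linear_cinner_left assms(1)[OF this], of y]
        bounded_linear.sums[OF bounded_linear_cinner_left assms(2)[OF this], of y]
      show "(\<lambda>n. cinner (a n) y * \<zeta> ^ n) sums cinner (f \<zeta>) y"
        "(\<lambda>n. cinner (b n) y * \<zeta> ^ n) sums cinner (f \<zeta>) y"
        by (simp_all add: cinner_scaleC_left mult.commute)
    qed
    then show "cinner (a n) y = cinner (b n) y" by meson
  qed
qed

lemma summable_norm_powser:
  assumes "\<And>n. norm (a n) \<le> C" "norm (\<zeta>::complex) < 1"
  shows "summable (\<lambda>n. norm (\<zeta> ^ n *\<^sub>C a n))"
proof (rule summable_comparison_test')
  show "summable (\<lambda>n. norm \<zeta> ^ n * C)"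
    using assms(2) by (intro summable_mult2 summable_geometric) simp
  show "norm (norm (\<zeta> ^ n *\<^sub>C a n)) \<le> norm \<zeta> ^ n * C" if "n \<ge> 0" for n
    using assms(1) by (simp add: norm_scaleC norm_power mult_left_mono)
qed

text \<open>The scalar Taylor coefficients are antilinear in the test vector, so Riesz' theorem turns
  them into vectors.\<close>

lemma weakly_holomorphic_powser:
  fixes g :: "complex \<Rightarrow> 'y::chilbert_space"
  assumes hol: "\<And>y. (\<lambda>\<zeta>. cinner (g \<zeta>) y) holomorphic_on ball 0 1"
    and bd: "\<And>\<zeta>. norm \<zeta> < 1 \<Longrightarrow> norm (g \<zeta>) \<le> C"
  obtains a where "\<And>n. norm (a n) \<le> C" "\<And>\<zeta>. norm \<zeta> < 1 \<Longrightarrow> (\<lambda>n. \<zeta> ^ n *\<^sub>C a n) sums g \<zeta>"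
proof -
  define \<alpha> where "\<alpha> n y = (deriv ^^ n) (\<lambda>\<zeta>. cinner (g \<zeta>) y) 0 / fact n" for n y
  have sums: "(\<lambda>n. \<alpha> n y * \<zeta> ^ n) sums cinner (g \<zeta>) y" if "norm \<zeta> < 1" for y \<zeta>
    using holomorphic_power_series[OF hol[of y], of \<zeta>] that by (simp add: \<alpha>_def)
  \<comment> \<open>Cauchy's inequality on the circle of radius r costs a factor r^(-n), which
    disappears as r tends to 1, so the constant stays exactly \<open>C\<close>.\<close>
  have "norm (\<alpha> n y) \<le> C * norm y" for n y
  proof (rule tendsto_lowerbound)
    have "((\<lambda>r. C * norm y / r ^ n) \<longlongrightarrow> C * norm y / 1 ^ n) (at_left 1)"
      by (intro tendsto_intros) auto
    then show "((\<lambda>r. C * norm y / r ^ n) \<longlongrightarrow> C * norm y) (at_left 1)" by simp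
    have "norm (\<alpha> n y) \<le> C * norm y / r ^ n" if r: "0 < r" "r < 1" for r
    proof -
      have "norm ((deriv ^^ n) (\<lambda>\<zeta>. cinner (g \<zeta>) y) 0) \<le> fact n * (C * norm y) / r ^ n"
      proof (rule Cauchy_inequality)
        show "(\<lambda>\<zeta>. cinner (g \<zeta>) y) holomorphic_on ball 0 r"
          using r by (intro holomorphic_on_subset[OF hol]) auto
        show "continuous_on (cball 0 r) (\<lambda>\<zeta>. cinner (g \<zeta>) y)"
          using r by (intro holomorphic_on_imp_continuous_on holomorphic_on_subset[OF hol]) auto
        fix x :: complex assume "norm (0 - x) = r"
        then have "norm (g x) \<le> C" using bd r by simp
        then show "norm (cinner (g x) y) \<le> C * norm y"
          using norm_cinner_le[of "g x" y] by (meson mult_right_mono norm_ge_zero order_trans)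
      qed (use r in auto)
      then show ?thesis by (simp add: \<alpha>_def norm_divide field_simps)
    qed
    then show "\<forall>\<^sub>F r in at_left 1. norm (\<alpha> n y) \<le> C * norm y / r ^ n"
      by (intro eventually_at_leftI[of 0]) auto
  qed simp
  note \<alpha>_le = this
  have add: "(\<lambda>n. \<alpha> n (y + z)) = (\<lambda>n. \<alpha> n y + \<alpha> n z)" for y z
    by (rule powser_unique_complex[OF sums])
       (use sums_add[OF sums[of _ y] sums[of _ z]] in \<open>simp_all add: distrib_right cinner_add_right\<close>)
  have scl: "(\<lambda>n. \<alpha> n (c *\<^sub>C y)) = (\<lambda>n. cnj c * \<alpha> n y)" for c y
    by (rule powser_unique_complex[OF sums])
       (use sums_mult[OF sums[of _ y], of _ "cnj c"] in \<open>simp_all add: mult.assoc cinner_scaleC_right\<close>)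
  \<comment> \<open>The real part is real-linear in \<open>y\<close> and representable by Riesz;
    antilinearity recovers the imaginary part from the test vector
    \<open>\<i> *\<^sub>C y\<close>.\<close>
  have "\<exists>a. \<forall>y. \<alpha> n y = cinner a y" for n
  proof -
    have "bounded_linear (\<lambda>y. Re (\<alpha> n y))"
    proof (rule bounded_linear_intro[where K=C])
      show "Re (\<alpha> n (y + z)) = Re (\<alpha> n y) + Re (\<alpha> n z)" for y z
        using fun_cong[OF add, of n y z] by simp
      show "Re (\<alpha> n (r *\<^sub>R y)) = r *\<^sub>R Re (\<alpha> n y)" for r y
        using fun_cong[OF scl, of n "complex_of_real r" y] by (simp add: scaleC_of_real)
      show "norm (Re (\<alpha> n y)) \<le> norm y * C" for y
        using \<alpha>_le[of n y] abs_Re_le_cmod[of "\<alpha> n y"] by (simp add: mult.commute)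
    qed
    from riesz_representation[OF this] obtain a where a: "\<And>y. Re (\<alpha> n y) = inner y a" by metis
    have "Im (\<alpha> n y) = inner a (\<i> *\<^sub>C y)" for y
      using fun_cong[OF scl, of n "\<i>" y] a[of "\<i> *\<^sub>C y"] by (simp add: inner_commute)
    then have "\<alpha> n y = cinner a y" for y
      by (simp add: cinner_eq_Complex complex_eq_iff a inner_ii_left) (rule inner_commute)
    then show ?thesis by blast
  qed
  then obtain a where a: "\<And>n y. \<alpha> n y = cinner (a n) y" by metis
  have na: "norm (a n) \<le> C" for n
  proof -
    have "norm (a n) * norm (a n) \<le> C * norm (a n)"
      using \<alpha>_le[of n "a n"] by (simp add: a cinner_self power2_eq_square norm_mult)
    moreover have "0 \<le> C" using order_trans[OF norm_ge_zero bd[of 0]] by simp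
    ultimately show ?thesis by (cases "a n = 0") auto
  qed
  show ?thesis
  proof (rule that[OF na])
    fix \<zeta> :: complex assume \<zeta>: "norm \<zeta> < 1"
    have 1: "(\<lambda>n. \<zeta> ^ n *\<^sub>C a n) sums (\<Sum>n. \<zeta> ^ n *\<^sub>C a n)"
      by (rule summable_sums[OF summable_norm_cancel[OF summable_norm_powser[OF na \<zeta>]]])
    have "(\<Sum>n. \<zeta> ^ n *\<^sub>C a n) = g \<zeta>"
    proof (rule cinner_eqI)
      fix y
      have "(\<lambda>n. \<alpha> n y * \<zeta> ^ n) sums cinner (\<Sum>n. \<zeta> ^ n *\<^sub>C a n) y"
        using bounded_linear.sums[OF bounded_linear_cinner_left 1, of y]
        by (simp add: cinner_scaleC_left a mult.commute)
      then show "cinner (\<Sum>n. \<zeta> ^ n *\<^sub>C a n) y = cinner (g \<zeta>) y"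
        using sums[OF \<zeta>, of y] sums_unique2 by blast
    qed
    with 1 show "(\<lambda>n. \<zeta> ^ n *\<^sub>C a n) sums g \<zeta>" by simp
  qed
qed

section \<open>Parseval's identity over roots of unity\<close>

text \<open>Orthogonality of the characters of the cyclic group of order N: the powers of an N-th
  root of unity other than 1 sum to 0.\<close>

lemma finite_parseval:
  fixes e :: "nat \<Rightarrow> 'a::chilbert_space"
  assumes N: "N > 0"
  defines "z \<equiv> exp (2 * of_real pi * \<i> / of_nat N)"
  shows "(\<Sum>j<N. (norm (\<Sum>s<N. (z ^ j) ^ s *\<^sub>C e s))\<^sup>2) = N * (\<Sum>s<N. (norm (e s))\<^sup>2)"
proof -
  have zs: "z ^ s = exp (2 * of_real pi * \<i> * of_nat s / of_nat N)" for s
    unfolding z_def exp_of_nat_mult[symmetric] by (simp add: field_simps)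
  have nz: "norm (z ^ s) = 1" for s by (simp add: zs)
  have cz: "cnj (z ^ s) = inverse (z ^ s)" for s
    using nz[of s] by (metis complex_norm_square inverse_unique of_real_1 one_power2)
  have orth: "(\<Sum>j<N. (z ^ s * cnj (z ^ t)) ^ j) = (if s = t then of_nat N else 0)"
    if "s < N" "t < N" for s t
  proof (cases "s = t")
    case True
    have "z ^ t * cnj (z ^ t) = 1" using complex_norm_square[of "z ^ t"] nz[of t] by simp
    then show ?thesis unfolding True by (simp only: power_one) simp
  next
    case False
    define w where "w = z ^ s * cnj (z ^ t)"
    have "z ^ s \<noteq> z ^ t" unfolding zs using that False N
      by (subst complex_root_unity_eq) auto
    then have "w \<noteq> 1" unfolding w_def cz using nz[of t] by (auto simp: field_simps)
    moreover have "w ^ N = 1"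
    proof -
      have "(z ^ s) ^ N = 1" for s unfolding zs using N by (intro complex_root_unity) auto
      then show ?thesis by (simp only: w_def power_mult_distrib flip: complex_cnj_power) simp
    qed
    ultimately show ?thesis using False sum_gp_strict[of w N] by (simp add: w_def)
  qed
  have "complex_of_real (\<Sum>j<N. (norm (\<Sum>s<N. (z ^ j) ^ s *\<^sub>C e s))\<^sup>2)
      = (\<Sum>j<N. cinner (\<Sum>s<N. (z ^ j) ^ s *\<^sub>C e s) (\<Sum>s<N. (z ^ j) ^ s *\<^sub>C e s))"
    by (simp only: cinner_self of_real_sum)
  also have "\<dots> = (\<Sum>j<N. \<Sum>s<N. \<Sum>t<N. (z ^ s * cnj (z ^ t)) ^ j * cinner (e s) (e t))"
  proof (intro sum.cong refl)
    fix j
    have "cinner (\<Sum>s<N. (z ^ j) ^ s *\<^sub>C e s) (\<Sum>s<N. (z ^ j) ^ s *\<^sub>C e s)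
        = (\<Sum>s<N. \<Sum>t<N. cinner ((z ^ j) ^ s *\<^sub>C e s) ((z ^ j) ^ t *\<^sub>C e t))"
      by (subst cinner_sum_left) (simp only: cinner_sum_right)
    also have "\<dots> = (\<Sum>s<N. \<Sum>t<N. (z ^ s * cnj (z ^ t)) ^ j * cinner (e s) (e t))"
      by (simp add: cinner_scaleC_left cinner_scaleC_right power_mult_distrib ac_simps flip: power_mult)
    finally show "cinner (\<Sum>s<N. (z ^ j) ^ s *\<^sub>C e s) (\<Sum>s<N. (z ^ j) ^ s *\<^sub>C e s)
        = (\<Sum>s<N. \<Sum>t<N. (z ^ s * cnj (z ^ t)) ^ j * cinner (e s) (e t))" .
  qed
  also have "\<dots> = (\<Sum>s<N. \<Sum>t<N. \<Sum>j<N. (z ^ s * cnj (z ^ t)) ^ j * cinner (e s) (e t))"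
    by (subst sum.swap) (intro sum.cong refl sum.swap)
  also have "\<dots> = (\<Sum>s<N. \<Sum>t<N. (if s = t then of_nat N else 0) * cinner (e s) (e t))"
    by (intro sum.cong refl) (simp only: orth lessThan_iff flip: sum_distrib_right)
  also have "\<dots> = (\<Sum>s<N. of_nat N * cinner (e s) (e s))"
    by (intro sum.cong refl) (simp add: if_distrib[of "\<lambda>x. x * _"] sum.delta' cong: if_cong)
  also have "\<dots> = complex_of_real (N * (\<Sum>s<N. (norm (e s))\<^sup>2))"
    by (simp add: cinner_self sum_distrib_left)
  finally show ?thesis by (simp only: of_real_eq_iff)
qed

text \<open>Averages over the circle of radius \<open>r < 1\<close> are replaced by averages over \<open>N\<close> equidistant points.
  These only see the coefficients summed over the residue classes modulo \<open>N\<close>, an error that vanishes as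
  \<open>N\<close> tends to infinity; then \<open>r\<close> tends to \<open>1\<close>.\<close>

lemma coeff_sum_le_if_powser_le:
  fixes b :: "nat \<Rightarrow> 'y::chilbert_space" and x :: "nat \<Rightarrow> 'u::chilbert_space"
  assumes sums: "\<And>\<zeta>. norm \<zeta> < 1 \<Longrightarrow> (\<lambda>n. \<zeta> ^ n *\<^sub>C b n) sums f \<zeta>"
    and b: "\<And>n. norm (b n) \<le> C"
    and le: "\<And>\<zeta>. norm \<zeta> < 1 \<Longrightarrow> norm (f \<zeta>) \<le> norm (\<Sum>k<M. \<zeta> ^ k *\<^sub>C x k)"
  shows "(\<Sum>n<M. (norm (b n))\<^sup>2) \<le> (\<Sum>k<M. (norm (x k))\<^sup>2)"
proof -
  define R where "R = (\<Sum>k<M. (norm (x k))\<^sup>2)"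
  have C0: "0 \<le> C" using order_trans[OF norm_ge_zero b[of 0]] by simp
  have rad: "(\<Sum>n<M. (norm (r ^ n *\<^sub>R b n))\<^sup>2) \<le> R" if r: "0 < r" "r < 1" for r :: real
  proof (rule tendsto_upperbound)
    \<comment> \<open>\<open>e N s\<close> folds all damped coefficients with index congruent to
      \<open>s\<close> modulo \<open>N\<close> into one; it tends to the coefficient at
      \<open>s\<close> itself as \<open>N\<close> grows.\<close>
    define e where "e N s = (\<Sum>m. r ^ (m * N + s) *\<^sub>R b (m * N + s))" for N s
    have summ: "summable (\<lambda>n. r ^ n * C)" using r by (intro summable_mult2 summable_geometric) simp
    have esummable: "summable (\<lambda>m. norm (r ^ (m * N + s) *\<^sub>R b (m * N + s)))" if "N > 0" for N s
    proof (rule summable_comparison_test')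
      show "summable (\<lambda>m. r ^ m * C)" by (rule summ)
      fix m :: nat assume "m \<ge> 0"
      have "m \<le> m * N + s" using that by (cases N) auto
      then have "r ^ (m * N + s) \<le> r ^ m" using r by (intro power_decreasing) auto
      then have "r ^ (m * N + s) * norm (b (m * N + s)) \<le> r ^ m * C"
        by (rule mult_mono[OF _ b]) (use r in simp_all)
      then show "norm (norm (r ^ (m * N + s) *\<^sub>R b (m * N + s))) \<le> r ^ m * C"
        using r by simp
    qed
    have etend: "(\<lambda>N. e N s) \<longlonglongrightarrow> r ^ s *\<^sub>R b s" for s
    proof (rule Lim_transform)
      show "(\<lambda>N. r ^ s *\<^sub>R b s) \<longlonglongrightarrow> r ^ s *\<^sub>R b s" by simp
      show "(\<lambda>N. e N s - r ^ s *\<^sub>R b s) \<longlonglongrightarrow> 0"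
      proof (rule Lim_null_comparison)
        show "\<forall>\<^sub>F N in sequentially. norm (e N s - r ^ s *\<^sub>R b s) \<le> r ^ N * (\<Sum>m. r ^ m * C)"
          using eventually_gt_at_top[of 0]
        proof eventually_elim
          case (elim N)
          let ?g = "\<lambda>m. r ^ (m * N + s) *\<^sub>R b (m * N + s)"
          have "e N s - r ^ s *\<^sub>R b s = (\<Sum>m. ?g (Suc m))"
            using suminf_split_head[OF summable_norm_cancel[OF esummable[OF elim, of s]]] by (simp add: e_def)
          also have "norm \<dots> \<le> (\<Sum>m. norm (?g (Suc m)))"
            by (rule summable_norm) (use esummable[OF elim, of s] in \<open>subst summable_Suc_iff\<close>)
          also have "\<dots> \<le> (\<Sum>m. r ^ N * (r ^ m * C))"
          proof (rule suminf_le)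
            fix m
            have "N + m \<le> Suc m * N + s" using elim by (cases N) auto
            then have "r ^ (Suc m * N + s) \<le> r ^ (N + m)" using r by (intro power_decreasing) auto
            then have "r ^ (Suc m * N + s) * norm (b (Suc m * N + s)) \<le> r ^ (N + m) * C"
              by (rule mult_mono[OF _ b]) (use r in simp_all)
            then have "norm (?g (Suc m)) \<le> r ^ (N + m) * C" using r by (simp del: mult_Suc)
            then show "norm (?g (Suc m)) \<le> r ^ N * (r ^ m * C)" by (simp add: power_add mult.assoc)
          next
            show "summable (\<lambda>m. norm (?g (Suc m)))"
              using esummable[OF elim, of s] by (subst summable_Suc_iff)
          qed (intro summable_mult summ)
          also have "\<dots> = r ^ N * (\<Sum>m. r ^ m * C)" by (rule suminf_mult[OF summ])
          finally show ?case .
        qed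
        show "(\<lambda>N. r ^ N * (\<Sum>m. r ^ m * C)) \<longlonglongrightarrow> 0"
          using r by (intro tendsto_mult_left_zero LIMSEQ_realpow_zero) auto
      qed
    qed
    show "(\<lambda>N. \<Sum>s<M. (norm (e N s))\<^sup>2) \<longlonglongrightarrow> (\<Sum>s<M. (norm (r ^ s *\<^sub>R b s))\<^sup>2)"
      by (intro tendsto_intros etend)
    show "\<forall>\<^sub>F N in sequentially. (\<Sum>s<M. (norm (e N s))\<^sup>2) \<le> R"
      using eventually_gt_at_top[of M]
    proof eventually_elim
      case (elim N)
      then have N: "N > 0" by simp
      define z where "z = exp (2 * of_real pi * \<i> / of_nat N)"
      have nz: "norm (z ^ j) = 1" for j unfolding z_def norm_power by simp
      \<comment> \<open>Since N > M, the polynomial has at most one coefficient per residue class: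
        folding does not change it, and \<open>x'\<close> only damps and pads with zeros.\<close>
      define x' where "x' s = (if s < M then r ^ s *\<^sub>R x s else 0)" for s
      have feq: "f (of_real r * z ^ j) = (\<Sum>s<N. (z ^ j) ^ s *\<^sub>C e N s)" for j
      proof (rule sums_unique2)
        have zN: "z ^ N = 1" unfolding z_def using complex_root_unity[of N 1] N by simp
        let ?h = "\<lambda>n. (of_real r * z ^ j) ^ n *\<^sub>C b n"
        have "?h sums f (of_real r * z ^ j)"
          using r nz[of j] by (intro sums) (simp add: norm_mult)
        from sums_group[OF this N]
        show "(\<lambda>m. \<Sum>s<N. (z ^ j) ^ s *\<^sub>C (r ^ (m * N + s) *\<^sub>R b (m * N + s))) sums f (of_real r * z ^ j)"
        proof (rule sums_cong[THEN iffD1, rotated])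
          fix m
          have "(z ^ j) ^ (m * N + s) = (z ^ j) ^ s" for s
          proof -
            have "(z ^ j) ^ (m * N + s) = (z ^ N) ^ (m * j) * (z ^ j) ^ s"
              by (simp add: power_add ac_simps flip: power_mult)
            then show ?thesis by (simp add: zN)
          qed
          then have "?h (m * N + s) = (z ^ j) ^ s *\<^sub>C (r ^ (m * N + s) *\<^sub>R b (m * N + s))" for s
            by (simp add: power_mult_distrib scaleC_scaleC mult.commute flip: scaleC_of_real)
          then show "sum ?h {m * N..<m * N + N}
              = (\<Sum>s<N. (z ^ j) ^ s *\<^sub>C (r ^ (m * N + s) *\<^sub>R b (m * N + s)))"
            using sum.shift_bounds_nat_ivl[of ?h 0 "m * N" N]
            by (simp add: add.commute atLeast0LessThan)
        qed
        show "(\<lambda>m. \<Sum>s<N. (z ^ j) ^ s *\<^sub>C (r ^ (m * N + s) *\<^sub>R b (m * N + s)))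
            sums (\<Sum>s<N. (z ^ j) ^ s *\<^sub>C e N s)"
          unfolding e_def
          by (intro sums_sum bounded_linear.sums[OF bounded_linear_scaleC] summable_sums
              summable_norm_cancel[OF esummable[OF N]])
      qed
      have peq: "(\<Sum>k<M. (of_real r * z ^ j) ^ k *\<^sub>C x k) = (\<Sum>s<N. (z ^ j) ^ s *\<^sub>C x' s)" for j
      proof (rule sum.mono_neutral_cong_left)
        show "(of_real r * z ^ j) ^ k *\<^sub>C x k = (z ^ j) ^ k *\<^sub>C x' k" if "k \<in> {..<M}" for k
          using that by (simp add: x'_def power_mult_distrib scaleC_scaleC mult.commute flip: scaleC_of_real)
      qed (use elim in \<open>auto simp: x'_def\<close>)
      have "N * (\<Sum>s<N. (norm (e N s))\<^sup>2) = (\<Sum>j<N. (norm (f (of_real r * z ^ j)))\<^sup>2)"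
        unfolding feq by (rule finite_parseval[OF N, folded z_def, symmetric])
      also have "\<dots> \<le> (\<Sum>j<N. (norm (\<Sum>s<N. (z ^ j) ^ s *\<^sub>C x' s))\<^sup>2)"
        unfolding peq[symmetric] using r nz
        by (intro sum_mono power_mono le) (auto simp: norm_mult)
      also have "\<dots> = N * (\<Sum>s<N. (norm (x' s))\<^sup>2)"
        unfolding z_def by (rule finite_parseval[OF N])
      finally have "(\<Sum>s<N. (norm (e N s))\<^sup>2) \<le> (\<Sum>s<N. (norm (x' s))\<^sup>2)" using N by simp
      moreover have "(\<Sum>s<M. (norm (e N s))\<^sup>2) \<le> (\<Sum>s<N. (norm (e N s))\<^sup>2)"
        using elim by (intro sum_mono2) auto
      moreover have "(\<Sum>s<N. (norm (x' s))\<^sup>2) = (\<Sum>s<M. (norm (x' s))\<^sup>2)"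
        using elim by (intro sum.mono_neutral_right) (auto simp: x'_def)
      moreover have "\<dots> \<le> R" unfolding R_def
      proof (rule sum_mono)
        fix s assume "s \<in> {..<M}"
        then have "norm (x' s) \<le> 1 * norm (x s)" using r
          by (simp add: x'_def) (intro mult_left_le_one_le, auto simp: power_le_one)
        then show "(norm (x' s))\<^sup>2 \<le> (norm (x s))\<^sup>2" by (intro power_mono) auto
      qed
      ultimately show ?case by linarith
    qed
  qed simp
  have "(\<Sum>n<M. (norm (b n))\<^sup>2) \<le> R"
  proof (rule tendsto_upperbound)
    have "((\<lambda>r. \<Sum>n<M. (norm (r ^ n *\<^sub>R b n))\<^sup>2) \<longlongrightarrow> (\<Sum>n<M. (norm (1 ^ n *\<^sub>R b n))\<^sup>2)) (at_left 1)"
      by (intro tendsto_intros)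
    then show "((\<lambda>r. \<Sum>n<M. (norm (r ^ n *\<^sub>R b n))\<^sup>2) \<longlongrightarrow> (\<Sum>n<M. (norm (b n))\<^sup>2)) (at_left 1)"
      by simp
    show "\<forall>\<^sub>F r in at_left 1. (\<Sum>n<M. (norm (r ^ n *\<^sub>R b n))\<^sup>2) \<le> R"
      by (rule eventually_at_leftI[of 0]) (use rad greaterThanLessThan_iff in blast, simp)
  qed simp
  then show ?thesis by (simp add: R_def)
qed

section \<open>The Schur class and its Toeplitz operators\<close>

text \<open>Passes from operator-norm differentiability to scalar functions, where Cauchy's theory
  is available.\<close>

lemma op_analytic_imp_weakly_holomorphic:
  assumes cl: "\<And>\<zeta>. \<zeta> \<in> ball 0 1 \<Longrightarrow> bounded_clinear (F \<zeta>)"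
    and an: "op_analytic_on_disc F"
  shows "(\<lambda>\<zeta>. cinner (F \<zeta> u) y) holomorphic_on ball 0 1"
proof (rule holomorphic_onI)
  fix \<zeta> :: complex assume \<zeta>: "\<zeta> \<in> ball 0 1"
  then obtain D where D: "bounded_clinear D"
    and lim: "((\<lambda>\<xi>. onorm (\<lambda>u. inverse (\<xi> - \<zeta>) *\<^sub>C (F \<xi> u - F \<zeta> u) - D u)) \<longlongrightarrow> 0) (at \<zeta>)"
    using an unfolding op_analytic_on_disc_def by blast
  let ?q = "\<lambda>\<xi> u. inverse (\<xi> - \<zeta>) *\<^sub>C (F \<xi> u - F \<zeta> u) - D u"
  have "((\<lambda>\<xi>. (cinner (F \<xi> u) y - cinner (F \<zeta> u) y) / (\<xi> - \<zeta>) - cinner (D u) y) \<longlongrightarrow> 0) (at \<zeta>)"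
  proof (rule Lim_null_comparison)
    have "\<forall>\<^sub>F \<xi> in at \<zeta>. \<xi> \<in> ball 0 1"
      using \<zeta> by (intro eventually_at_in_open') auto
    then show "\<forall>\<^sub>F \<xi> in at \<zeta>. norm ((cinner (F \<xi> u) y - cinner (F \<zeta> u) y) / (\<xi> - \<zeta>) - cinner (D u) y)
        \<le> onorm (?q \<xi>) * norm u * norm y"
    proof eventually_elim
      case (elim \<xi>)
      have "bounded_clinear (?q \<xi>)"
        by (intro bounded_clinear_minus bounded_clinear_scale cl D elim \<zeta>)
      then have "norm (?q \<xi> u) \<le> onorm (?q \<xi>) * norm u"
        by (rule onorm[OF bounded_clinear_linear])
      then have "norm (cinner (?q \<xi> u) y) \<le> onorm (?q \<xi>) * norm u * norm y"
        using norm_cinner_le[of "?q \<xi> u" y] by (meson mult_right_mono norm_ge_zero order_trans)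
      then show ?case by (simp add: cinner_diff_left cinner_scaleC_left field_simps)
    qed
    show "((\<lambda>\<xi>. onorm (?q \<xi>) * norm u * norm y) \<longlongrightarrow> 0) (at \<zeta>)"
      by (intro tendsto_mult_left_zero lim)
  qed
  then have "((\<lambda>\<xi>. cinner (F \<xi> u) y) has_field_derivative cinner (D u) y) (at \<zeta>)"
    unfolding has_field_derivative_iff by (rule LIM_zero_cancel)
  then show "(\<lambda>\<zeta>. cinner (F \<zeta> u) y) field_differentiable at \<zeta> within ball 0 1"
    by (meson field_differentiable_at_within field_differentiable_def)
qed

lemma taylor_coeff_eqI:
  assumes "\<And>\<zeta> u. norm \<zeta> < 1 \<Longrightarrow> (\<lambda>n. \<zeta> ^ n *\<^sub>C c n u) sums F \<zeta> u"
  shows "taylor_coeff F = c"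
  unfolding taylor_coeff_def
proof (rule the_equality)
  show "\<forall>\<zeta>\<in>ball 0 1. \<forall>u. (\<lambda>n. \<zeta> ^ n *\<^sub>C c n u) sums F \<zeta> u" using assms by simp
next
  fix d assume d: "\<forall>\<zeta>\<in>ball 0 1. \<forall>u. (\<lambda>n. \<zeta> ^ n *\<^sub>C d n u) sums F \<zeta> u"
  have "(\<lambda>n. d n u) = (\<lambda>n. c n u)" for u
    by (rule powser_unique[where f="\<lambda>\<zeta>. F \<zeta> u"]) (use assms d in auto)
  then show "d = c" by (metis ext)
qed

text \<open>The coefficients are found for each \<open>u\<close> separately; their linearity in
  \<open>u\<close> is inherited from \<open>F \<zeta>\<close> by uniqueness of power series.\<close>

lemma schur_class_taylor_exists:
  assumes "F \<in> schur_class"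
  shows "\<exists>c. (\<forall>n. bounded_clinear (c n)) \<and> (\<forall>n u. norm (c n u) \<le> norm u)
    \<and> (\<forall>\<zeta> u. norm \<zeta> < 1 \<longrightarrow> (\<lambda>n. \<zeta> ^ n *\<^sub>C c n u) sums F \<zeta> u)"
proof -
  have cl: "bounded_clinear (F \<zeta>)" if "norm \<zeta> < 1" for \<zeta>
    using assms that by (simp add: schur_class_def)
  have le: "norm (F \<zeta> u) \<le> norm u" if "norm \<zeta> < 1" for \<zeta> u
  proof -
    have "norm (F \<zeta> u) \<le> onorm (F \<zeta>) * norm u"
      by (rule onorm[OF bounded_clinear_linear[OF cl[OF that]]])
    also have "\<dots> \<le> 1 * norm u" using assms that by (intro mult_right_mono) (auto simp: schur_class_def)
    finally show ?thesis by simp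
  qed
  have "\<exists>a. (\<forall>n. norm (a n) \<le> norm u) \<and> (\<forall>\<zeta>. norm \<zeta> < 1 \<longrightarrow> (\<lambda>n. \<zeta> ^ n *\<^sub>C a n) sums F \<zeta> u)" for u
  proof -
    have "(\<lambda>\<zeta>. cinner (F \<zeta> u) y) holomorphic_on ball 0 1" for y
      using assms by (intro op_analytic_imp_weakly_holomorphic) (auto simp: schur_class_def)
    from weakly_holomorphic_powser[OF this le] show ?thesis by metis
  qed
  then obtain a where a: "\<And>u n. norm (a u n) \<le> norm u"
    and s: "\<And>u \<zeta>. norm \<zeta> < 1 \<Longrightarrow> (\<lambda>n. \<zeta> ^ n *\<^sub>C a u n) sums F \<zeta> u" by metis
  have add: "a (u + v) = (\<lambda>n. a u n + a v n)" for u v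
  proof (rule powser_unique[OF s])
    fix \<zeta> :: complex assume z: "norm \<zeta> < 1"
    then show "(\<lambda>n. \<zeta> ^ n *\<^sub>C (a u n + a v n)) sums F \<zeta> (u + v)"
      using sums_add[OF s[OF z, of u] s[OF z, of v]]
      by (simp add: scaleC_add_right bounded_clinear_add[OF cl])
  qed
  have scl: "a (k *\<^sub>C u) = (\<lambda>n. k *\<^sub>C a u n)" for k u
  proof (rule powser_unique[OF s])
    fix \<zeta> :: complex assume z: "norm \<zeta> < 1"
    then show "(\<lambda>n. \<zeta> ^ n *\<^sub>C (k *\<^sub>C a u n)) sums F \<zeta> (k *\<^sub>C u)"
      using bounded_linear.sums[OF bounded_linear_scaleC s[OF z, of u], of k]
      by (simp add: bounded_clinear_scaleC[OF cl] scaleC_scaleC mult.commute)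
  qed
  show ?thesis
  proof (intro exI[of _ "\<lambda>n u. a u n"] conjI allI impI)
    show "bounded_clinear (\<lambda>u. a u n)" for n
      by (rule bounded_clinear_intro[where K=1]) (use a in \<open>simp_all add: add scl\<close>)
  qed (use a s in auto)
qed

lemma
  assumes "F \<in> schur_class"
  shows bounded_clinear_taylor_coeff: "bounded_clinear (taylor_coeff F n)"
    and norm_taylor_coeff_le: "norm (taylor_coeff F n u) \<le> norm u"
    and taylor_coeff_sums: "norm \<zeta> < 1 \<Longrightarrow> (\<lambda>n. \<zeta> ^ n *\<^sub>C taylor_coeff F n u) sums F \<zeta> u"
proof -
  obtain c where c: "\<And>n. bounded_clinear (c n)" "\<And>n u. norm (c n u) \<le> norm u"
    and s: "\<And>\<zeta> u. norm \<zeta> < 1 \<Longrightarrow> (\<lambda>n. \<zeta> ^ n *\<^sub>C c n u) sums F \<zeta> u"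
    using schur_class_taylor_exists[OF assms] by blast
  have "taylor_coeff F = c" by (rule taylor_coeff_eqI[OF s])
  then show "bounded_clinear (taylor_coeff F n)" "norm (taylor_coeff F n u) \<le> norm u"
    "norm \<zeta> < 1 \<Longrightarrow> (\<lambda>n. \<zeta> ^ n *\<^sub>C taylor_coeff F n u) sums F \<zeta> u"
    using c s by auto
qed

lemma taylor_coeff_cong:
  assumes "\<And>\<zeta>. norm \<zeta> < 1 \<Longrightarrow> F \<zeta> = G \<zeta>"
  shows "taylor_coeff F = taylor_coeff G"
  unfolding taylor_coeff_def using assms by (intro arg_cong[where f=The]) (auto simp: fun_eq_iff)

text \<open>The second derivative of the geometric series at \<open>K\<close>, which majorizes the
  errors of the difference quotients of powers.\<close>

lemma summable_diffs2_geometric: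
  fixes K :: real
  assumes "0 \<le> K" "K < 1"
  shows "summable (\<lambda>n. of_nat n * of_nat (n - Suc 0) * K ^ (n - 2))"
proof -
  have "summable (\<lambda>n. diffs (\<lambda>_. 1) n * x ^ n)" if "norm x < 1" for x :: real
    by (rule termdiff_converges[where K=1]) (use that in \<open>auto intro: summable_geometric\<close>)
  then have "summable (\<lambda>n. diffs (diffs (\<lambda>_. 1)) n * K ^ n)"
    using assms by (intro termdiff_converges[where K=1]) auto
  then show ?thesis
    by (subst summable_iff_shift[of _ 2, symmetric]) (simp add: diffs_def ac_simps)
qed

text \<open>The termwise derivative differs from the difference quotient by at most a constant times
  \<open>norm (\<xi> - \<zeta>) * norm u\<close>. Uniformity in \<open>u\<close> upgrades pointwise
  power series to analyticity in operator norm.\<close>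

lemma schur_classI:
  assumes c: "\<And>n. bounded_clinear (c n)" and c_le: "\<And>n u. norm (c n u) \<le> norm u"
    and s: "\<And>\<zeta> u. norm \<zeta> < 1 \<Longrightarrow> (\<lambda>n. \<zeta> ^ n *\<^sub>C c n u) sums F \<zeta> u"
    and F_le: "\<And>\<zeta> u. norm \<zeta> < 1 \<Longrightarrow> norm (F \<zeta> u) \<le> norm u"
  shows "F \<in> schur_class"
proof -
  have cl: "bounded_clinear (F \<zeta>)" if z: "norm \<zeta> < 1" for \<zeta>
  proof (rule bounded_clinear_intro[where K=1])
    fix u v and a :: complex
    show "F \<zeta> (u + v) = F \<zeta> u + F \<zeta> v"
      using sums_add[OF s[OF z, of u] s[OF z, of v]] s[OF z, of "u + v"]
      by (simp add: scaleC_add_right[symmetric] bounded_clinear_add[OF c, symmetric])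
         (metis sums_unique2)
    show "F \<zeta> (a *\<^sub>C u) = a *\<^sub>C F \<zeta> u"
      using bounded_linear.sums[OF bounded_linear_scaleC s[OF z, of u], of a] s[OF z, of "a *\<^sub>C u"]
      by (simp add: bounded_clinear_scaleC[OF c] scaleC_scaleC mult.commute) (metis sums_unique2)
  qed (use F_le[OF z] in simp)
  have "\<exists>D. bounded_clinear D \<and>
    ((\<lambda>\<xi>. onorm (\<lambda>u. inverse (\<xi> - \<zeta>) *\<^sub>C (F \<xi> u - F \<zeta> u) - D u)) \<longlongrightarrow> 0) (at \<zeta>)"
    if z: "norm \<zeta> < 1" for \<zeta>
  proof -
    \<comment> \<open>A radius strictly between \<open>norm \<zeta>\<close> and 1, so that all
      points near \<zeta> stay below it and the majorant still converges.\<close>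
    define K where "K = (1 + norm \<zeta>) / 2"
    have K: "norm \<zeta> < K" "K < 1" "0 \<le> K" using z by (auto simp: K_def)
    define S where "S = (\<Sum>n. of_nat n * of_nat (n - Suc 0) * K ^ (n - 2))"
    note sumK = summable_diffs2_geometric[OF K(3,2)]
    have S0: "0 \<le> S" unfolding S_def using K by (intro suminf_nonneg sumK) auto
    define d where "d n = of_nat n * \<zeta> ^ (n - Suc 0)" for n
    have sd: "summable (\<lambda>n. norm (d n))"
    proof -
      have "summable (\<lambda>n. diffs (\<lambda>_. 1) n * x ^ n)" if "norm x < 1" for x :: real
        by (rule termdiff_converges[where K=1]) (use that in \<open>auto intro: summable_geometric\<close>)
      from this[of "norm \<zeta>"] z show ?thesis
        by (subst summable_Suc_iff[symmetric]) (simp add: d_def diffs_def norm_mult norm_power del: of_nat_Suc)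
    qed
    define D where "D u = (\<Sum>n. d n *\<^sub>C c n u)" for u
    have sD: "summable (\<lambda>n. norm (d n *\<^sub>C c n u))" for u
    proof (rule summable_comparison_test')
      show "summable (\<lambda>n. norm (d n) * norm u)" by (intro summable_mult2 sd)
      show "norm (norm (d n *\<^sub>C c n u)) \<le> norm (d n) * norm u" if "n \<ge> 0" for n
        using c_le by (simp add: norm_scaleC mult_left_mono)
    qed
    have Dsums: "(\<lambda>n. d n *\<^sub>C c n u) sums D u" for u
      unfolding D_def by (rule summable_sums[OF summable_norm_cancel[OF sD]])
    have Dcl: "bounded_clinear D"
    proof (rule bounded_clinear_intro[where K="\<Sum>n. norm (d n)"])
      fix u v and a :: complex
      show "D (u + v) = D u + D v"
        using sums_add[OF Dsums[of u] Dsums[of v]] Dsums[of "u + v"]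
        by (simp add: scaleC_add_right[symmetric] bounded_clinear_add[OF c, symmetric])
           (metis sums_unique2)
      show "D (a *\<^sub>C u) = a *\<^sub>C D u"
        using bounded_linear.sums[OF bounded_linear_scaleC Dsums[of u], of a] Dsums[of "a *\<^sub>C u"]
        by (simp add: bounded_clinear_scaleC[OF c] scaleC_scaleC mult.commute) (metis sums_unique2)
      have "norm (D u) \<le> (\<Sum>n. norm (d n *\<^sub>C c n u))" unfolding D_def by (rule summable_norm[OF sD])
      also have "\<dots> \<le> (\<Sum>n. norm (d n) * norm u)"
        by (intro suminf_le sD summable_mult2 sd) (use c_le in \<open>simp add: norm_scaleC mult_left_mono\<close>)
      also have "\<dots> = (\<Sum>n. norm (d n)) * norm u" by (rule suminf_mult2[OF sd, symmetric])
      finally show "norm (D u) \<le> (\<Sum>n. norm (d n)) * norm u" .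
    qed
    let ?q = "\<lambda>\<xi> u. inverse (\<xi> - \<zeta>) *\<^sub>C (F \<xi> u - F \<zeta> u) - D u"
    have "((\<lambda>\<xi>. onorm (?q \<xi>)) \<longlongrightarrow> 0) (at \<zeta>)"
    proof (rule Lim_null_comparison)
      have "\<forall>\<^sub>F \<xi> in at \<zeta>. \<xi> \<in> ball 0 K - {\<zeta>}"
        using K by (intro eventually_at_in_open) auto
      then show "\<forall>\<^sub>F \<xi> in at \<zeta>. norm (onorm (?q \<xi>)) \<le> S * norm (\<xi> - \<zeta>)"
      proof eventually_elim
        case (elim \<xi>)
        then have \<xi>: "norm \<xi> < K" "norm \<xi> < 1" "\<xi> \<noteq> \<zeta>" using K by auto
        have qcl: "bounded_clinear (?q \<xi>)"
          by (intro bounded_clinear_minus bounded_clinear_scale cl Dcl z \<xi>)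
        have "norm (?q \<xi> u) \<le> S * norm (\<xi> - \<zeta>) * norm u" for u
        proof -
          define t where "t n = (\<xi> ^ n - \<zeta> ^ n) / (\<xi> - \<zeta>) - of_nat n * \<zeta> ^ (n - Suc 0)" for n
          have ts: "(\<lambda>n. t n *\<^sub>C c n u) sums ?q \<xi> u"
            using sums_diff[OF bounded_linear.sums[OF bounded_linear_scaleC
                  sums_diff[OF s[OF \<xi>(2), of u] s[OF z, of u]], of "inverse (\<xi> - \<zeta>)"] Dsums[of u]]
            by (simp add: scaleC_scaleC scaleC_diff_left[symmetric] t_def d_def divide_inverse mult.commute)
          have tle: "norm (t n *\<^sub>C c n u)
              \<le> of_nat n * of_nat (n - Suc 0) * K ^ (n - 2) * (norm (\<xi> - \<zeta>) * norm u)" for n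
          proof -
            have "norm (t n) \<le> of_nat n * of_nat (n - Suc 0) * K ^ (n - 2) * norm (\<xi> - \<zeta>)"
              using lemma_termdiff3[of "\<xi> - \<zeta>" \<zeta> K n] \<xi> K by (simp add: t_def)
            then have "norm (t n) * norm (c n u)
                \<le> of_nat n * of_nat (n - Suc 0) * K ^ (n - 2) * norm (\<xi> - \<zeta>) * norm u"
              by (rule mult_mono[OF _ c_le]) (use K in simp_all)
            then show ?thesis by (simp only: norm_scaleC mult.assoc)
          qed
          have sK: "summable (\<lambda>n. of_nat n * of_nat (n - Suc 0) * K ^ (n - 2) * (norm (\<xi> - \<zeta>) * norm u))"
            by (intro summable_mult2 sumK)
          have st: "summable (\<lambda>n. norm (t n *\<^sub>C c n u))"
            by (rule summable_comparison_test'[OF sK]) (use tle in auto)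
          have "norm (?q \<xi> u) \<le> (\<Sum>n. norm (t n *\<^sub>C c n u))"
            using summable_norm[OF st] sums_unique[OF ts] by simp
          also have "\<dots> \<le> (\<Sum>n. of_nat n * of_nat (n - Suc 0) * K ^ (n - 2) * (norm (\<xi> - \<zeta>) * norm u))"
            by (intro suminf_le tle st sK)
          also have "\<dots> = S * (norm (\<xi> - \<zeta>) * norm u)"
            unfolding S_def by (rule suminf_mult2[OF sumK, symmetric])
          finally show ?thesis by (simp add: mult.assoc)
        qed
        then have "onorm (?q \<xi>) \<le> S * norm (\<xi> - \<zeta>)" using S0 by (intro onorm_bound) auto
        then show ?case using onorm_pos_le[OF bounded_clinear_linear[OF qcl]] by simp
      qed
      show "((\<lambda>\<xi>. S * norm (\<xi> - \<zeta>)) \<longlongrightarrow> 0) (at \<zeta>)"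
        by (intro tendsto_mult_right_zero tendsto_norm_zero LIM_zero tendsto_ident_at)
    qed
    with Dcl show ?thesis by blast
  qed
  then have "op_analytic_on_disc F" by (simp add: op_analytic_on_disc_def)
  moreover have "onorm (F \<zeta>) \<le> 1" if "norm \<zeta> < 1" for \<zeta>
    using F_le[OF that] by (intro onorm_bound) auto
  ultimately show ?thesis using cl by (simp add: schur_class_def)
qed

text \<open>Contractivity without boundary values: \<open>F\<close> sends the polynomial with
  coefficients \<open>x\<close> to a pointwise smaller function, and
  \<open>coeff_sum_le_if_powser_le\<close> compares coefficients. Cutting the input at
  \<open>M\<close> leaves the outputs before \<open>M\<close> unchanged, the matrix being lower
  triangular.\<close>

lemma toeplitz_sum_le:
  assumes F: "F \<in> schur_class"
  shows "(\<Sum>n<M. (norm (\<Sum>k\<le>n. taylor_coeff F (n - k) (x k)))\<^sup>2) \<le> (\<Sum>k<M. (norm (x k))\<^sup>2)"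
proof -
  let ?c = "taylor_coeff F"
  define b where "b n = (\<Sum>k<M. if n < k then 0 else ?c (n - k) (x k))" for n
  have "(\<Sum>n<M. (norm (b n))\<^sup>2) \<le> (\<Sum>k<M. (norm (x k))\<^sup>2)"
  proof (rule coeff_sum_le_if_powser_le)
    fix \<zeta> :: complex assume z: "norm \<zeta> < 1"
    then have cl: "bounded_clinear (F \<zeta>)" using F by (simp add: schur_class_def)
    define p where "p = (\<Sum>k<M. \<zeta> ^ k *\<^sub>C x k)"
    have "(\<lambda>n. if n < k then 0 else \<zeta> ^ n *\<^sub>C ?c (n - k) (x k)) sums (\<zeta> ^ k *\<^sub>C F \<zeta> (x k))" for k
    proof -
      have "(\<lambda>n. \<zeta> ^ k *\<^sub>C \<zeta> ^ n *\<^sub>C ?c n (x k)) sums (\<zeta> ^ k *\<^sub>C F \<zeta> (x k))"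
        by (rule bounded_linear.sums[OF bounded_linear_scaleC taylor_coeff_sums[OF F z]])
      then have "(\<lambda>n. (\<lambda>n. if n < k then 0 else \<zeta> ^ n *\<^sub>C ?c (n - k) (x k)) (n + k))
          sums (\<zeta> ^ k *\<^sub>C F \<zeta> (x k))"
        by (simp add: scaleC_scaleC power_add mult.commute)
      then show ?thesis by (subst (asm) sums_zero_iff_shift) auto
    qed
    then have "(\<lambda>n. \<Sum>k<M. if n < k then 0 else \<zeta> ^ n *\<^sub>C ?c (n - k) (x k))
        sums (\<Sum>k<M. \<zeta> ^ k *\<^sub>C F \<zeta> (x k))" by (intro sums_sum)
    moreover have "(\<Sum>k<M. \<zeta> ^ k *\<^sub>C F \<zeta> (x k)) = F \<zeta> p"
      unfolding p_def linear_sum[OF bounded_linear.linear[OF bounded_clinear_linear[OF cl]]]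
      by (simp add: bounded_clinear_scaleC[OF cl])
    moreover have "(\<Sum>k<M. if n < k then 0 else \<zeta> ^ n *\<^sub>C ?c (n - k) (x k)) = \<zeta> ^ n *\<^sub>C b n" for n
      unfolding b_def linear_sum[OF bounded_linear.linear[OF bounded_linear_scaleC]]
      by (intro sum.cong) auto
    ultimately show "(\<lambda>n. \<zeta> ^ n *\<^sub>C b n) sums F \<zeta> (\<Sum>k<M. \<zeta> ^ k *\<^sub>C x k)" by (simp add: p_def)
    have "norm (F \<zeta> p) \<le> onorm (F \<zeta>) * norm p" by (rule onorm[OF bounded_clinear_linear[OF cl]])
    also have "\<dots> \<le> 1 * norm p" using F z by (intro mult_right_mono) (auto simp: schur_class_def)
    finally show "norm (F \<zeta> (\<Sum>k<M. \<zeta> ^ k *\<^sub>C x k)) \<le> norm (\<Sum>k<M. \<zeta> ^ k *\<^sub>C x k)"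
      by (simp add: p_def)
  next
    fix n
    show "norm (b n) \<le> (\<Sum>k<M. norm (x k))"
      unfolding b_def by (rule sum_norm_le) (auto simp: norm_taylor_coeff_le[OF F])
  qed
  moreover have "b n = (\<Sum>k\<le>n. ?c (n - k) (x k))" if "n < M" for n
    unfolding b_def using that by (intro sum.mono_neutral_cong_right) auto
  ultimately show ?thesis by simp
qed

lemma
  assumes F: "F \<in> schur_class"
  shows ell2_nth_toeplitz_op:
      "ell2_nth (toeplitz_op F x) n = (\<Sum>k\<le>n. taylor_coeff F (n - k) (ell2_nth x k))"
    and norm_toeplitz_op_le: "norm (toeplitz_op F x) \<le> norm x"
proof -
  have *: "(\<Sum>n<M. (norm (\<Sum>k\<le>n. taylor_coeff F (n - k) (ell2_nth x k)))\<^sup>2) \<le> (norm x)\<^sup>2" for M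
  proof (rule order_trans[OF toeplitz_sum_le[OF F]])
    show "(\<Sum>k<M. (norm (ell2_nth x k))\<^sup>2) \<le> (norm x)\<^sup>2"
      unfolding norm2_ell2 by (intro sum_le_suminf summable_norm2_ell2) auto
  qed
  from norm_le_if_partial_sums_le[OF * norm_ge_zero]
  show "ell2_nth (toeplitz_op F x) n = (\<Sum>k\<le>n. taylor_coeff F (n - k) (ell2_nth x k))"
    "norm (toeplitz_op F x) \<le> norm x"
    unfolding toeplitz_op_def by (auto simp: fun_eq_iff)
qed

lemma bounded_clinear_toeplitz_op:
  assumes F: "F \<in> schur_class"
  shows "bounded_clinear (toeplitz_op F)"
proof (rule bounded_clinear_intro[where K=1])
  fix x y and a :: complex
  note cl = bounded_clinear_taylor_coeff[OF F]
  show "toeplitz_op F (x + y) = toeplitz_op F x + toeplitz_op F y"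
    by (rule ell2_eqI) (simp add: ell2_nth_toeplitz_op[OF F] plus_ell2.rep_eq
        bounded_clinear_add[OF cl] sum.distrib)
  show "toeplitz_op F (a *\<^sub>C x) = a *\<^sub>C toeplitz_op F x"
    by (rule ell2_eqI) (simp add: ell2_nth_toeplitz_op[OF F] scaleC_ell2.rep_eq
        bounded_clinear_scaleC[OF cl] linear_sum[OF bounded_linear.linear[OF bounded_linear_scaleC]])
  show "norm (toeplitz_op F x) \<le> 1 * norm x" using norm_toeplitz_op_le[OF F] by simp
qed

lemma toeplitz_op_fwd_shift:
  assumes F: "F \<in> schur_class"
  shows "toeplitz_op F (fwd_shift x) = fwd_shift (toeplitz_op F x)"
proof (rule ell2_eqI)
  fix n
  note c0 = bounded_clinear_zero[OF bounded_clinear_taylor_coeff[OF F]]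
  show "ell2_nth (toeplitz_op F (fwd_shift x)) n = ell2_nth (fwd_shift (toeplitz_op F x)) n"
  proof (cases n)
    case (Suc m)
    then show ?thesis unfolding ell2_nth_toeplitz_op[OF F] fwd_shift.rep_eq Suc
      by (simp add: sum.atMost_Suc_shift c0 del: sum.atMost_Suc)
  qed (simp add: ell2_nth_toeplitz_op[OF F] fwd_shift.rep_eq c0)
qed

lemma ell2_nth_toeplitz_op_embed0:
  assumes F: "F \<in> schur_class"
  shows "ell2_nth (toeplitz_op F (embed0 u)) n = taylor_coeff F n u"
proof -
  note c0 = bounded_clinear_zero[OF bounded_clinear_taylor_coeff[OF F]]
  have "(\<Sum>k\<le>n. taylor_coeff F (n - k) (if k = 0 then u else 0))
      = (\<Sum>k\<le>n. if k = 0 then taylor_coeff F n u else 0)"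
    by (intro sum.cong) (auto simp: c0)
  then show ?thesis by (simp add: ell2_nth_toeplitz_op[OF F] embed0.rep_eq sum.delta)
qed

section \<open>Entropy\<close>

text \<open>The functional under the infimum, expanded: the squared norm of entry 0 of the adjoint
  image of \<open>h\<close> cancels, and only its backward shift remains.\<close>

definition entropy_form ::
    "(complex \<Rightarrow> 'u::chilbert_space \<Rightarrow> 'y::chilbert_space) \<Rightarrow> 'u \<Rightarrow> 'y ell2 \<Rightarrow> real"
  where "entropy_form F u h = (norm u)\<^sup>2 - 2 * inner u (ell2_nth (cadjoint (toeplitz_op F) h) 0)
    + (norm h)\<^sup>2 - (norm (bwd_shift (cadjoint (toeplitz_op F) h)))\<^sup>2"

lemma entropy_form_eq:
  assumes "F \<in> schur_class"
  shows "(norm (u - cadjoint embed0 (cadjoint (toeplitz_op F) h)))\<^sup>2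
      + Re (cinner (h - toeplitz_op F (cadjoint (toeplitz_op F) h)) h) = entropy_form F u h"
  using norm_ell2_decompose[of "cadjoint (toeplitz_op F) h"]
  by (simp add: Re_cinner cadjoint_embed0 inner_diff_left norm_diff_sq entropy_form_def
      inner_cadjoint[OF bounded_clinear_toeplitz_op[OF assms]] flip: power2_norm_eq_inner)

lemma norm_cadjoint_toeplitz_op_le:
  "F \<in> schur_class \<Longrightarrow> norm (cadjoint (toeplitz_op F) h) \<le> norm h"
  using norm_cadjoint_le[OF bounded_clinear_toeplitz_op, of F 1] by (simp add: norm_toeplitz_op_le)

text \<open>Bounds the family from below, so that the real infimum is a true lower bound of its
  members.\<close>

lemma entropy_form_nonneg:
  assumes "F \<in> schur_class"
  shows "0 \<le> entropy_form F u h"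
proof -
  have "(norm (cadjoint (toeplitz_op F) h))\<^sup>2 \<le> (norm h)\<^sup>2"
    by (intro power_mono norm_cadjoint_toeplitz_op_le assms norm_ge_zero)
  then show ?thesis
    using norm_diff_sq[of u "ell2_nth (cadjoint (toeplitz_op F) h) 0"]
      norm_ell2_decompose[of "cadjoint (toeplitz_op F) h"]
      zero_le_power2[of "norm (u - ell2_nth (cadjoint (toeplitz_op F) h) 0)"]
    unfolding entropy_form_def by linarith
qed

lemma schur_entropy_eq:
  assumes "F \<in> schur_class"
  shows "schur_entropy F u = (INF h. entropy_form F u h)"
  by (simp add: schur_entropy_def entropy_form_eq[OF assms])

lemma schur_entropy_le:
  assumes "F \<in> schur_class"
  shows "schur_entropy F u \<le> entropy_form F u h"
  unfolding schur_entropy_eq[OF assms]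
  by (rule cINF_lower) (auto intro: bdd_belowI[of _ 0] simp: entropy_form_nonneg[OF assms])

lemma schur_entropy_greatest:
  assumes "F \<in> schur_class" "\<And>h. c \<le> entropy_form F u h"
  shows "c \<le> schur_entropy F u"
  unfolding schur_entropy_eq[OF assms(1)] using assms(2) by (intro cINF_greatest) auto

section \<open>The central solution\<close>

lemma norm_Pair_sq: "(norm (a, b))\<^sup>2 = (norm a)\<^sup>2 + (norm b)\<^sup>2"
  by (simp add: norm_Pair)

lemma norm_prod_sq: "(norm p)\<^sup>2 = (norm (fst p))\<^sup>2 + (norm (snd p))\<^sup>2"
  using norm_Pair_sq[of "fst p" "snd p"] by simp

locale ltonp =
  fixes W :: "'y::chilbert_space ell2 \<Rightarrow> 'z::chilbert_space"
    and Wt :: "'u::chilbert_space ell2 \<Rightarrow> 'z"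
    and Z :: "'z \<Rightarrow> 'z"
  assumes data: "ltonp_data W Wt Z"
    and pick_nonneg: "nonneg_op (pick_op W Wt)"
begin

abbreviation L where "L \<equiv> pick_op W Wt"
abbreviation R where "R \<equiv> sqrt_op L"
abbreviation Ws where "Ws \<equiv> cadjoint W"
abbreviation Wts where "Wts \<equiv> cadjoint Wt"
abbreviation Zs where "Zs \<equiv> cadjoint Z"

section \<open>Intertwining relations and the square root of the Pick operator\<close>

lemma W_clinear: "bounded_clinear W" and Wt_clinear: "bounded_clinear Wt" and Z_clinear: "bounded_clinear Z"
  using data by (auto simp: ltonp_data_def)

lemma W_shift: "W (fwd_shift x) = Z (W x)" and Wt_shift: "Wt (fwd_shift x') = Z (Wt x')"
  using data by (auto simp: ltonp_data_def fun_eq_iff)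

lemma Ws_Zs: "Ws (Zs z) = bwd_shift (Ws z)"
proof (rule inner_eqI)
  fix x
  have "inner (Z (W x)) z = inner x (Ws (Zs z))"
    by (simp add: inner_cadjoint[OF W_clinear] inner_cadjoint[OF Z_clinear])
  moreover have "inner (Z (W x)) z = inner x (bwd_shift (Ws z))"
    by (simp add: inner_cadjoint[OF W_clinear] inner_fwd_shift flip: W_shift)
  ultimately show "inner (Ws (Zs z)) x = inner (bwd_shift (Ws z)) x"
    by (simp add: inner_commute)
qed

lemma Wts_Zs: "Wts (Zs z) = bwd_shift (Wts z)"
proof (rule inner_eqI)
  fix x
  have "inner (Z (Wt x)) z = inner x (Wts (Zs z))"
    by (simp add: inner_cadjoint[OF Wt_clinear] inner_cadjoint[OF Z_clinear])
  moreover have "inner (Z (Wt x)) z = inner x (bwd_shift (Wts z))"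
    by (simp add: inner_cadjoint[OF Wt_clinear] inner_fwd_shift flip: Wt_shift)
  ultimately show "inner (Wts (Zs z)) x = inner (bwd_shift (Wts z)) x"
    by (simp add: inner_commute)
qed

lemma R_nonneg: "nonneg_op R" by (rule nonneg_sqrt_op[OF pick_nonneg])

lemma R_clinear: "bounded_clinear R" by (rule nonneg_op_bounded_clinear[OF R_nonneg])

lemma R_sa: "inner (R x) y = inner x (R y)" by (rule nonneg_op_selfadjoint[OF R_nonneg])

lemma R_R: "R (R x) = L x" by (rule sqrt_op_sqrt_op[OF pick_nonneg])

lemma norm_R_sq: "(norm (R z))\<^sup>2 = (norm (Ws z))\<^sup>2 - (norm (Wts z))\<^sup>2"
proof -
  have "(norm (R z))\<^sup>2 = inner (L z) z" by (simp add: power2_norm_eq_inner R_sa R_R inner_commute)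
  then show ?thesis
    by (simp add: pick_op_def inner_diff_left inner_cadjoint[OF W_clinear] inner_cadjoint[OF Wt_clinear] power2_norm_eq_inner)
qed

text \<open>The adjoints of \<open>K1_op\<close> and \<open>K2_op\<close> in closed form; taking
  entry 0 is the adjoint of \<open>embed0\<close>, and \<open>R\<close> is its own adjoint.\<close>

definition K1s :: "'z \<Rightarrow> 'u \<times> 'z" where "K1s z = (ell2_nth (Wts z) 0, R z)"
definition K2s :: "'z \<Rightarrow> 'y \<times> 'z" where "K2s z = (ell2_nth (Ws z) 0, R (Zs z))"

lemma K1_clinear: "bounded_clinear (K1_op W Wt)"
proof -
  have "bounded_clinear (\<lambda>p. Wt (embed0 (fst p)) + R (snd p))"
    by (intro bounded_clinear_plus bounded_clinear_compose[OF Wt_clinear] bounded_clinear_compose[OF bounded_clinear_embed0]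
        bounded_clinear_compose[OF R_clinear] bounded_clinear_fst bounded_clinear_snd)
  then show ?thesis by (simp add: K1_op_def case_prod_unfold)
qed

lemma K2_clinear: "bounded_clinear (K2_op W Wt Z)"
proof -
  have "bounded_clinear (\<lambda>p. W (embed0 (fst p)) + Z (R (snd p)))"
    by (intro bounded_clinear_plus bounded_clinear_compose[OF W_clinear] bounded_clinear_compose[OF bounded_clinear_embed0]
        bounded_clinear_compose[OF Z_clinear] bounded_clinear_compose[OF R_clinear] bounded_clinear_fst bounded_clinear_snd)
  then show ?thesis by (simp add: K2_op_def case_prod_unfold)
qed

lemma cadjoint_K1: "cadjoint (K1_op W Wt) = K1s"
  by (rule cadjoint_eqI[OF K1_clinear])
     (auto simp: K1_op_def K1s_def inner_prod_def inner_add_left inner_cadjoint[OF Wt_clinear] inner_embed0 R_sa)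

lemma cadjoint_K2: "cadjoint (K2_op W Wt Z) = K2s"
  by (rule cadjoint_eqI[OF K2_clinear])
     (auto simp: K2_op_def K2s_def inner_prod_def inner_add_left inner_cadjoint[OF W_clinear]
       inner_cadjoint[OF Z_clinear] inner_embed0 R_sa)

lemma K1s_clinear: "bounded_clinear K1s"
  unfolding cadjoint_K1[symmetric] by (rule bounded_clinear_cadjoint[OF K1_clinear])

lemma K2s_clinear: "bounded_clinear K2s"
  unfolding cadjoint_K2[symmetric] by (rule bounded_clinear_cadjoint[OF K2_clinear])

lemma norm_K1s_sq: "(norm (K1s z))\<^sup>2 = (norm (Ws z))\<^sup>2 - (norm (bwd_shift (Wts z)))\<^sup>2"
  using norm_ell2_decompose[of "Wts z"] by (simp add: K1s_def norm_Pair_sq norm_R_sq)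

text \<open>The identity K1 K1^* = K2 K2^* as an equality of norms: by the intertwining relations
  both squares equal
  \<open>(norm (Ws z))\<^sup>2 - (norm (bwd_shift (Wts z)))\<^sup>2\<close>.\<close>

lemma norm_K2s: "norm (K2s z) = norm (K1s z)"
proof -
  have "(norm (K2s z))\<^sup>2 = (norm (K1s z))\<^sup>2"
    unfolding norm_K1s_sq
    using norm_ell2_decompose[of "Ws z"] by (simp add: K2s_def norm_Pair_sq norm_R_sq Ws_Zs Wts_Zs)
  then show ?thesis by simp
qed

section \<open>The spaces of the central solution and the unitary operator omega\<close>

abbreviation FF where "FF \<equiv> F_space W Wt"
abbreviation ZZ where "ZZ \<equiv> Z_circ W Wt"

lemma FF_eq: "FF = closure (range K1s)" by (simp add: F_space_def cadjoint_K1)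

lemma F'_eq: "F'_space W Wt Z = closure (range K2s)" by (simp add: F'_space_def cadjoint_K2)

sublocale F: closed_csubspace FF
  unfolding FF_eq by (rule closed_csubspace_closure_range[OF K1s_clinear])

sublocale Z0: closed_csubspace ZZ
  unfolding Z_circ_def by (rule closed_csubspace_closure_range[OF nonneg_op_bounded_clinear[OF pick_nonneg]])

lemma K1s_mem: "K1s z \<in> FF"
  unfolding FF_eq by (rule subsetD[OF closure_subset]) simp

text \<open>\<open>ZZ\<close> is the closed range of \<open>L\<close>, not of its root. A vector
  orthogonal to the range of \<open>L\<close> is killed by \<open>R\<close>, because the square of
  \<open>norm (R n)\<close> is \<open>inner n (L n)\<close>.\<close>

lemma R_mem: "R z \<in> ZZ"
proof (rule Z0.mem_if_orth_complement)
  fix n assume n: "\<And>m. m \<in> ZZ \<Longrightarrow> inner n m = 0"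
  have "L n \<in> ZZ" unfolding Z_circ_def by (rule subsetD[OF closure_subset]) simp
  then have "inner n (R (R n)) = 0" using n by (simp add: R_R)
  then have "inner (R n) (R n) = 0" by (simp only: R_sa)
  then have "R n = 0" by simp
  then show "inner (R z) n = 0" by (simp add: R_sa)
qed

lemma FF_subset: "FF \<subseteq> UNIV \<times> ZZ"
  unfolding FF_eq by (intro closure_minimal closed_Times closed_UNIV Z0.closed) (auto simp: K1s_def R_mem)

lemma F'_subset: "F'_space W Wt Z \<subseteq> UNIV \<times> ZZ"
  unfolding F'_eq by (intro closure_minimal closed_Times closed_UNIV Z0.closed) (auto simp: K2s_def R_mem)

text \<open>Factorization gives a contraction on the whole space sending \<open>K1s z\<close> to
  \<open>K2s z\<close>. Norms agree on \<open>range K1s\<close>, hence on its closure; the isometric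
  image is then closed and contains \<open>range K2s\<close>.\<close>

lemma omega_exists:
  "\<exists>V. unitary_betw V FF (F'_space W Wt Z) \<and> V \<circ> cadjoint (K1_op W Wt) = cadjoint (K2_op W Wt Z)"
proof -
  obtain V where V: "bounded_linear V" "\<And>z. V (K1s z) = K2s z" "\<And>x. norm (V x) \<le> norm x"
    using douglas_factorization[OF bounded_clinear_linear[OF K1s_clinear] bounded_clinear_linear[OF K2s_clinear]]
    by (metis norm_K2s order_refl)
  interpret V: bounded_linear V by fact
  have cont: "continuous_on S V" for S by (rule linear_continuous_on[OF V(1)])
  have FFsub: "FF \<subseteq> S" if "closed S" "\<And>z. K1s z \<in> S" for S
    unfolding FF_eq using that by (intro closure_minimal) auto
  have n: "norm (V x) = norm x" if "x \<in> FF" for x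
  proof -
    have "FF \<subseteq> {x. norm (V x) = norm x}"
      by (intro FFsub closed_Collect_eq continuous_on_norm cont continuous_on_id) (auto simp: V norm_K2s)
    then show ?thesis using that by blast
  qed
  have i: "inner (V x) (V y) = inner x y" if "x \<in> FF" "y \<in> FF" for x y
  proof -
    have "x + y \<in> FF" using that F.sub by (simp add: subspace_add)
    then show ?thesis using n[of x] n[of y] n[of "x + y"] that
      norm_add_sq[of x y] norm_add_sq[of "V x" "V y"] by (simp add: V.add)
  qed
  \<comment> \<open>The factorization only supplies a real-linear map; complex homogeneity is
    checked on \<open>range K1s\<close> and extended by continuity.\<close>
  have sc: "V (a *\<^sub>C x) = a *\<^sub>C V x" if "x \<in> FF" for a x
  proof -
    have "FF \<subseteq> {x. V (a *\<^sub>C x) = a *\<^sub>C V x}"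
    proof (intro FFsub closed_Collect_eq)
      show "continuous_on UNIV (\<lambda>x. V (a *\<^sub>C x))"
        by (intro linear_continuous_on bounded_linear_compose[OF V(1)] bounded_linear_scaleC)
      show "continuous_on UNIV (\<lambda>x. a *\<^sub>C V x)"
        by (intro linear_continuous_on bounded_linear_compose[OF bounded_linear_scaleC] V(1))
    qed (simp add: V(2) flip: bounded_clinear_scaleC[OF K1s_clinear] bounded_clinear_scaleC[OF K2s_clinear])
    then show ?thesis using that by blast
  qed
  have im: "V ` FF = F'_space W Wt Z"
  proof
    show "V ` FF \<subseteq> F'_space W Wt Z" unfolding FF_eq F'_eq
      by (intro image_closure_subset cont closed_closure)
         (auto simp: V(2) intro: subsetD[OF closure_subset])
    have "complete (V ` FF)"
      by (rule complete_isometric_image[where e=1])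
         (use n F.closed F.sub V(1) in \<open>auto simp: complete_eq_closed\<close>)
    then have "closed (V ` FF)" by (simp add: complete_eq_closed)
    moreover have "range K2s \<subseteq> V ` FF" using K1s_mem by (auto simp: V(2)[symmetric])
    ultimately show "F'_space W Wt Z \<subseteq> V ` FF" unfolding F'_eq by (rule closure_minimal[rotated])
  qed
  have "inj_on V FF"
  proof (rule inj_onI)
    fix x y assume "x \<in> FF" "y \<in> FF" "V x = V y"
    then show "x = y" using n[of "x - y"] F.sub by (simp add: subspace_diff V.diff)
  qed
  then have "unitary_betw V FF (F'_space W Wt Z)"
    unfolding unitary_betw_def bij_betw_def using im sc i F.csub
    by (auto simp: V.add cinner_eq_Complex csubspace_def simp flip: sc)
  then show ?thesis using V(2) by (intro exI[of _ V]) (auto simp: cadjoint_K1 cadjoint_K2 fun_eq_iff)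
qed

section \<open>The contractive system and its outputs\<close>

abbreviation om where "om \<equiv> omega W Wt Z"

lemma om_unitary: "unitary_betw om FF (F'_space W Wt Z)"
  and om_K1s: "om (K1s z) = K2s z"
proof -
  have "unitary_betw om FF (F'_space W Wt Z) \<and> om \<circ> cadjoint (K1_op W Wt) = cadjoint (K2_op W Wt Z)"
    unfolding omega_def by (rule someI_ex[OF omega_exists])
  then show "unitary_betw om FF (F'_space W Wt Z)" "om (K1s z) = K2s z"
    by (auto simp: cadjoint_K1 cadjoint_K2 fun_eq_iff)
qed

text \<open>The block operator with entries \<delta>, \<gamma>, \<beta>, \<alpha>. It acts on the
  full product type; a state orthogonal to \<open>ZZ\<close> is annihilated because
  \<open>FF \<subseteq> UNIV \<times> ZZ\<close>.\<close>

definition M :: "'u \<times> 'z \<Rightarrow> 'y \<times> 'z" where "M p = om (orth_proj FF p)"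

lemma inner_M: "inner (M p) (M q) = inner (orth_proj FF p) (orth_proj FF q)"
  using om_unitary F.orth_proj_mem by (simp add: M_def unitary_betw_def flip: Re_cinner)

lemma norm_M: "norm (M p) = norm (orth_proj FF p)"
  using inner_M[of p p] by (simp add: norm_eq_sqrt_inner)

lemma norm_M_le: "norm (M p) \<le> norm p"
  using F.norm_orth_proj_le by (simp add: norm_M)

lemma M_clinear: "bounded_clinear M"
  by (rule bounded_clinear_intro[where K=1])
     (use om_unitary F.orth_proj_mem norm_M_le in \<open>simp_all add: M_def unitary_betw_def
       bounded_clinear_add[OF F.bounded_clinear_orth_proj] bounded_clinear_scaleC[OF F.bounded_clinear_orth_proj]\<close>)

lemma M_K1s: "M (K1s z) = K2s z"
  by (simp add: M_def F.orth_proj_ident K1s_mem om_K1s)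

lemma M_orth_proj: "M (orth_proj FF p) = M p"
  by (simp add: M_def F.orth_proj_ident F.orth_proj_mem)

lemma snd_M_mem: "snd (M p) \<in> ZZ"
proof -
  have "M p \<in> F'_space W Wt Z"
    using om_unitary F.orth_proj_mem unfolding M_def unitary_betw_def by (meson bij_betwE)
  then show ?thesis using F'_subset by (auto simp: mem_Times_iff)
qed

lemma norm_M_sq: "(norm (fst (M p)))\<^sup>2 + (norm (snd (M p)))\<^sup>2 = (norm (orth_proj FF p))\<^sup>2"
  unfolding norm_M[symmetric] by (rule norm_prod_sq[symmetric])

text \<open>This is K2 M = K1. Tested against \<open>z\<close> it reduces to
  \<open>M (K1s z) = K2s z\<close>, since \<open>M\<close> preserves inner products with elements of
  \<open>FF\<close>.\<close>

lemma K2_M: "W (embed0 (fst (M p))) + Z (R (snd (M p))) = Wt (embed0 (fst p)) + R (snd p)"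
proof (rule inner_eqI)
  fix z
  have "inner (W (embed0 (fst (M p))) + Z (R (snd (M p)))) z = inner (K2_op W Wt Z (M p)) z"
    by (simp add: K2_op_def case_prod_unfold)
  also have "\<dots> = inner (M p) (M (K1s z))" by (simp add: inner_cadjoint[OF K2_clinear] cadjoint_K2 M_K1s)
  also have "\<dots> = inner p (K1s z)"
    by (simp add: inner_M F.orth_proj_ident K1s_mem F.inner_orth_proj)
  also have "\<dots> = inner (K1_op W Wt p) z" by (simp add: inner_cadjoint[OF K1_clinear] cadjoint_K1)
  finally show "inner (W (embed0 (fst (M p))) + Z (R (snd (M p)))) z
      = inner (Wt (embed0 (fst p)) + R (snd p)) z" by (simp add: K1_op_def case_prod_unfold)
qed

text \<open>The outputs of the system \<open>(input, state) \<mapsto> M (input, state)\<close> when it starts at \<open>p\<close> and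
  all later inputs are zero.\<close>

primrec out :: "nat \<Rightarrow> 'u \<times> 'z \<Rightarrow> 'y" where
  "out 0 p = fst (M p)"
| "out (Suc n) p = out n (0, snd (M p))"

definition al :: "'z \<Rightarrow> 'z" where "al x = snd (M (0, x))"

lemma clinear_0_Pair: "bounded_clinear (\<lambda>x. (0, x))" and clinear_Pair_0: "bounded_clinear (\<lambda>x. (x, 0))"
  by (intro bounded_clinear_Pair bounded_clinear_ident bounded_clinear_const_zero)+

lemma al_clinear: "bounded_clinear al"
  unfolding al_def[abs_def]
  by (rule bounded_clinear_compose[OF bounded_clinear_snd bounded_clinear_compose[OF M_clinear clinear_0_Pair]])

lemma norm_al_le: "norm (al x) \<le> norm x"
  using order_trans[OF norm_snd_le[of "snd (M (0, x))" "fst (M (0, x))"]] norm_M_le[of "(0, x)"]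
  by (simp add: al_def norm_Pair)

lemma norm_al_funpow_le: "norm ((al ^^ n) x) \<le> norm x"
  by (induction n) (auto intro: order_trans[OF norm_al_le])

lemma out_0: "out n (0, x) = fst (M (0, (al ^^ n) x))"
  by (induction n arbitrary: x) (simp_all add: funpow_swap1 flip: al_def)

lemma out_clinear: "bounded_clinear (out n)"
proof (induction n)
  case 0
  have "bounded_clinear (\<lambda>p. fst (M p))" by (rule bounded_clinear_compose[OF bounded_clinear_fst M_clinear])
  then show ?case by (simp add: bounded_clinear_def)
next
  case (Suc n)
  have "bounded_clinear (\<lambda>p. out n (0, snd (M p)))"
    by (rule bounded_clinear_compose[OF Suc bounded_clinear_compose[OF clinear_0_Pair
          bounded_clinear_compose[OF bounded_clinear_snd M_clinear]]])
  then show ?case by (simp add: bounded_clinear_def)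
qed

text \<open>Energy balance: each step splits the energy of the projected pair exactly into output
  and next state, so the total output energy cannot exceed the initial one.\<close>

lemma sum_out_le: "(\<Sum>n<N. (norm (out n p))\<^sup>2) \<le> (norm (orth_proj FF p))\<^sup>2"
proof (induction N arbitrary: p)
  case (Suc N)
  have "(\<Sum>n<N. (norm (out n (0, snd (M p))))\<^sup>2) \<le> (norm (0::'u, snd (M p)))\<^sup>2"
    by (rule order_trans[OF Suc]) (intro power_mono F.norm_orth_proj_le norm_ge_zero)
  then show ?case unfolding sum.lessThan_Suc_shift norm_M_sq[symmetric] by (simp add: norm_Pair)
qed simp

lemma norm_out_le: "norm (out n p) \<le> norm p"
proof (rule power2_le_imp_le)
  have "(norm (out n p))\<^sup>2 \<le> (\<Sum>k<Suc n. (norm (out k p))\<^sup>2)"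
    by (rule member_le_sum) auto
  also have "\<dots> \<le> (norm (orth_proj FF p))\<^sup>2" by (rule sum_out_le)
  also have "\<dots> \<le> (norm p)\<^sup>2" by (intro power_mono F.norm_orth_proj_le norm_ge_zero)
  finally show "(norm (out n p))\<^sup>2 \<le> (norm p)\<^sup>2" .
qed simp

text \<open>\<open>Theta (0, x)\<close> is the observability map of \<gamma> and \<alpha>, while
  \<open>Theta (u, 0)\<close> turns out to be the first column of the Toeplitz operator of the
  central solution.\<close>

definition Theta :: "'u \<times> 'z \<Rightarrow> 'y ell2" where "Theta p = Abs_ell2 (\<lambda>n. out n p)"

lemma ell2_nth_Theta: "ell2_nth (Theta p) n = out n p"
  and norm_Theta_le_proj: "norm (Theta p) \<le> norm (orth_proj FF p)"
  using norm_le_if_partial_sums_le[OF sum_out_le[where p=p] norm_ge_zero] by (simp_all add: Theta_def)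

lemma norm_Theta_le: "norm (Theta p) \<le> norm p"
  using norm_Theta_le_proj F.norm_orth_proj_le by (rule order_trans)

lemma Theta_clinear: "bounded_clinear Theta"
proof (rule bounded_clinear_intro[where K=1])
  show "Theta (p + q) = Theta p + Theta q" for p q
    by (rule ell2_eqI) (simp only: ell2_nth_Theta plus_ell2.rep_eq bounded_clinear_add[OF out_clinear])
  show "Theta (a *\<^sub>C p) = a *\<^sub>C Theta p" for a p
    by (rule ell2_eqI) (simp only: ell2_nth_Theta scaleC_ell2.rep_eq bounded_clinear_scaleC[OF out_clinear])
qed (use norm_Theta_le in simp)

lemma Theta_rec: "Theta p = embed0 (fst (M p)) + fwd_shift (Theta (0, snd (M p)))"
proof (rule ell2_eqI)
  fix n
  show "ell2_nth (Theta p) n = ell2_nth (embed0 (fst (M p)) + fwd_shift (Theta (0, snd (M p)))) n"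
    by (cases n) (simp_all add: ell2_nth_Theta plus_ell2.rep_eq embed0.rep_eq fwd_shift.rep_eq)
qed

text \<open>\<Lambda> \<le> W W^*, and \<open>Ws\<close> converts powers of \<open>Zs\<close> into
  powers of the backward shift.\<close>

lemma R_Zs_funpow_le: "norm (R ((Zs ^^ n) z)) \<le> norm ((bwd_shift ^^ n) (Ws z))"
proof (rule power2_le_imp_le)
  have "Ws ((Zs ^^ n) z) = (bwd_shift ^^ n) (Ws z)" by (induction n) (simp_all add: Ws_Zs)
  then show "(norm (R ((Zs ^^ n) z)))\<^sup>2 \<le> (norm ((bwd_shift ^^ n) (Ws z)))\<^sup>2"
    by (simp add: norm_R_sq)
qed simp

text \<open>The difference \<open>\<Delta>\<close> of the two sides satisfies \<open>\<Delta> (0, x) = Z\<^sup>n \<Delta> (0, \<alpha>\<^sup>n x)\<close>, which tends to \<open>0\<close> weakly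
  because \<open>\<Lambda>\<^sup>1\<^sup>/\<^sup>2 (Z\<^sup>*)\<^sup>n\<close> tends to \<open>0\<close> strongly.\<close>

lemma W_Theta: "W (Theta p) = Wt (embed0 (fst p)) + R (snd p)"
proof -
  define \<Delta> where "\<Delta> p = W (Theta p) - (Wt (embed0 (fst p)) + R (snd p))" for p
  have \<Delta>_rec: "\<Delta> p = Z (\<Delta> (0, snd (M p)))" for p
  proof -
    have "W (Theta p) = W (embed0 (fst (M p))) + Z (W (Theta (0, snd (M p))))"
      by (subst Theta_rec) (simp add: bounded_clinear_add[OF W_clinear] W_shift)
    moreover have "\<Delta> (0, snd (M p)) = W (Theta (0, snd (M p))) - R (snd (M p))"
      by (simp add: \<Delta>_def bounded_clinear_zero[OF bounded_clinear_embed0] bounded_clinear_zero[OF Wt_clinear])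
    ultimately show ?thesis
      unfolding \<Delta>_def[of p] K2_M[symmetric] by (simp add: bounded_clinear_diff[OF Z_clinear])
  qed
  have \<Delta>_pow: "\<Delta> (0, x) = (Z ^^ n) (\<Delta> (0, (al ^^ n) x))" for n x
  proof (induction n arbitrary: x)
    case (Suc n)
    have "\<Delta> (0, x) = (Z ^^ n) (\<Delta> (0, (al ^^ n) x))" by (rule Suc)
    also have "\<dots> = (Z ^^ n) (Z (\<Delta> (0, al ((al ^^ n) x))))"
      by (subst \<Delta>_rec) (simp add: al_def)
    finally show ?case by (simp add: funpow_swap1)
  qed simp
  have "\<Delta> (0, x) = 0" for x
  proof (rule inner_eqI)
    fix z
    have bound: "\<bar>inner (\<Delta> (0, x)) z\<bar> \<le> 2 * norm x * norm ((bwd_shift ^^ n) (Ws z))" for n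
    proof -
      define y where "y = (al ^^ n) x"
      have ny: "norm y \<le> norm x" unfolding y_def by (rule norm_al_funpow_le)
      have Zn: "inner ((Z ^^ n) a) z = inner a ((Zs ^^ n) z)" for a
        by (induction n arbitrary: z) (simp_all add: inner_cadjoint[OF Z_clinear], simp add: funpow_swap1)
      have Wn: "Ws ((Zs ^^ n) z) = (bwd_shift ^^ n) (Ws z)" by (induction n) (simp_all add: Ws_Zs)
      have "inner (\<Delta> (0, x)) z = inner (\<Delta> (0, y)) ((Zs ^^ n) z)"
        unfolding \<Delta>_pow[of x n] Zn y_def ..
      also have "\<dots> = inner (Theta (0, y)) ((bwd_shift ^^ n) (Ws z)) - inner y (R ((Zs ^^ n) z))"
        by (simp add: \<Delta>_def bounded_clinear_zero[OF bounded_clinear_embed0] bounded_clinear_zero[OF Wt_clinear]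
            inner_diff_left inner_cadjoint[OF W_clinear] Wn R_sa)
      finally have "\<bar>inner (\<Delta> (0, x)) z\<bar> \<le> \<bar>inner (Theta (0, y)) ((bwd_shift ^^ n) (Ws z))\<bar>
          + \<bar>inner y (R ((Zs ^^ n) z))\<bar>" by simp
      also have "\<bar>inner (Theta (0, y)) ((bwd_shift ^^ n) (Ws z))\<bar> \<le> norm x * norm ((bwd_shift ^^ n) (Ws z))"
      proof (rule order_trans[OF Cauchy_Schwarz_ineq2])
        have "norm (Theta (0, y)) \<le> norm x" using norm_Theta_le[of "(0, y)"] ny by (simp add: norm_Pair)
        then show "norm (Theta (0, y)) * norm ((bwd_shift ^^ n) (Ws z))
            \<le> norm x * norm ((bwd_shift ^^ n) (Ws z))" by (rule mult_right_mono) simp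
      qed
      also have "\<bar>inner y (R ((Zs ^^ n) z))\<bar> \<le> norm x * norm ((bwd_shift ^^ n) (Ws z))"
        using Cauchy_Schwarz_ineq2[of y "R ((Zs ^^ n) z)"] mult_mono[OF ny R_Zs_funpow_le[of n z]] by simp
      finally show ?thesis by simp
    qed
    have "(\<lambda>n. 2 * norm x * norm ((bwd_shift ^^ n) (Ws z))) \<longlonglongrightarrow> 0"
      by (intro tendsto_mult_right_zero tendsto_norm_zero bwd_shift_funpow_tendsto_0)
    then have "\<bar>inner (\<Delta> (0, x)) z\<bar> \<le> 0"
      by (rule tendsto_lowerbound) (simp_all add: bound)
    then show "inner (\<Delta> (0, x)) z = inner 0 z" by simp
  qed
  then have "\<Delta> p = 0" by (subst \<Delta>_rec) (simp add: bounded_clinear_zero[OF Z_clinear])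
  then show ?thesis by (simp add: \<Delta>_def)
qed

section \<open>The central solution as the transfer function of the system\<close>

abbreviation F0 where "F0 \<equiv> central_solution W Wt Z"

lemma
  assumes \<zeta>: "norm \<zeta> < 1"
  shows central_sums: "(\<lambda>n. \<zeta> ^ n *\<^sub>C out n (u, 0)) sums F0 \<zeta> u"
    and norm_central_le: "norm (F0 \<zeta> u) \<le> norm u"
proof -
  define s where "s = snd (M (u, 0))"
  \<comment> \<open>The Neumann series for the inverse of I - \<zeta> \<alpha> applied to \<beta>
    u.\<close>
  define x where "x = (\<Sum>n. \<zeta> ^ n *\<^sub>C (al ^^ n) s)"
  have xs: "(\<lambda>n. \<zeta> ^ n *\<^sub>C (al ^^ n) s) sums x" unfolding x_def
    by (rule summable_sums[OF summable_norm_cancel[OF summable_norm_powser[OF norm_al_funpow_le \<zeta>]]])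
  \<comment> \<open>\<open>central_solution\<close> inverts on \<open>Z_circ\<close> only, so the
    preimage has to be located there.\<close>
  have xmem: "x \<in> ZZ"
  proof (rule closed_sequentially[OF Z0.closed])
    show "(\<lambda>N. \<Sum>n<N. \<zeta> ^ n *\<^sub>C (al ^^ n) s) \<longlonglongrightarrow> x" using xs by (simp add: sums_def)
    have "(al ^^ n) s \<in> ZZ" for n by (cases n) (simp_all add: s_def snd_M_mem al_def)
    then show "(\<Sum>n<N. \<zeta> ^ n *\<^sub>C (al ^^ n) s) \<in> ZZ" for N
      using Z0.csub by (intro subspace_sum) (auto simp: csubspace_def)
  qed
  have "(\<lambda>n. \<zeta> *\<^sub>C al (\<zeta> ^ n *\<^sub>C (al ^^ n) s)) sums (\<zeta> *\<^sub>C al x)"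
    by (rule bounded_linear.sums[OF bounded_clinear_linear[OF bounded_clinear_scale[OF al_clinear]] xs])
  then have "(\<lambda>n. \<zeta> ^ Suc n *\<^sub>C (al ^^ Suc n) s) sums (\<zeta> *\<^sub>C al x)"
    by (simp add: bounded_clinear_scaleC[OF al_clinear] scaleC_scaleC)
  then have "(\<lambda>n. \<zeta> ^ n *\<^sub>C (al ^^ n) s) sums (\<zeta> *\<^sub>C al x + s)"
    by (subst (asm) sums_Suc_iff) simp
  then have xeq: "x = \<zeta> *\<^sub>C al x + s" using xs by (rule sums_unique2[rotated])
  have "inv_into ZZ (\<lambda>z. z - \<zeta> *\<^sub>C al z) s = x"
  proof (rule inv_into_f_eq[OF _ xmem])
    show "inj_on (\<lambda>z. z - \<zeta> *\<^sub>C al z) ZZ"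
    proof (rule inj_onI)
      fix a b assume "a - \<zeta> *\<^sub>C al a = b - \<zeta> *\<^sub>C al b"
      then have "a - b = \<zeta> *\<^sub>C al (a - b)"
        by (simp add: bounded_clinear_diff[OF al_clinear] scaleC_diff_right algebra_simps)
      then have "norm (a - b) = norm \<zeta> * norm (al (a - b))" by (metis norm_scaleC)
      also have "\<dots> \<le> norm \<zeta> * norm (a - b)" by (intro mult_left_mono norm_al_le) simp
      finally have "(1 - norm \<zeta>) * norm (a - b) \<le> 0" by (simp add: algebra_simps)
      then show "a = b" using \<zeta> by (simp add: mult_le_0_iff)
    qed
    show "x - \<zeta> *\<^sub>C al x = s" using xeq by (simp add: algebra_simps)
  qed
  moreover have "alpha0 W Wt Z = al" "beta0 W Wt Z u = s" "gamma0 W Wt Z x = fst (M (0, x))"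
    "delta0 W Wt Z u = fst (M (u, 0))"
    by (simp_all add: alpha0_def beta0_def gamma0_def delta0_def al_def s_def M_def fun_eq_iff)
  ultimately have F0: "F0 \<zeta> u = fst (M (u, 0)) + \<zeta> *\<^sub>C fst (M (0, x))"
    unfolding central_solution_def by simp
  have cl: "bounded_clinear (\<lambda>x. \<zeta> *\<^sub>C fst (M (0, x)))"
    by (rule bounded_clinear_scale[OF bounded_clinear_compose[OF bounded_clinear_fst
          bounded_clinear_compose[OF M_clinear clinear_0_Pair]]])
  have "(\<lambda>n. \<zeta> *\<^sub>C fst (M (0, \<zeta> ^ n *\<^sub>C (al ^^ n) s))) sums (\<zeta> *\<^sub>C fst (M (0, x)))"
    by (rule bounded_linear.sums[OF bounded_clinear_linear[OF cl] xs])
  then have "(\<lambda>n. \<zeta> ^ Suc n *\<^sub>C out (Suc n) (u, 0)) sums (\<zeta> *\<^sub>C fst (M (0, x)))"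
    by (simp add: bounded_clinear_scaleC[OF cl] out_0 s_def scaleC_scaleC mult.commute)
  then show "(\<lambda>n. \<zeta> ^ n *\<^sub>C out n (u, 0)) sums F0 \<zeta> u"
    by (subst (asm) sums_Suc_iff) (simp add: F0 add.commute)
  \<comment> \<open>Input \<open>u\<close> in state \<open>\<zeta> *\<^sub>C x\<close> yields output
    \<open>F0 \<zeta> u\<close> and next state \<open>x\<close>. Contractivity of \<open>M\<close>
    bounds the output, because the old state is no larger than the new one.\<close>
  have "M (u, \<zeta> *\<^sub>C x) = M (u, 0) + \<zeta> *\<^sub>C M (0, x)"
  proof -
    have "(u, \<zeta> *\<^sub>C x) = (u, 0) + \<zeta> *\<^sub>C (0, x)" by (simp add: scaleC_prod_def)
    then show ?thesis by (simp only: bounded_clinear_add[OF M_clinear] bounded_clinear_scaleC[OF M_clinear])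
  qed
  then have "M (u, \<zeta> *\<^sub>C x) = (F0 \<zeta> u, x)"
    using xeq by (simp add: F0 prod_eq_iff scaleC_prod_def al_def s_def add.commute)
  then have "(norm (F0 \<zeta> u))\<^sup>2 + (norm x)\<^sup>2 \<le> (norm u)\<^sup>2 + (norm (\<zeta> *\<^sub>C x))\<^sup>2"
    using power_mono[OF norm_M_le[of "(u, \<zeta> *\<^sub>C x)"], of 2] by (simp add: norm_Pair)
  moreover have "(norm (\<zeta> *\<^sub>C x))\<^sup>2 \<le> (norm x)\<^sup>2"
    using \<zeta> by (intro power_mono) (simp_all add: norm_scaleC mult_left_le_one_le)
  ultimately have "(norm (F0 \<zeta> u))\<^sup>2 \<le> (norm u)\<^sup>2" by linarith
  then show "norm (F0 \<zeta> u) \<le> norm u" by (simp add: power2_le_iff_abs_le)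
qed

lemma out_u_clinear: "bounded_clinear (\<lambda>u. out n (u, 0))"
  by (rule bounded_clinear_compose[OF out_clinear clinear_Pair_0])

lemma F0_schur: "F0 \<in> schur_class"
proof (rule schur_classI[OF out_u_clinear _ central_sums norm_central_le])
  show "norm (out n (u, 0)) \<le> norm u" for n u
    using norm_out_le[of n "(u, 0)"] by (simp add: norm_Pair)
qed

lemma taylor_coeff_F0: "taylor_coeff F0 n u = out n (u, 0)"
  using taylor_coeff_eqI[of "\<lambda>n u. out n (u, 0)", OF central_sums] by simp

abbreviation T0 where "T0 \<equiv> toeplitz_op F0"

lemma T0_embed0: "T0 (embed0 u) = Theta (u, 0)"
  by (rule ell2_eqI) (simp add: ell2_nth_toeplitz_op_embed0[OF F0_schur] taylor_coeff_F0 ell2_nth_Theta)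

text \<open>The defect \<open>D\<close> vanishes on \<open>range embed0\<close> by
  \<open>W_Theta\<close> and intertwines the shift with \<open>Z\<close>. Hence the first n entries
  of \<open>x\<close> do not affect \<open>D x\<close>, and the tails tend to 0.\<close>

lemma F0_solution: "ltonp_solution W Wt F0"
proof -
  have T: "bounded_clinear T0" by (rule bounded_clinear_toeplitz_op[OF F0_schur])
  define D where "D x = W (T0 x) - Wt x" for x
  have D: "bounded_clinear D" unfolding D_def[abs_def]
    by (intro bounded_clinear_minus bounded_clinear_compose[OF W_clinear] T Wt_clinear)
  have D0: "D (embed0 u) = 0" for u
    by (simp add: D_def T0_embed0 W_Theta bounded_clinear_zero[OF R_clinear])
  have D_shift: "D (fwd_shift x) = Z (D x)" for x
    by (simp add: D_def toeplitz_op_fwd_shift[OF F0_schur] W_shift Wt_shift bounded_clinear_diff[OF Z_clinear])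
  have "D x = D ((fwd_shift ^^ n) ((bwd_shift ^^ n) x))" for n x
  proof (induction n)
    case (Suc n)
    have "D ((fwd_shift ^^ n) y) = (Z ^^ n) (D y)" for n y
      by (induction n) (simp_all add: D_shift)
    then have "D x = (Z ^^ n) (D ((bwd_shift ^^ n) x))" using Suc by simp
    also have "D ((bwd_shift ^^ n) x) = D (fwd_shift (bwd_shift ((bwd_shift ^^ n) x)))"
      by (subst ell2_decompose[of "(bwd_shift ^^ n) x"]) (simp add: bounded_clinear_add[OF D] D0)
    also have "(Z ^^ n) \<dots> = D ((fwd_shift ^^ n) (fwd_shift (bwd_shift ((bwd_shift ^^ n) x))))"
      by (simp add: \<open>\<And>n y. D ((fwd_shift ^^ n) y) = (Z ^^ n) (D y)\<close>)
    finally show ?case by (simp add: funpow_swap1)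
  qed simp
  then have "norm (D x) \<le> norm ((bwd_shift ^^ n) x) * onorm D" for n x
  proof -
    have "norm ((fwd_shift ^^ n) y) = norm y" for y :: "'u ell2"
      by (induction n) (simp_all add: norm_fwd_shift)
    then show ?thesis
      using onorm[OF bounded_clinear_linear[OF D], of "(fwd_shift ^^ n) ((bwd_shift ^^ n) x)"]
        \<open>\<And>n x. D x = D ((fwd_shift ^^ n) ((bwd_shift ^^ n) x))\<close>[of x n] by (simp add: mult.commute)
  qed
  moreover have "(\<lambda>n. norm ((bwd_shift ^^ n) x) * onorm D) \<longlonglongrightarrow> 0" for x :: "'u ell2"
    by (intro tendsto_mult_left_zero tendsto_norm_zero bwd_shift_funpow_tendsto_0)
  ultimately have "norm (D x) \<le> 0" for x
    by (rule tendsto_lowerbound[OF _ always_eventually[OF allI] sequentially_bot, rotated])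
  then have "W \<circ> T0 = Wt" by (auto simp: D_def fun_eq_iff)
  then show ?thesis by (simp add: ltonp_solution_def F0_schur)
qed

end

context ltonp
begin

section \<open>Maximality of the central solution\<close>

text \<open>The map \<open>(g, p) \<mapsto> S T g + \<Theta> p\<close> is a contraction, hence so is its adjoint
  \<open>h \<mapsto> (S\<^sup>* T\<^sup>* h, \<Theta>\<^sup>* h)\<close>, and the range of \<open>\<Theta>\<^sup>*\<close> lies in \<open>\<F>\<close>.\<close>

lemma entropy_form_F0_ge:
  "(norm ((u, 0) - orth_proj FF (u, 0)))\<^sup>2 \<le> entropy_form F0 u h"
proof -
  define g where "g = bwd_shift (cadjoint T0 h)"
  define w where "w = cadjoint Theta h"
  note T = bounded_clinear_toeplitz_op[OF F0_schur]
  \<comment> \<open>The output of the system started at \<open>p\<close> and fed with the inputs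
    \<open>g\<close> from time 1 on. In the induction the first entry of \<open>g\<close> joins the
    next state to form the new initial pair.\<close>
  have first: "(\<Sum>n<N. (norm (ell2_nth (fwd_shift (T0 g) + Theta p) n))\<^sup>2)
      \<le> (norm g)\<^sup>2 + (norm (orth_proj FF p))\<^sup>2" for N g p
  proof (induction N arbitrary: g p)
    case (Suc N)
    let ?q = "(ell2_nth g 0, snd (M p))"
    have "T0 g = Theta (ell2_nth g 0, 0) + fwd_shift (T0 (bwd_shift g))"
      by (subst ell2_decompose[of g])
         (simp add: bounded_clinear_add[OF T] T0_embed0 toeplitz_op_fwd_shift[OF F0_schur])
    moreover have "Theta ?q = Theta (ell2_nth g 0, 0) + Theta (0, snd (M p))"
      by (simp flip: bounded_clinear_add[OF Theta_clinear])
    ultimately have "fwd_shift (T0 g) + Theta p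
        = embed0 (fst (M p)) + fwd_shift (fwd_shift (T0 (bwd_shift g)) + Theta ?q)"
      by (subst Theta_rec) (simp add: bounded_clinear_add[OF bounded_clinear_fwd_shift])
    then have "(\<Sum>n<Suc N. (norm (ell2_nth (fwd_shift (T0 g) + Theta p) n))\<^sup>2)
        = (norm (fst (M p)))\<^sup>2
          + (\<Sum>n<N. (norm (ell2_nth (fwd_shift (T0 (bwd_shift g)) + Theta ?q) n))\<^sup>2)"
      unfolding sum.lessThan_Suc_shift
      by (simp add: plus_ell2.rep_eq embed0.rep_eq fwd_shift.rep_eq del: sum.lessThan_Suc)
    also have "\<dots> \<le> (norm (fst (M p)))\<^sup>2 + ((norm (bwd_shift g))\<^sup>2 + (norm ?q)\<^sup>2)"
      by (intro add_left_mono order_trans[OF Suc] power_mono F.norm_orth_proj_le norm_ge_zero)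
    also have "\<dots> = (norm g)\<^sup>2 + (norm (orth_proj FF p))\<^sup>2"
      unfolding norm_Pair_sq norm_M_sq[symmetric] norm_ell2_decompose[of g] by simp
    finally show ?case .
  qed simp
  have contr: "(norm (fwd_shift (T0 g) + Theta p))\<^sup>2 \<le> (norm g)\<^sup>2 + (norm p)\<^sup>2" for g p
  proof -
    have "(norm (fwd_shift (T0 g) + Theta p))\<^sup>2 \<le> (norm g)\<^sup>2 + (norm (orth_proj FF p))\<^sup>2"
      unfolding norm2_ell2[of "_ + _"] by (intro suminf_le_const summable_norm2_ell2 first)
    then show ?thesis using power_mono[OF F.norm_orth_proj_le[of p] norm_ge_zero, of 2] by linarith
  qed
  have "(norm g)\<^sup>2 + (norm w)\<^sup>2 \<le> (norm h)\<^sup>2"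
  proof -
    \<comment> \<open>The contraction bound passes to the adjoint: pairing the image of
      \<open>(g, w)\<close> with \<open>h\<close> gives \<open>s * s\<close>, and Cauchy-Schwarz
      bounds it by \<open>s * norm h\<close>.\<close>
    define s where "s = sqrt ((norm g)\<^sup>2 + (norm w)\<^sup>2)"
    have s2: "s\<^sup>2 = (norm g)\<^sup>2 + (norm w)\<^sup>2" and s0: "0 \<le> s" by (simp_all add: s_def)
    have "inner (fwd_shift (T0 g) + Theta w) h = inner g g + inner w w"
      by (simp add: inner_add_left inner_cadjoint[OF Theta_clinear] w_def g_def
          inner_cadjoint[OF T] flip: toeplitz_op_fwd_shift[OF F0_schur] inner_fwd_shift)
    then have "s * s \<le> norm (fwd_shift (T0 g) + Theta w) * norm h"
      using norm_cauchy_schwarz[of "fwd_shift (T0 g) + Theta w" h] s2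
      by (simp add: power2_eq_square power2_norm_eq_inner[unfolded power2_eq_square])
    also have "\<dots> \<le> s * norm h"
      using power2_le_imp_le[OF contr[of g w, folded s2] s0] by (rule mult_right_mono) simp
    finally have "s \<le> norm h" using s0 by (cases "s = 0") (auto simp: mult_le_cancel_left_pos)
    then show ?thesis unfolding s2[symmetric] using s0 by (rule power_mono)
  qed
  moreover have "inner u (ell2_nth (cadjoint T0 h) 0) = inner (u, 0) w"
  proof -
    have "inner u (ell2_nth (cadjoint T0 h) 0) = inner (Theta (u, 0)) h"
      by (simp add: inner_cadjoint[OF T] flip: inner_embed0 T0_embed0)
    then show ?thesis by (simp only: inner_cadjoint[OF Theta_clinear] w_def)
  qed
  moreover have "(norm ((u, 0) - w))\<^sup>2 = (norm u)\<^sup>2 - 2 * inner (u, 0) w + (norm w)\<^sup>2"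
    by (simp add: norm_diff_sq norm_Pair)
  ultimately have "(norm ((u, 0) - w))\<^sup>2 \<le> entropy_form F0 u h"
    unfolding entropy_form_def g_def[symmetric] by linarith
  moreover have "w \<in> FF"
  proof (rule F.mem_if_orth_complement)
    fix n assume "\<And>m. m \<in> FF \<Longrightarrow> inner n m = 0"
    then have "orth_proj FF n = 0" by (rule F.orth_proj_eq_0)
    then have "Theta n = 0" using norm_Theta_le_proj[of n] by simp
    then show "inner w n = 0" unfolding w_def by (simp add: inner_cadjoint_left[OF Theta_clinear])
  qed
  ultimately show ?thesis using F.orth_proj_nearest by (meson order_trans)
qed

context
  fixes F :: "complex \<Rightarrow> 'u \<Rightarrow> 'y"
  assumes sol: "ltonp_solution W Wt F"
begin

abbreviation T where "T \<equiv> toeplitz_op F"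

lemma F_schur: "F \<in> schur_class" and W_T: "W (T x) = Wt x"
  using sol by (auto simp: ltonp_solution_def fun_eq_iff)

lemma T_clinear: "bounded_clinear T" by (rule bounded_clinear_toeplitz_op[OF F_schur])

lemma Ts_Ws: "cadjoint T (Ws z) = Wts z"
  by (rule inner_eqI) (simp add: inner_cadjoint_left[OF T_clinear] inner_cadjoint_left[OF W_clinear]
      inner_cadjoint_left[OF Wt_clinear] W_T)

lemma entropy_form_Ws: "entropy_form F u (Ws z) = (norm ((u, 0) - K1s z))\<^sup>2"
  using norm_ell2_decompose[of "Wts z"]
  by (simp add: entropy_form_def Ts_Ws K1s_def norm_Pair_sq norm_diff_sq norm_R_sq)

text \<open>Each \<open>K1s z\<close> provides a competitor; the bound is a closed condition on the
  pair, so it reaches the projection, which may lie outside \<open>range K1s\<close>.\<close>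

lemma schur_entropy_le_dist: "schur_entropy F u \<le> (norm ((u, 0) - orth_proj FF (u, 0)))\<^sup>2"
proof -
  have "FF \<subseteq> {p. schur_entropy F u \<le> (norm ((u, 0) - p))\<^sup>2}" unfolding FF_eq
  proof (intro closure_minimal closed_Collect_le continuous_intros)
    show "range K1s \<subseteq> {p. schur_entropy F u \<le> (norm ((u, 0) - p))\<^sup>2}"
      using schur_entropy_le[OF F_schur] by (auto simp flip: entropy_form_Ws)
  qed
  then show ?thesis using F.orth_proj_mem by blast
qed

end

lemma schur_entropy_F0: "schur_entropy F0 u = (norm ((u, 0) - orth_proj FF (u, 0)))\<^sup>2"
  by (intro antisym schur_entropy_le_dist F0_solution schur_entropy_greatest F0_schur entropy_form_F0_ge)

section \<open>Uniqueness\<close>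

text \<open>Equality of the entropies makes \<open>\<Theta>\<^sub>F (u, x) = T\<^sub>F E u + \<Gamma> x\<close>, with \<open>\<Gamma> \<Lambda>\<^sup>1\<^sup>/\<^sup>2 = (I - T\<^sub>F T\<^sub>F\<^sup>*) W\<^sup>*\<close>,
  vanish on the complement of \<open>\<F>\<close>: this is the first variation of the entropy functional at its minimum.
  Then \<open>\<Theta>\<^sub>F\<close> satisfies the recursion that determines \<open>Theta\<close>.\<close>

lemma solution_unique:
  assumes sol: "ltonp_solution W Wt F"
    and eq: "\<And>u. schur_entropy F u = schur_entropy F0 u"
  shows "taylor_coeff F = taylor_coeff F0"
proof -
  let ?T = "toeplitz_op F" and ?Ts = "cadjoint (toeplitz_op F)"
  note Fs = F_schur[OF sol] and T = T_clinear[OF sol] and Ts_Ws = Ts_Ws[OF sol]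
  note Ts = bounded_clinear_cadjoint[OF T]
  define C where "C z = Ws z - ?T (Wts z)" for z
  have C: "bounded_linear C" unfolding C_def[abs_def]
    by (intro bounded_clinear_linear bounded_clinear_minus bounded_clinear_cadjoint W_clinear
        bounded_clinear_compose[OF T] Wt_clinear)
  \<comment> \<open>Since \<open>?Ts (Ws z) = Wts z\<close> and \<open>?T\<close> is a contraction,
    the defect is dominated by \<open>norm_R_sq\<close>; this is the hypothesis of the
    factorization.\<close>
  have C_le: "norm (C z) \<le> norm (R z)" for z
  proof (rule power2_le_imp_le)
    have "inner (Ws z) (?T (Wts z)) = (norm (Wts z))\<^sup>2"
      by (subst inner_commute) (simp add: inner_cadjoint[OF T] Ts_Ws power2_norm_eq_inner)
    then have "(norm (C z))\<^sup>2 = (norm (Ws z))\<^sup>2 - 2 * (norm (Wts z))\<^sup>2 + (norm (?T (Wts z)))\<^sup>2"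
      unfolding C_def norm_diff_sq by simp
    moreover have "(norm (?T (Wts z)))\<^sup>2 \<le> (norm (Wts z))\<^sup>2"
      by (intro power_mono norm_toeplitz_op_le[OF Fs] norm_ge_zero)
    ultimately show "(norm (C z))\<^sup>2 \<le> (norm (R z))\<^sup>2" unfolding norm_R_sq by linarith
  qed simp
  \<comment> \<open>Real linearity of \<Gamma> is enough for comparing entries below;
    \<open>\<Gamma>0\<close> fixes \<Gamma> off the closed range of \<open>R\<close>.\<close>
  obtain \<Gamma> where \<Gamma>: "bounded_linear \<Gamma>" "\<And>z. \<Gamma> (R z) = C z"
    and \<Gamma>0: "\<And>x. (\<And>z. inner x (R z) = 0) \<Longrightarrow> \<Gamma> x = 0"
    using douglas_factorization[OF bounded_clinear_linear[OF R_clinear] C C_le] by metis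
  interpret \<Gamma>: bounded_linear \<Gamma> by (rule \<Gamma>(1))
  define \<Theta> where "\<Theta> p = ?T (embed0 (fst p)) + \<Gamma> (snd p)" for p
  have \<Theta>: "bounded_linear \<Theta>" unfolding \<Theta>_def[abs_def]
    by (intro bounded_linear_add bounded_linear_compose[OF \<Gamma>(1) bounded_linear_snd]
        bounded_linear_compose[OF bounded_clinear_linear[OF T]]
        bounded_linear_compose[OF bounded_clinear_linear[OF bounded_clinear_embed0]] bounded_linear_fst)
  interpret \<Theta>: bounded_linear \<Theta> by (rule \<Theta>)
  have \<Theta>_u: "\<Theta> (u, 0) = ?T (embed0 u)" for u by (simp add: \<Theta>_def \<Gamma>.zero)
  have \<Theta>_x: "\<Theta> (0, x) = \<Gamma> x" for x
    by (simp add: \<Theta>_def bounded_clinear_zero[OF T] bounded_clinear_zero[OF bounded_clinear_embed0])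
  have \<Theta>_K1s: "\<Theta> (K1s z) = Ws z - fwd_shift (?T (bwd_shift (Wts z)))" for z
  proof -
    have "?T (Wts z) = ?T (embed0 (ell2_nth (Wts z) 0)) + fwd_shift (?T (bwd_shift (Wts z)))"
      by (subst ell2_decompose[of "Wts z"])
         (simp add: bounded_clinear_add[OF T] toeplitz_op_fwd_shift[OF Fs])
    then show ?thesis by (simp add: \<Theta>_def K1s_def \<Gamma>(2) C_def)
  qed
  \<comment> \<open>Splitting \<open>Ws z\<close> into entry 0 and tail produces the two components
    of \<open>K2s z\<close>: the tail is \<open>Ws (Zs z)\<close> and combines with the second term
    to \<open>C (Zs z) = \<Gamma> (R (Zs z))\<close>.\<close>
  have rec_range: "\<Theta> (K1s z) = embed0 (fst (M (K1s z))) + fwd_shift (\<Gamma> (snd (M (K1s z))))" for z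
    unfolding M_K1s \<Theta>_K1s
    by (subst ell2_decompose[of "Ws z"])
       (simp add: K2s_def \<Gamma>(2) C_def Ws_Zs Wts_Zs bounded_clinear_diff[OF bounded_clinear_fwd_shift])
  have rec: "\<Theta> p = embed0 (fst (M p)) + fwd_shift (\<Gamma> (snd (M p)))" if "p \<in> FF" for p
  proof -
    have cont: "continuous_on UNIV (\<lambda>p. embed0 (fst (M p)) + fwd_shift (\<Gamma> (snd (M p))))"
      by (intro linear_continuous_on bounded_linear_add
          bounded_linear_compose[OF bounded_clinear_linear[OF bounded_clinear_embed0]]
          bounded_linear_compose[OF bounded_clinear_linear[OF bounded_clinear_fwd_shift]]
          bounded_linear_compose[OF \<Gamma>(1)]
          bounded_linear_compose[OF bounded_linear_fst] bounded_linear_compose[OF bounded_linear_snd]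
          bounded_clinear_linear[OF M_clinear])
    have "FF \<subseteq> {p. \<Theta> p = embed0 (fst (M p)) + fwd_shift (\<Gamma> (snd (M p)))}" unfolding FF_eq
      by (intro closure_minimal closed_Collect_eq[OF linear_continuous_on[OF \<Theta>] cont]) (auto simp: rec_range)
    then show ?thesis using that by blast
  qed
  have stationary: "\<Theta> ((u, 0) - orth_proj FF (u, 0)) = 0" for u
  proof (rule inner_eqI)
    fix g
    define c where "c = (norm g)\<^sup>2 - (norm (bwd_shift (?Ts g)))\<^sup>2"
    \<comment> \<open>An exact expansion of the functional at \<open>Ws z\<close> in an arbitrary
      direction \<open>g\<close>; its linear coefficient is a value of \<Theta>.\<close>
    have var: "entropy_form F u (Ws z + t *\<^sub>R g)
        = (norm ((u, 0) - K1s z))\<^sup>2 + 2 * t * inner (\<Theta> (K1s z - (u, 0))) g + t\<^sup>2 * c" for z t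
    proof -
      have 1: "?Ts (Ws z + t *\<^sub>R g) = Wts z + t *\<^sub>R ?Ts g"
        by (simp add: bounded_clinear_add[OF Ts] bounded_clinear_scaleR[OF Ts] Ts_Ws)
      have 2: "inner u (ell2_nth (?Ts g) 0) = inner (\<Theta> (u, 0)) g"
        by (simp add: \<Theta>_u inner_cadjoint[OF T] inner_embed0)
      have 3: "inner (bwd_shift (Wts z)) (bwd_shift (?Ts g))
          = inner (fwd_shift (?T (bwd_shift (Wts z)))) g"
        by (simp add: inner_cadjoint[OF T] flip: inner_fwd_shift toeplitz_op_fwd_shift[OF Fs])
      have 4: "ell2_nth (a + t *\<^sub>R b) 0 = ell2_nth a 0 + t *\<^sub>R ell2_nth b 0" for a b :: "'u ell2"
        by (simp add: plus_ell2.rep_eq scaleR_ell2.rep_eq)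
      have 5: "bwd_shift (a + t *\<^sub>R b) = bwd_shift a + t *\<^sub>R bwd_shift b" for a b :: "'u ell2"
        by (simp add: bounded_clinear_add[OF bounded_clinear_bwd_shift]
            bounded_clinear_scaleR[OF bounded_clinear_bwd_shift])
      have "entropy_form F u (Ws z + t *\<^sub>R g) = entropy_form F u (Ws z)
          + 2 * t * (inner (Ws z) g - inner (bwd_shift (Wts z)) (bwd_shift (?Ts g))
              - inner u (ell2_nth (?Ts g) 0)) + t\<^sup>2 * c"
        unfolding entropy_form_def 1 4 5 Ts_Ws norm_add_sq[of _ "t *\<^sub>R _"]
        by (simp add: c_def inner_add_right power_mult_distrib algebra_simps)
      also have "inner (Ws z) g - inner (bwd_shift (Wts z)) (bwd_shift (?Ts g))
              - inner u (ell2_nth (?Ts g) 0) = inner (\<Theta> (K1s z - (u, 0))) g"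
        unfolding 2 3 by (simp only: \<Theta>.diff \<Theta>_K1s inner_diff_left)
      finally show ?thesis by (simp only: entropy_form_Ws[OF sol])
    qed
    \<comment> \<open>Both sides are continuous in the pair, so \<open>K1s z\<close> may be replaced
      by the projection; there the constant term equals the entropy by the assumed equality and
      drops out.\<close>
    have "inner (\<Theta> (orth_proj FF (u, 0) - (u, 0))) g = 0"
    proof (rule quadratic_nonneg_imp_linear_zero)
      fix t
      have "continuous_on UNIV (\<lambda>p. \<Theta> (p - (u, 0)))"
        by (simp only: \<Theta>.diff) (intro continuous_intros linear_continuous_on \<Theta>)
      then have "FF \<subseteq> {p. schur_entropy F u
          \<le> (norm ((u, 0) - p))\<^sup>2 + 2 * t * inner (\<Theta> (p - (u, 0))) g + t\<^sup>2 * c}"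
        unfolding FF_eq
        by (intro closure_minimal closed_Collect_le continuous_intros)
           (auto simp flip: var intro: schur_entropy_le[OF Fs])
      then have "schur_entropy F u \<le> (norm ((u, 0) - orth_proj FF (u, 0)))\<^sup>2
          + 2 * t * inner (\<Theta> (orth_proj FF (u, 0) - (u, 0))) g + t\<^sup>2 * c"
        using F.orth_proj_mem by blast
      then show "0 \<le> 2 * t * inner (\<Theta> (orth_proj FF (u, 0) - (u, 0))) g + t\<^sup>2 * c"
        by (simp add: eq schur_entropy_F0)
    qed
    then show "inner (\<Theta> ((u, 0) - orth_proj FF (u, 0))) g = inner 0 g"
      by (simp add: \<Theta>.diff inner_diff_left)
  qed
  have vanish: "\<Theta> w = 0" if w: "\<And>q. q \<in> FF \<Longrightarrow> inner w q = 0" for w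
  proof -
    \<comment> \<open>\<open>N\<close> is the kernel of \<Theta> inside the complement of
      \<open>FF\<close>, to be shown to be all of it. A residual \<open>m\<close> is orthogonal to
      the stationary vectors, which removes its input component; orthogonality to each
      \<open>K1s z\<close> then leaves a state orthogonal to \<open>range R\<close>, where \<Gamma>
      vanishes.\<close>
    define N where "N = {p. \<Theta> p = 0} \<inter> (\<Inter>q\<in>FF. {p. inner p q = 0})"
    have "subspace N"
      by (auto simp: N_def subspace_def \<Theta>.zero \<Theta>.add \<Theta>.scaleR inner_add_left)
    moreover have "closed N" unfolding N_def
      by (intro closed_Int closed_INT ballI closed_Collect_eq linear_continuous_on \<Theta> continuous_intros)
    ultimately obtain n where n: "n \<in> N" "\<And>q. q \<in> N \<Longrightarrow> inner (w - n) q = 0"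
      using orthogonal_projection_exists by blast
    define m where "m = w - n"
    have mF: "inner m q = 0" if "q \<in> FF" for q
      using w[OF that] n(1) that by (simp add: m_def N_def inner_diff_left)
    have "inner (fst m) u = 0" for u
    proof -
      have "(u, 0) - orth_proj FF (u, 0) \<in> N"
        using stationary F.orth_proj_orth by (simp add: N_def)
      then have "inner m ((u, 0) - orth_proj FF (u, 0)) = 0" using n(2) by (simp add: m_def)
      then have "inner m (u, 0) = 0"
        using mF[OF F.orth_proj_mem] by (simp add: inner_diff_right)
      then show ?thesis by (simp add: inner_prod_def)
    qed
    from this[of "fst m"] have m1: "fst m = 0" by simp
    have "inner (snd m) (R z) = 0" for z
      using mF[OF K1s_mem, of z] m1 by (simp add: inner_prod_def K1s_def)
    then have "\<Gamma> (snd m) = 0" by (rule \<Gamma>0)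
    then have "\<Theta> m = 0" using \<Theta>_x[of "snd m"] m1 by (metis prod.collapse)
    then have "m \<in> N" using mF by (simp add: N_def)
    then have "inner m m = 0" using n(2) by (simp add: m_def)
    then have "w = n" by (simp add: m_def)
    then show ?thesis using n(1) by (simp add: N_def)
  qed
  have \<Theta>_rec: "\<Theta> p = embed0 (fst (M p)) + fwd_shift (\<Theta> (0, snd (M p)))" for p
  proof -
    have "\<Theta> (p - orth_proj FF p) = 0" by (rule vanish) (rule F.orth_proj_orth)
    then have "\<Theta> p = \<Theta> (orth_proj FF p)" by (simp add: \<Theta>.diff)
    then show ?thesis using rec[OF F.orth_proj_mem, of p] by (simp add: \<Theta>_x M_orth_proj)
  qed
  have "ell2_nth (\<Theta> p) n = out n p" for n p
  proof (induction n arbitrary: p)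
    case 0
    show ?case by (subst \<Theta>_rec) (simp add: plus_ell2.rep_eq embed0.rep_eq fwd_shift.rep_eq)
  next
    case (Suc n)
    show ?case by (subst \<Theta>_rec) (simp add: plus_ell2.rep_eq embed0.rep_eq fwd_shift.rep_eq Suc)
  qed
  then have "taylor_coeff F n u = taylor_coeff F0 n u" for n u
    by (simp add: taylor_coeff_F0 flip: ell2_nth_toeplitz_op_embed0[OF Fs] \<Theta>_u)
  then show ?thesis by (intro ext)
qed

text \<open>Taylor coefficients mediate in both directions: they determine the values on the disc as
  well as the Toeplitz operator, hence the entropy.\<close>

lemma entropy_eq_iff:
  assumes sol: "ltonp_solution W Wt F"
  shows "(\<forall>u. schur_entropy F u = schur_entropy F0 u) \<longleftrightarrow> (\<forall>\<zeta>\<in>ball 0 1. F \<zeta> = F0 \<zeta>)"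
proof
  assume "\<forall>u. schur_entropy F u = schur_entropy F0 u"
  then have *: "taylor_coeff F = taylor_coeff F0" using solution_unique[OF sol] by simp
  show "\<forall>\<zeta>\<in>ball 0 1. F \<zeta> = F0 \<zeta>"
  proof (intro ballI ext)
    fix \<zeta> :: complex and u assume "\<zeta> \<in> ball 0 1"
    then have z: "norm \<zeta> < 1" by simp
    show "F \<zeta> u = F0 \<zeta> u"
      using taylor_coeff_sums[OF F_schur[OF sol] z, of u] taylor_coeff_sums[OF F0_schur z, of u]
      unfolding * by (rule sums_unique2)
  qed
next
  assume "\<forall>\<zeta>\<in>ball 0 1. F \<zeta> = F0 \<zeta>"
  then have "taylor_coeff F = taylor_coeff F0" by (intro taylor_coeff_cong) simp
  then have "toeplitz_op F = toeplitz_op F0" by (simp add: toeplitz_op_def fun_eq_iff)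
  then show "\<forall>u. schur_entropy F u = schur_entropy F0 u" by (simp add: schur_entropy_def)
qed

section \<open>The entropy of the central solution\<close>

sublocale G: closed_csubspace "G_space W Wt"
proof
  have eq: "G_space W Wt = (UNIV \<times> ZZ) \<inter> (\<Inter>y\<in>FF. {x. cinner x y = 0})"
    by (auto simp: G_space_def orth_diff_def)
  show "csubspace (G_space W Wt)"
    unfolding csubspace_def subspace_def eq using Z0.csub
    by (auto simp: csubspace_def subspace_def mem_Times_iff cinner_add_left cinner_scaleC_left
        fst_scaleC snd_scaleC simp flip: scaleC_of_real)
  show "closed (G_space W Wt)" unfolding eq
    by (intro closed_Int closed_Times closed_UNIV Z0.closed closed_INT ballI closed_Collect_eq
        linear_continuous_on bounded_linear_cinner_left continuous_on_const)
qed

text \<open>\<open>G_space\<close> is the complement of \<open>FF\<close> only within the pairs with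
  state in \<open>ZZ\<close>; the residual stays there because \<open>(u, 0)\<close> and its
  projection do.\<close>

lemma orth_proj_G: "orth_proj (G_space W Wt) (u, 0) = (u, 0) - orth_proj FF (u, 0)"
proof (rule G.orth_proj_eqI)
  have "orth_proj FF (u, 0) \<in> UNIV \<times> ZZ" using F.orth_proj_mem FF_subset by blast
  then have "snd (orth_proj FF (u, 0)) \<in> ZZ" by auto
  then have "(u, 0) - orth_proj FF (u, 0) \<in> UNIV \<times> ZZ"
    using Z0.sub by (auto simp: mem_Times_iff subspace_neg)
  then show "(u, 0) - orth_proj FF (u, 0) \<in> G_space W Wt"
    using F.orth_proj_spec by (simp add: G_space_def orth_diff_def)
  fix m assume "m \<in> G_space W Wt"
  then have "inner m (orth_proj FF (u, 0)) = 0"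
    using F.orth_proj_mem by (simp add: G_space_def orth_diff_def flip: Re_cinner)
  then show "inner ((u, 0) - ((u, 0) - orth_proj FF (u, 0))) m = 0" by (simp add: inner_commute)
qed

lemma schur_entropy_F0_G:
  "complex_of_real (schur_entropy F0 u) = cinner (orth_proj (G_space W Wt) (u, 0)) (u, 0)"
proof -
  let ?q = "(u, 0) - orth_proj FF (u, 0)"
  have "cinner ?q (u, 0) = cinner ?q (?q + orth_proj FF (u, 0))" by simp
  also have "\<dots> = cinner ?q ?q + cinner ?q (orth_proj FF (u, 0))" by (rule cinner_add_right)
  also have "cinner ?q (orth_proj FF (u, 0)) = 0"
    using F.orth_proj_spec F.orth_proj_mem by blast
  finally show ?thesis by (simp only: orth_proj_G schur_entropy_F0 cinner_self add_0_right)
qed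

text \<open>Here the projection is attained at some \<open>K1s z\<close>. Orthogonality of the
  residual \<open>(v, - R z)\<close> says \<open>Bt v = L z\<close>; eliminating \<open>z\<close>
  shows that \<open>v\<close> solves the linear equation with right-hand side \<open>u\<close>, and
  the entropy is \<open>cinner v u\<close>.\<close>

lemma schur_entropy_F0_strictly_positive:
  assumes "strictly_positive_op L"
  shows "complex_of_real (schur_entropy F0 u)
    = cinner (inv (\<lambda>v. v + cadjoint (Wt \<circ> embed0) (inv L ((Wt \<circ> embed0) v))) u) u"
proof -
  define Bt where "Bt = Wt \<circ> embed0"
  have Bt: "bounded_clinear Bt"
    using bounded_clinear_compose[OF Wt_clinear bounded_clinear_embed0] by (simp add: Bt_def o_def)
  have Bts: "cadjoint Bt = (\<lambda>z. ell2_nth (Wts z) 0)"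
    by (rule cadjoint_eqI[OF Bt]) (simp add: Bt_def inner_cadjoint[OF Wt_clinear] inner_embed0)
  obtain S where S: "bounded_clinear S" "S \<circ> L = id" "L \<circ> S = id"
    using assms by (auto simp: strictly_positive_op_def invertible_op_def)
  have SL: "S (L z) = z" and LS: "L (S z) = z" for z
    using S(2,3) by (auto simp: fun_eq_iff)
  have invL: "inv L = S" using S by (intro inv_unique_comp) auto
  obtain k where k: "\<And>z. norm (S z) \<le> norm z * k" "k > 0"
    using bounded_linear.pos_bounded[OF bounded_clinear_linear[OF S(1)]] by blast
  obtain c where c: "c > 0" "\<And>z. norm (R z) \<le> c * norm z"
    using nonneg_op_bound_exists[OF R_nonneg] by blast
  \<comment> \<open>Invertibility of L = R R bounds \<open>R\<close>, and with it
    \<open>K1s\<close>, from below, so the range of \<open>K1s\<close> is already closed.\<close>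
  have below: "norm (K1s z) \<ge> 1 / (k * c) * norm z" for z
  proof -
    have "norm z \<le> norm (L z) * k" using k(1)[of "L z"] by (simp add: SL)
    also have "\<dots> \<le> c * norm (R z) * k" using c(2)[of "R z"] k(2) by (simp add: R_R)
    also have "\<dots> \<le> c * norm (K1s z) * k"
      using c(1) k(2) norm_snd_le[of "R z" "ell2_nth (Wts z) 0"] by (simp add: K1s_def)
    finally show ?thesis using c(1) k(2) by (simp add: field_simps)
  qed
  have "complete (range K1s)"
    by (rule complete_isometric_image[where e="1 / (k * c)"])
       (use below c(1) k(2) bounded_clinear_linear[OF K1s_clinear] in \<open>auto simp: complete_UNIV\<close>)
  then have "FF = range K1s" by (simp add: FF_eq complete_eq_closed)
  then obtain z where z: "orth_proj FF (u, 0) = K1s z" using F.orth_proj_mem by blast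
  define v where "v = u - cadjoint Bt z"
  have q: "(u, 0) - orth_proj FF (u, 0) = (v, - R z)" by (simp add: z v_def K1s_def Bts)
  have "Bt v = L z"
  proof (rule inner_eqI)
    fix y
    have "inner (v, - R z) (K1s y) = 0" unfolding q[symmetric] by (rule F.orth_proj_orth[OF K1s_mem])
    then have "inner v (cadjoint Bt y) = inner (R z) (R y)" by (simp add: K1s_def Bts)
    then show "inner (Bt v) y = inner (L z) y"
      by (simp only: inner_cadjoint[OF Bt] R_R[symmetric] R_sa)
  qed
  then have fv: "v + cadjoint Bt (S (Bt v)) = u" by (simp add: SL v_def)
  \<comment> \<open>Pairing with \<open>d\<close> gives \<open>inner d d\<close> plus a value of the
    nonnegative form of \<open>L\<close>; injectivity is what identifies \<open>inv\<close> with the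
    solution \<open>v\<close>.\<close>
  have "inj (\<lambda>v. v + cadjoint Bt (S (Bt v)))"
  proof (rule injI)
    fix a b assume ab: "a + cadjoint Bt (S (Bt a)) = b + cadjoint Bt (S (Bt b))"
    define d where "d = a - b"
    have cl: "bounded_clinear (\<lambda>v. v + cadjoint Bt (S (Bt v)))"
      by (intro bounded_clinear_plus bounded_clinear_ident
          bounded_clinear_compose[OF bounded_clinear_cadjoint[OF Bt]] bounded_clinear_compose[OF S(1)] Bt)
    have "d + cadjoint Bt (S (Bt d)) = 0" using bounded_clinear_diff[OF cl, of a b] ab by (simp add: d_def)
    then have "inner (d + cadjoint Bt (S (Bt d))) d = 0" by simp
    then have "inner d d + inner (S (Bt d)) (L (S (Bt d))) = 0"
      by (simp add: inner_add_left inner_cadjoint_left[OF Bt] LS)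
    moreover have "0 \<le> inner (S (Bt d)) (L (S (Bt d)))"
      using nonneg_op_inner[OF pick_nonneg] by (simp add: inner_commute)
    ultimately have "inner d d = 0" using inner_ge_zero[of d] by linarith
    then show "a = b" by (simp add: d_def)
  qed
  then have "inv (\<lambda>v. v + cadjoint Bt (S (Bt v))) u = v" using fv by (rule inv_f_eq)
  then show ?thesis
    unfolding invL Bt_def[symmetric] schur_entropy_F0_G orth_proj_G q by (simp add: cinner_prod_def
        cinner_eq_Complex[of _ "0::'z"] complex_eq_iff)
qed

end

theorem theorem7p1:
  fixes W :: "'y::chilbert_space ell2 \<Rightarrow> 'z::chilbert_space"
    and Wt :: "'u::chilbert_space ell2 \<Rightarrow> 'z"
    and Z :: "'z \<Rightarrow> 'z"
  assumes "ltonp_data W Wt Z"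
    and "nonneg_op (pick_op W Wt)"
  shows "ltonp_solution W Wt (central_solution W Wt Z)
    \<and> (\<forall>F. ltonp_solution W Wt F \<longrightarrow>
          (\<forall>u. schur_entropy F u \<le> schur_entropy (central_solution W Wt Z) u))
    \<and> (\<forall>F. ltonp_solution W Wt F \<longrightarrow>
          ((\<forall>u. schur_entropy F u = schur_entropy (central_solution W Wt Z) u)
            \<longleftrightarrow> (\<forall>\<zeta>\<in>ball 0 1. F \<zeta> = central_solution W Wt Z \<zeta>)))
    \<and> (\<forall>u. complex_of_real (schur_entropy (central_solution W Wt Z) u)
          = cinner (orth_proj (G_space W Wt) (u, 0)) (u, 0))
    \<and> (strictly_positive_op (pick_op W Wt) \<longrightarrow>
          (\<forall>u. complex_of_real (schur_entropy (central_solution W Wt Z) u)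
            = cinner (inv (\<lambda>v. v + cadjoint (Wt \<circ> embed0)
                (inv (pick_op W Wt) ((Wt \<circ> embed0) v))) u) u))"
proof -
  interpret ltonp W Wt Z using assms by unfold_locales
  show ?thesis
    using F0_solution schur_entropy_le_dist entropy_eq_iff schur_entropy_F0_G
      schur_entropy_F0_strictly_positive by (auto simp: schur_entropy_F0)
qed

end
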